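(* Let $A$ be a unital star algebra over $\mathbb{C}$ and let $L$ be a left line module over $A$ with a star operation $\star:L\to\overline{L}$, $\star(e)=\overline{e^*}$. Assume that there is a non-degenerate Hermitian metric $G:\overline{L}\to L^\circ$ on $L$ which is star compatible, with inner product $\langle e,\overline f\rangle=\mathrm{ev}(e\otimes G(\overline f))$. Then: (a) The star algebra $T_{\mathbb{N}}(L)$ is isomorphic as an $\mathbb{N}$-graded algebra to $$A\otimes_{\mathbb{C}}P(\xi)\ \oplus\ L\otimes_{\mathbb{C}}P(\xi),$$ where $P(\xi)$ is the polynomial algebra $\mathbb{C}[\xi]$ in a variable $\xi$ of degree $2$, $A$ has degree $0$ and $L$ has degree $1$. The product is given by $\xi$ being central, the product of $A$, the bimodule actions of $A$ on $L$, and $e\,f=\langle e,\overline{f^*}\rangle\,\xi$ for $e,f\in L$. The star operation is given by that specified on $A$ and $L$, together with $\xi^*=\xi$. (b) The even-odd graded algebra $A\oplus L$ ($A$ even, $L$ odd), with product $e\,f=\langle e,\overline{f^*}\rangle$ for $e,f\in L$ (and the product of $A$ and the bimodule actions otherwise), is a $\mathbb{Z}/2$-graded Hopf-Galois extension of $A$.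
   Context: For an $A$-bimodule $E$, $E^\circ={}_A\mathrm{Hom}(E,A)$ (left module maps), a bimodule with $(\alpha.a)(e)=\alpha(e)a$ and $(a.\alpha)(e)=\alpha(e.a)$. If $E$ is finitely generated projective as a left module, with dual basis $e^i\in E$, $e_i\in E^\circ$ ($f=\sum_i e_i(f).e^i$ for all $f\in E$), there are bimodule maps $\mathrm{ev}:E\otimes_A E^\circ\to A$, $\mathrm{ev}(e\otimes\alpha)=\alpha(e)$, and $\mathrm{coev}:A\to E^\circ\otimes_A E$, $\mathrm{coev}(1)=\sum_i e_i\otimes e^i$. A left line module is an $A$-bimodule $L$, finitely generated projective as a left module, such that $\mathrm{coev}:A\to L^\circ\otimes_A L$ and $\mathrm{ev}:L\otimes_A L^\circ\to A$ are isomorphisms. The conjugate bimodule $\overline{E}$ is the conjugate vector space with elements $\overline{e}$, $e\in E$, and $a.\overline{e}=\overline{e.a^*}$, $\overline{e}.a=\overline{a^*.e}$. A star operation on $L$ is a bimodule map $\star:L\to\overline L$, written $\star(e)=\overline{e^*}$, with $e^{**}=e$ (so $(a.e.b)^*=b^*.e^*.a^*$). A non-degenerate Hermitian metric (structure) on $L$ is an invertible bimodule map $G:\overline{L}\to L^\circ$ such that $\langle e,\overline{f}\rangle=\mathrm{ev}(e\otimes G(\overline f))$ satisfies $\langle e,\overline f\rangle=\langle f,\overline e\rangle^*$. Write $G\star:L\to L^\circ$ for the composite bimodule isomorphism $e\mapsto G(\overline{e^*})$. $G$ is star compatible if the element $\alpha\in A$ defined as the image of $1_A$ under $$A\xrightarrow{\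 \mathrm{coev}\ }L^\circ\otimes_A L\xrightarrow{(G\star)^{-1}\otimes G\star}L\otimes_A L^\circ\xrightarrow{\ \mathrm{ev}\ }A$$ equals $1_A$. $T_{\mathbb{N}}(L)=A\oplus L\oplus(L\otimes_A L)\oplus\cdots$ is the tensor algebra with product $\otimes_A$, graded by tensor degree, and star operation $(x_1\otimes\cdots\otimes x_m)^*=x_m^*\otimes\cdots\otimes x_1^*$. A $\mathbb{Z}/2$-graded algebra $C=C_0\oplus C_1$ is a $\mathbb{Z}/2$ Hopf-Galois extension of $C_0$ if, for the $\mathbb{C}[\mathbb{Z}/2]$-coaction $c\mapsto c\otimes\underline{n}$ ($c\in C_n$, $\underline n$ the basis element of $\mathbb{C}[\mathbb{Z}/2]$ corresponding to $n$), the canonical map $C\otimes_{C_0}C\to C\otimes\mathbb{C}[\mathbb{Z}/2]$, $c\otimes c'\mapsto cc'\otimes\underline m$ for $c'\in C_m$, is bijective. *)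

theory Defs
  imports
    Complex_Main
    "HOL-Algebra.QuotRing"
    "HOL-Algebra.Module"
    "HOL-Algebra.Free_Abelian_Groups"
    "HOL-Algebra.Algebraic_Closure_Type"
    "HOL-Computational_Algebra.Polynomial"
    "HOL-Library.Z2"
begin

section \<open>Complex algebras, star algebras, gradings\<close>

abbreviation complex_ring :: "complex ring"
  where "complex_ring \<equiv> ring_of_type_algebra"

locale complex_algebra = ring A for A :: "(complex, 'a, 'z) module_scheme" (structure) +
  assumes vector_space: "module complex_ring A"
    and smult_mult_left:
      "\<lbrakk>x \<in> carrier A; y \<in> carrier A\<rbrakk> \<Longrightarrow> (c \<odot> x) \<otimes> y = c \<odot> (x \<otimes> y)"
    and smult_mult_right:
      "\<lbrakk>x \<in> carrier A; y \<in> carrier A\<rbrakk> \<Longrightarrow> x \<otimes> (c \<odot> y) = c \<odot> (x \<otimes> y)"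

record 'a star_algebra = "(complex, 'a) module" +
  star :: "'a \<Rightarrow> 'a"

locale star_algebra = complex_algebra A for A :: "('a, 'z) star_algebra_scheme" (structure) +
  assumes star_closed: "x \<in> carrier A \<Longrightarrow> star A x \<in> carrier A"
    and star_add: "\<lbrakk>x \<in> carrier A; y \<in> carrier A\<rbrakk> \<Longrightarrow> star A (x \<oplus> y) = star A x \<oplus> star A y"
    and star_smult: "x \<in> carrier A \<Longrightarrow> star A (c \<odot> x) = cnj c \<odot> star A x"
    and star_mult: "\<lbrakk>x \<in> carrier A; y \<in> carrier A\<rbrakk> \<Longrightarrow> star A (x \<otimes> y) = star A y \<otimes> star A x"
    and star_star: "x \<in> carrier A \<Longrightarrow> star A (star A x) = x"

definition homogeneous_decomposition ::
    "('c, 'z) ring_scheme \<Rightarrow> ('i \<Rightarrow> 'c set) \<Rightarrow> 'c \<Rightarrow> ('i \<Rightarrow> 'c) \<Rightarrow> bool"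
  where "homogeneous_decomposition C gr x f \<longleftrightarrow>
    (\<forall>i. f i \<in> gr i) \<and> finite {i. f i \<noteq> \<zero>\<^bsub>C\<^esub>} \<and> x = (\<Oplus>\<^bsub>C\<^esub>i\<in>{i. f i \<noteq> \<zero>\<^bsub>C\<^esub>}. f i)"

definition homogeneous_component ::
    "('c, 'z) ring_scheme \<Rightarrow> ('i \<Rightarrow> 'c set) \<Rightarrow> 'i \<Rightarrow> 'c \<Rightarrow> 'c"
  where "homogeneous_component C gr i x = (THE f. homogeneous_decomposition C gr x f) i"

locale graded_algebra = complex_algebra C
  for C :: "(complex, 'c, 'z) module_scheme" (structure)
    and gr :: "'i::comm_monoid_add \<Rightarrow> 'c set" +
  assumes gr_subspace: "submodule (gr i) complex_ring C"
    and gr_one: "\<one> \<in> gr 0"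
    and gr_mult: "\<lbrakk>x \<in> gr i; y \<in> gr j\<rbrakk> \<Longrightarrow> x \<otimes> y \<in> gr (i + j)"
    and gr_direct_sum: "x \<in> carrier C \<Longrightarrow> \<exists>!f. homogeneous_decomposition C gr x f"

definition graded_star_algebra_iso ::
    "('c, 'y) star_algebra_scheme \<Rightarrow> ('i \<Rightarrow> 'c set) \<Rightarrow>
     ('d, 'z) star_algebra_scheme \<Rightarrow> ('i \<Rightarrow> 'd set) \<Rightarrow> ('c \<Rightarrow> 'd) \<Rightarrow> bool"
  where "graded_star_algebra_iso C gr D gr' h \<longleftrightarrow>
    h \<in> ring_iso C D \<and>
    (\<forall>c. \<forall>x\<in>carrier C. h (c \<odot>\<^bsub>C\<^esub> x) = c \<odot>\<^bsub>D\<^esub> h x) \<and>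
    (\<forall>x\<in>carrier C. h (star C x) = star D (h x)) \<and>
    (\<forall>i. h ` gr i = gr' i)"


section \<open>Bimodules\<close>

text \<open>
  As in the HOL-Algebra theory of modules, the fields for the multiplication and its unit are part
  of the record but carry no meaning for bimodules. The complex vector space structure of a bimodule
  over a complex algebra is the one obtained from the scalars in the algebra.
\<close>

record ('a, 'm) bimodule = "('a, 'm) module" +
  rsmult :: "'m \<Rightarrow> 'a \<Rightarrow> 'm"  (infixl \<open>\<bullet>\<index>\<close> 70)

locale bimodule = A?: complex_algebra A + M?: abelian_group M
  for A :: "(complex, 'a, 'z) module_scheme" (structure)
    and M :: "('a, 'm) bimodule" (structure) +
  assumes lact_closed:
      "\<lbrakk>a \<in> carrier A; x \<in> carrier M\<rbrakk> \<Longrightarrow> a \<odot>\<^bsub>M\<^esub> x \<in> carrier M"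
    and ract_closed:
      "\<lbrakk>a \<in> carrier A; x \<in> carrier M\<rbrakk> \<Longrightarrow> x \<bullet>\<^bsub>M\<^esub> a \<in> carrier M"
    and lact_add_scalar: "\<lbrakk>a \<in> carrier A; b \<in> carrier A; x \<in> carrier M\<rbrakk> \<Longrightarrow>
      (a \<oplus>\<^bsub>A\<^esub> b) \<odot>\<^bsub>M\<^esub> x = a \<odot>\<^bsub>M\<^esub> x \<oplus>\<^bsub>M\<^esub> b \<odot>\<^bsub>M\<^esub> x"
    and ract_add_scalar: "\<lbrakk>a \<in> carrier A; b \<in> carrier A; x \<in> carrier M\<rbrakk> \<Longrightarrow>
      x \<bullet>\<^bsub>M\<^esub> (a \<oplus>\<^bsub>A\<^esub> b) = x \<bullet>\<^bsub>M\<^esub> a \<oplus>\<^bsub>M\<^esub> x \<bullet>\<^bsub>M\<^esub> b"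
    and lact_add: "\<lbrakk>a \<in> carrier A; x \<in> carrier M; y \<in> carrier M\<rbrakk> \<Longrightarrow>
      a \<odot>\<^bsub>M\<^esub> (x \<oplus>\<^bsub>M\<^esub> y) = a \<odot>\<^bsub>M\<^esub> x \<oplus>\<^bsub>M\<^esub> a \<odot>\<^bsub>M\<^esub> y"
    and ract_add: "\<lbrakk>a \<in> carrier A; x \<in> carrier M; y \<in> carrier M\<rbrakk> \<Longrightarrow>
      (x \<oplus>\<^bsub>M\<^esub> y) \<bullet>\<^bsub>M\<^esub> a = x \<bullet>\<^bsub>M\<^esub> a \<oplus>\<^bsub>M\<^esub> y \<bullet>\<^bsub>M\<^esub> a"
    and lact_mult: "\<lbrakk>a \<in> carrier A; b \<in> carrier A; x \<in> carrier M\<rbrakk> \<Longrightarrow>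
      (a \<otimes>\<^bsub>A\<^esub> b) \<odot>\<^bsub>M\<^esub> x = a \<odot>\<^bsub>M\<^esub> (b \<odot>\<^bsub>M\<^esub> x)"
    and ract_mult: "\<lbrakk>a \<in> carrier A; b \<in> carrier A; x \<in> carrier M\<rbrakk> \<Longrightarrow>
      x \<bullet>\<^bsub>M\<^esub> (a \<otimes>\<^bsub>A\<^esub> b) = (x \<bullet>\<^bsub>M\<^esub> a) \<bullet>\<^bsub>M\<^esub> b"
    and lact_one: "x \<in> carrier M \<Longrightarrow> \<one>\<^bsub>A\<^esub> \<odot>\<^bsub>M\<^esub> x = x"
    and ract_one: "x \<in> carrier M \<Longrightarrow> x \<bullet>\<^bsub>M\<^esub> \<one>\<^bsub>A\<^esub> = x"
    and lact_ract: "\<lbrakk>a \<in> carrier A; b \<in> carrier A; x \<in> carrier M\<rbrakk> \<Longrightarrow>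
      (a \<odot>\<^bsub>M\<^esub> x) \<bullet>\<^bsub>M\<^esub> b = a \<odot>\<^bsub>M\<^esub> (x \<bullet>\<^bsub>M\<^esub> b)"
    and complex_central: "x \<in> carrier M \<Longrightarrow>
      (c \<odot>\<^bsub>A\<^esub> \<one>\<^bsub>A\<^esub>) \<odot>\<^bsub>M\<^esub> x = x \<bullet>\<^bsub>M\<^esub> (c \<odot>\<^bsub>A\<^esub> \<one>\<^bsub>A\<^esub>)"

definition bimod_hom ::
    "('a, 'z) ring_scheme \<Rightarrow> ('a, 'm) bimodule \<Rightarrow> ('a, 'n) bimodule \<Rightarrow> ('m \<Rightarrow> 'n) set"
  where "bimod_hom A M N = {h. h \<in> carrier M \<rightarrow> carrier N \<and>
    (\<forall>x\<in>carrier M. \<forall>y\<in>carrier M. h (x \<oplus>\<^bsub>M\<^esub> y) = h x \<oplus>\<^bsub>N\<^esub> h y) \<and>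
    (\<forall>a\<in>carrier A. \<forall>x\<in>carrier M. h (a \<odot>\<^bsub>M\<^esub> x) = a \<odot>\<^bsub>N\<^esub> h x \<and> h (x \<bullet>\<^bsub>M\<^esub> a) = h x \<bullet>\<^bsub>N\<^esub> a)}"

definition bimod_iso ::
    "('a, 'z) ring_scheme \<Rightarrow> ('a, 'm) bimodule \<Rightarrow> ('a, 'n) bimodule \<Rightarrow> ('m \<Rightarrow> 'n) set"
  where "bimod_iso A M N = {h \<in> bimod_hom A M N. bij_betw h (carrier M) (carrier N)}"

definition regular_bimodule :: "('a, 'z) ring_scheme \<Rightarrow> ('a, 'a) bimodule"
  where "regular_bimodule A = \<lparr>carrier = carrier A, monoid.mult = monoid.mult A, one = one A,
    zero = zero A, add = add A, module.smult = monoid.mult A, rsmult = monoid.mult A\<rparr>"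

text \<open>The underlying complex vector space, as a bimodule over the complex numbers.\<close>

definition complex_restrict ::
    "(complex, 'a, 'z) module_scheme \<Rightarrow> ('a, 'm) bimodule \<Rightarrow> (complex, 'm) bimodule"
  where "complex_restrict A M = \<lparr>carrier = carrier M, monoid.mult = monoid.mult M, one = one M,
    zero = zero M, add = add M,
    module.smult = (\<lambda>c x. (c \<odot>\<^bsub>A\<^esub> \<one>\<^bsub>A\<^esub>) \<odot>\<^bsub>M\<^esub> x),
    rsmult = (\<lambda>x c. x \<bullet>\<^bsub>M\<^esub> (c \<odot>\<^bsub>A\<^esub> \<one>\<^bsub>A\<^esub>))\<rparr>"

text \<open>The element \<open>x\<close> of the conjugate bimodule stands for the barred \<open>x\<close>.\<close>

definition conj_bimodule :: "('a, 'z) star_algebra_scheme \<Rightarrow> ('a, 'm) bimodule \<Rightarrow> ('a, 'm) bimodule"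
  where "conj_bimodule A M = \<lparr>carrier = carrier M, monoid.mult = monoid.mult M, one = one M,
    zero = zero M, add = add M,
    module.smult = (\<lambda>a x. x \<bullet>\<^bsub>M\<^esub> star A a),
    rsmult = (\<lambda>x a. star A a \<odot>\<^bsub>M\<^esub> x)\<rparr>"

text \<open>
  The left module maps from \<open>M\<close> to \<open>A\<close>; they are extensional, so that equal maps on the carrier are
  equal elements.
\<close>

definition dual_bimodule :: "('a, 'z) ring_scheme \<Rightarrow> ('a, 'm) bimodule \<Rightarrow> ('a, 'm \<Rightarrow> 'a) bimodule"
  where "dual_bimodule A M = \<lparr>
    carrier = {\<alpha> \<in> carrier M \<rightarrow>\<^sub>E carrier A.
      (\<forall>x\<in>carrier M. \<forall>y\<in>carrier M. \<alpha> (x \<oplus>\<^bsub>M\<^esub> y) = \<alpha> x \<oplus>\<^bsub>A\<^esub> \<alpha> y) \<and>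
      (\<forall>a\<in>carrier A. \<forall>x\<in>carrier M. \<alpha> (a \<odot>\<^bsub>M\<^esub> x) = a \<otimes>\<^bsub>A\<^esub> \<alpha> x)},
    monoid.mult = undefined, one = undefined,
    zero = (\<lambda>x\<in>carrier M. \<zero>\<^bsub>A\<^esub>),
    add = (\<lambda>\<alpha> \<beta>. \<lambda>x\<in>carrier M. \<alpha> x \<oplus>\<^bsub>A\<^esub> \<beta> x),
    module.smult = (\<lambda>a \<alpha>. \<lambda>x\<in>carrier M. \<alpha> (x \<bullet>\<^bsub>M\<^esub> a)),
    rsmult = (\<lambda>\<alpha> a. \<lambda>x\<in>carrier M. \<alpha> x \<otimes>\<^bsub>A\<^esub> a)\<rparr>"


section \<open>Tensor products\<close>

text \<open>
  The abelian group with generators \<open>S\<close> and relators \<open>r\<close>, the class of a generator, and the map out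
  of it into an abelian group \<open>P\<close> determined by its values \<open>f\<close> on the generators (which has
  a meaning only if the additive extension of \<open>f\<close> kills the relators).
\<close>

definition presented_group :: "'x set \<Rightarrow> ('x \<Rightarrow>\<^sub>0 int) set \<Rightarrow> ('x \<Rightarrow>\<^sub>0 int) set ring"
  where "presented_group S r =
    (let F = free_Abelian_group S; Q = F Mod generate F r
     in \<lparr>carrier = carrier Q, monoid.mult = undefined, one = undefined,
         zero = one Q, add = monoid.mult Q\<rparr>)"

definition generator_class :: "'x set \<Rightarrow> ('x \<Rightarrow>\<^sub>0 int) set \<Rightarrow> 'x \<Rightarrow> ('x \<Rightarrow>\<^sub>0 int) set"
  where "generator_class S r x =
    generate (free_Abelian_group S) r #>\<^bsub>free_Abelian_group S\<^esub> frag_of x"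

definition extend_additively ::
    "('p, 'z) ring_scheme \<Rightarrow> ('x \<Rightarrow> 'p) \<Rightarrow> ('x \<Rightarrow>\<^sub>0 int) set \<Rightarrow> 'p"
  where "extend_additively P f U =
    the_elem ((\<lambda>c. \<Oplus>\<^bsub>P\<^esub>x\<in>Poly_Mapping.keys c. [Poly_Mapping.lookup c x] \<cdot>\<^bsub>P\<^esub> f x) ` U)"

definition extend_biadditively ::
    "('p, 'z) ring_scheme \<Rightarrow> ('x \<Rightarrow> 'y \<Rightarrow> 'p) \<Rightarrow> ('x \<Rightarrow>\<^sub>0 int) set \<Rightarrow> ('y \<Rightarrow>\<^sub>0 int) set \<Rightarrow> 'p"
  where "extend_biadditively P f U W =
    extend_additively P (\<lambda>x. extend_additively P (f x) W) U"

definition tensor_relators ::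
    "('a, 'z) ring_scheme \<Rightarrow> ('a, 'm) bimodule \<Rightarrow> ('a, 'n) bimodule \<Rightarrow> ('m \<times> 'n \<Rightarrow>\<^sub>0 int) set"
  where "tensor_relators A M N =
    {frag_of (x \<oplus>\<^bsub>M\<^esub> x', y) - frag_of (x, y) - frag_of (x', y) | x x' y.
       x \<in> carrier M \<and> x' \<in> carrier M \<and> y \<in> carrier N} \<union>
    {frag_of (x, y \<oplus>\<^bsub>N\<^esub> y') - frag_of (x, y) - frag_of (x, y') | x y y'.
       x \<in> carrier M \<and> y \<in> carrier N \<and> y' \<in> carrier N} \<union>
    {frag_of (x \<bullet>\<^bsub>M\<^esub> a, y) - frag_of (x, a \<odot>\<^bsub>N\<^esub> y) | x a y.
       x \<in> carrier M \<and> a \<in> carrier A \<and> y \<in> carrier N}"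

definition tensor_group ::
    "('a, 'z) ring_scheme \<Rightarrow> ('a, 'm) bimodule \<Rightarrow> ('a, 'n) bimodule \<Rightarrow> ('m \<times> 'n \<Rightarrow>\<^sub>0 int) set ring"
  where "tensor_group A M N =
    presented_group (carrier M \<times> carrier N) (tensor_relators A M N)"

definition pure_tensor ::
    "('a, 'z) ring_scheme \<Rightarrow> ('a, 'm) bimodule \<Rightarrow> ('a, 'n) bimodule \<Rightarrow>
     'm \<Rightarrow> 'n \<Rightarrow> ('m \<times> 'n \<Rightarrow>\<^sub>0 int) set"
  where "pure_tensor A M N x y =
    generator_class (carrier M \<times> carrier N) (tensor_relators A M N) (x, y)"

definition tensor ::
    "('a, 'z) ring_scheme \<Rightarrow> ('a, 'm) bimodule \<Rightarrow> ('a, 'n) bimodule \<Rightarrow>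
     ('a, ('m \<times> 'n \<Rightarrow>\<^sub>0 int) set) bimodule"
  where "tensor A M N =
    (let T = tensor_group A M N in
     \<lparr>carrier = carrier T, monoid.mult = undefined, one = undefined, zero = zero T, add = add T,
      module.smult = (\<lambda>a. extend_additively T (\<lambda>(x, y). pure_tensor A M N (a \<odot>\<^bsub>M\<^esub> x) y)),
      rsmult = (\<lambda>U a. extend_additively T (\<lambda>(x, y). pure_tensor A M N x (y \<bullet>\<^bsub>N\<^esub> a)) U)\<rparr>)"


section \<open>Line modules, star operations and Hermitian metrics\<close>

definition ev ::
    "('a, 'z) ring_scheme \<Rightarrow> ('a, 'l) bimodule \<Rightarrow> ('l \<times> ('l \<Rightarrow> 'a) \<Rightarrow>\<^sub>0 int) set \<Rightarrow> 'a"
  where "ev A L = extend_additively A (\<lambda>(e, \<alpha>). \<alpha> e)"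

definition dual_basis ::
    "('a, 'z) ring_scheme \<Rightarrow> ('a, 'l) bimodule \<Rightarrow> nat \<Rightarrow> (nat \<Rightarrow> 'l) \<Rightarrow> (nat \<Rightarrow> 'l \<Rightarrow> 'a) \<Rightarrow> bool"
  where "dual_basis A L n u v \<longleftrightarrow>
    (\<forall>i<n. u i \<in> carrier L \<and> v i \<in> carrier (dual_bimodule A L)) \<and>
    (\<forall>f\<in>carrier L. f = (\<Oplus>\<^bsub>L\<^esub>i\<in>{..<n}. v i f \<odot>\<^bsub>L\<^esub> u i))"

definition left_fgp :: "('a, 'z) ring_scheme \<Rightarrow> ('a, 'l) bimodule \<Rightarrow> bool"
  where "left_fgp A L \<longleftrightarrow> (\<exists>n u v. dual_basis A L n u v)"

text \<open>The element below does not depend on the dual basis that is used.\<close>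

definition coev_one ::
    "('a, 'z) ring_scheme \<Rightarrow> ('a, 'l) bimodule \<Rightarrow> (('l \<Rightarrow> 'a) \<times> 'l \<Rightarrow>\<^sub>0 int) set"
  where "coev_one A L =
    (let (n, u, v) = (SOME (n, u, v). dual_basis A L n u v)
     in \<Oplus>\<^bsub>tensor A (dual_bimodule A L) L\<^esub>i\<in>{..<n}. pure_tensor A (dual_bimodule A L) L (v i) (u i))"

definition coev ::
    "('a, 'z) ring_scheme \<Rightarrow> ('a, 'l) bimodule \<Rightarrow> 'a \<Rightarrow> (('l \<Rightarrow> 'a) \<times> 'l \<Rightarrow>\<^sub>0 int) set"
  where "coev A L a = a \<odot>\<^bsub>tensor A (dual_bimodule A L) L\<^esub> coev_one A L"

definition left_line_module :: "(complex, 'a, 'z) module_scheme \<Rightarrow> ('a, 'l) bimodule \<Rightarrow> bool"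
  where "left_line_module A L \<longleftrightarrow> bimodule A L \<and> left_fgp A L \<and>
    coev A L \<in> bimod_iso A (regular_bimodule A) (tensor A (dual_bimodule A L) L) \<and>
    ev A L \<in> bimod_iso A (tensor A L (dual_bimodule A L)) (regular_bimodule A)"

definition star_operation ::
    "('a, 'z) star_algebra_scheme \<Rightarrow> ('a, 'l) bimodule \<Rightarrow> ('l \<Rightarrow> 'l) \<Rightarrow> bool"
  where "star_operation A L st \<longleftrightarrow>
    st \<in> bimod_hom A L (conj_bimodule A L) \<and> (\<forall>e\<in>carrier L. st (st e) = e)"

definition inner_product ::
    "('a, 'z) ring_scheme \<Rightarrow> ('a, 'l) bimodule \<Rightarrow> ('l \<Rightarrow> 'l \<Rightarrow> 'a) \<Rightarrow> 'l \<Rightarrow> 'l \<Rightarrow> 'a"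
  where "inner_product A L G e f = ev A L (pure_tensor A L (dual_bimodule A L) e (G f))"

definition hermitian_metric ::
    "('a, 'z) star_algebra_scheme \<Rightarrow> ('a, 'l) bimodule \<Rightarrow> ('l \<Rightarrow> 'l \<Rightarrow> 'a) \<Rightarrow> bool"
  where "hermitian_metric A L G \<longleftrightarrow>
    G \<in> bimod_iso A (conj_bimodule A L) (dual_bimodule A L) \<and>
    (\<forall>e\<in>carrier L. \<forall>f\<in>carrier L. inner_product A L G e f = star A (inner_product A L G f e))"

definition tensor_map ::
    "('a, 'z) ring_scheme \<Rightarrow> ('a, 'm) bimodule \<Rightarrow> ('a, 'n) bimodule \<Rightarrow> ('m' \<Rightarrow> 'm) \<Rightarrow> ('n' \<Rightarrow> 'n) \<Rightarrow>
     ('m' \<times> 'n' \<Rightarrow>\<^sub>0 int) set \<Rightarrow> ('m \<times> 'n \<Rightarrow>\<^sub>0 int) set"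
  where "tensor_map A M N g h =
    extend_additively (tensor A M N) (\<lambda>(x, y). pure_tensor A M N (g x) (h y))"

definition star_compatible ::
    "('a, 'z) ring_scheme \<Rightarrow> ('a, 'l) bimodule \<Rightarrow> ('l \<Rightarrow> 'l) \<Rightarrow> ('l \<Rightarrow> 'l \<Rightarrow> 'a) \<Rightarrow> bool"
  where "star_compatible A L st G \<longleftrightarrow>
    ev A L (tensor_map A L (dual_bimodule A L) (inv_into (carrier L) (G \<circ> st)) (G \<circ> st)
      (coev A L \<one>\<^bsub>A\<^esub>)) = \<one>\<^bsub>A\<^esub>"


section \<open>The tensor algebra\<close>

text \<open>
  The \<open>n\<close>-fold tensor product over \<open>A\<close>, for \<open>n \<ge> 1\<close>: the list of \<open>x\<^sub>1, \<dots>, x\<^sub>n\<close> is the generator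
  for the tensor product of these elements. (The value at \<open>n = 0\<close> is not used: degree 0 of
  the tensor algebra is \<open>A\<close>.)
\<close>

definition tpow_gens :: "('a, 'l) bimodule \<Rightarrow> nat \<Rightarrow> 'l list set"
  where "tpow_gens L n = {xs. length xs = n \<and> set xs \<subseteq> carrier L}"

definition tpow_relators ::
    "('a, 'z) ring_scheme \<Rightarrow> ('a, 'l) bimodule \<Rightarrow> nat \<Rightarrow> ('l list \<Rightarrow>\<^sub>0 int) set"
  where "tpow_relators A L n =
    {frag_of (us @ [x \<oplus>\<^bsub>L\<^esub> y] @ vs) - frag_of (us @ [x] @ vs) - frag_of (us @ [y] @ vs) | us x y vs.
       us @ [x] @ vs \<in> tpow_gens L n \<and> y \<in> carrier L} \<union>
    {frag_of (us @ [x \<bullet>\<^bsub>L\<^esub> a, y] @ vs) - frag_of (us @ [x, a \<odot>\<^bsub>L\<^esub> y] @ vs) | us x a y vs.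
       us @ [x, y] @ vs \<in> tpow_gens L n \<and> a \<in> carrier A}"

definition tpow ::
    "('a, 'z) ring_scheme \<Rightarrow> ('a, 'l) bimodule \<Rightarrow> nat \<Rightarrow> ('l list \<Rightarrow>\<^sub>0 int) set ring"
  where "tpow A L n = presented_group (tpow_gens L n) (tpow_relators A L n)"

definition tpow_pure ::
    "('a, 'z) ring_scheme \<Rightarrow> ('a, 'l) bimodule \<Rightarrow> nat \<Rightarrow> 'l list \<Rightarrow> ('l list \<Rightarrow>\<^sub>0 int) set"
  where "tpow_pure A L n xs = generator_class (tpow_gens L n) (tpow_relators A L n) xs"

definition tpow_lact ::
    "('a, 'z) ring_scheme \<Rightarrow> ('a, 'l) bimodule \<Rightarrow> nat \<Rightarrow> 'a \<Rightarrow>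
     ('l list \<Rightarrow>\<^sub>0 int) set \<Rightarrow> ('l list \<Rightarrow>\<^sub>0 int) set"
  where "tpow_lact A L n a =
    extend_additively (tpow A L n) (\<lambda>xs. tpow_pure A L n ((a \<odot>\<^bsub>L\<^esub> hd xs) # tl xs))"

definition tpow_ract ::
    "('a, 'z) ring_scheme \<Rightarrow> ('a, 'l) bimodule \<Rightarrow> nat \<Rightarrow>
     ('l list \<Rightarrow>\<^sub>0 int) set \<Rightarrow> 'a \<Rightarrow> ('l list \<Rightarrow>\<^sub>0 int) set"
  where "tpow_ract A L n U a =
    extend_additively (tpow A L n) (\<lambda>xs. tpow_pure A L n (butlast xs @ [last xs \<bullet>\<^bsub>L\<^esub> a])) U"

definition tpow_mult ::
    "('a, 'z) ring_scheme \<Rightarrow> ('a, 'l) bimodule \<Rightarrow> nat \<Rightarrow> nat \<Rightarrow>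
     ('l list \<Rightarrow>\<^sub>0 int) set \<Rightarrow> ('l list \<Rightarrow>\<^sub>0 int) set \<Rightarrow> ('l list \<Rightarrow>\<^sub>0 int) set"
  where "tpow_mult A L m n =
    extend_biadditively (tpow A L (m + n)) (\<lambda>xs ys. tpow_pure A L (m + n) (xs @ ys))"

definition tpow_star ::
    "('a, 'z) ring_scheme \<Rightarrow> ('a, 'l) bimodule \<Rightarrow> ('l \<Rightarrow> 'l) \<Rightarrow> nat \<Rightarrow>
     ('l list \<Rightarrow>\<^sub>0 int) set \<Rightarrow> ('l list \<Rightarrow>\<^sub>0 int) set"
  where "tpow_star A L st n =
    extend_additively (tpow A L n) (\<lambda>xs. tpow_pure A L n (rev (map st xs)))"

text \<open>
  In an element \<open>(a, t)\<close> the component of degree 0 is \<open>a\<close> and the component of degree \<open>k + 1\<close> is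
  \<open>t k\<close>. In the degree \<open>k + 1\<close> component of a product, the degrees \<open>i + 1\<close> and \<open>k - i\<close> of the
  two factors in the sum run over all decompositions of \<open>k + 1\<close> into two positive numbers.
\<close>

definition tensor_algebra ::
    "('a, 'z) star_algebra_scheme \<Rightarrow> ('a, 'l) bimodule \<Rightarrow> ('l \<Rightarrow> 'l) \<Rightarrow>
     ('a \<times> (nat \<Rightarrow> ('l list \<Rightarrow>\<^sub>0 int) set)) star_algebra"
  where "tensor_algebra A L st = \<lparr>
    carrier = {(a, t). a \<in> carrier A \<and> (\<forall>k. t k \<in> carrier (tpow A L (Suc k))) \<and>
      finite {k. t k \<noteq> \<zero>\<^bsub>tpow A L (Suc k)\<^esub>}},
    monoid.mult = (\<lambda>(a, s) (b, t). (a \<otimes>\<^bsub>A\<^esub> b,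
      \<lambda>k. tpow_lact A L (Suc k) a (t k) \<oplus>\<^bsub>tpow A L (Suc k)\<^esub> tpow_ract A L (Suc k) (s k) b
        \<oplus>\<^bsub>tpow A L (Suc k)\<^esub>
        (\<Oplus>\<^bsub>tpow A L (Suc k)\<^esub>i\<in>{..<k}. tpow_mult A L (Suc i) (k - i) (s i) (t (k - Suc i))))),
    one = (\<one>\<^bsub>A\<^esub>, \<lambda>k. \<zero>\<^bsub>tpow A L (Suc k)\<^esub>),
    zero = (\<zero>\<^bsub>A\<^esub>, \<lambda>k. \<zero>\<^bsub>tpow A L (Suc k)\<^esub>),
    add = (\<lambda>(a, s) (b, t). (a \<oplus>\<^bsub>A\<^esub> b, \<lambda>k. s k \<oplus>\<^bsub>tpow A L (Suc k)\<^esub> t k)),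
    module.smult = (\<lambda>c (a, t). (c \<odot>\<^bsub>A\<^esub> a, \<lambda>k. tpow_lact A L (Suc k) (c \<odot>\<^bsub>A\<^esub> \<one>\<^bsub>A\<^esub>) (t k))),
    star = (\<lambda>(a, t). (star A a, \<lambda>k. tpow_star A L st (Suc k) (t k)))\<rparr>"

fun tensor_algebra_degree ::
    "('a, 'z) star_algebra_scheme \<Rightarrow> ('a, 'l) bimodule \<Rightarrow> ('l \<Rightarrow> 'l) \<Rightarrow> nat \<Rightarrow>
     ('a \<times> (nat \<Rightarrow> ('l list \<Rightarrow>\<^sub>0 int) set)) set"
  where
    "tensor_algebra_degree A L st 0 =
      {(a, t) \<in> carrier (tensor_algebra A L st). \<forall>k. t k = \<zero>\<^bsub>tpow A L (Suc k)\<^esub>}"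
  | "tensor_algebra_degree A L st (Suc n) =
      {(a, t) \<in> carrier (tensor_algebra A L st).
        a = \<zero>\<^bsub>A\<^esub> \<and> (\<forall>k. k \<noteq> n \<longrightarrow> t k = \<zero>\<^bsub>tpow A L (Suc k)\<^esub>)}"


section \<open>The algebra generated by A, L and the central variable\<close>

definition poly_bimodule :: "(complex, complex poly) bimodule"
  where "poly_bimodule = \<lparr>carrier = UNIV, monoid.mult = (*), one = 1, zero = 0, add = (+),
    module.smult = Polynomial.smult, rsmult = (\<lambda>p c. Polynomial.smult c p)\<rparr>"

definition xi :: "complex poly"
  where "xi = [:0, 1:]"

definition poly_tensor ::
    "(complex, 'a, 'z) module_scheme \<Rightarrow> ('a, 'm) bimodule \<Rightarrow>
     (complex, ('m \<times> complex poly \<Rightarrow>\<^sub>0 int) set) bimodule"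
  where "poly_tensor A M = tensor complex_ring (complex_restrict A M) poly_bimodule"

definition poly_pure ::
    "(complex, 'a, 'z) module_scheme \<Rightarrow> ('a, 'm) bimodule \<Rightarrow> 'm \<Rightarrow> complex poly \<Rightarrow>
     ('m \<times> complex poly \<Rightarrow>\<^sub>0 int) set"
  where "poly_pure A M = pure_tensor complex_ring (complex_restrict A M) poly_bimodule"

definition line_poly_algebra ::
    "('a, 'z) star_algebra_scheme \<Rightarrow> ('a, 'l) bimodule \<Rightarrow> ('l \<Rightarrow> 'l) \<Rightarrow> ('l \<Rightarrow> 'l \<Rightarrow> 'a) \<Rightarrow>
     (('a \<times> complex poly \<Rightarrow>\<^sub>0 int) set \<times> ('l \<times> complex poly \<Rightarrow>\<^sub>0 int) set) star_algebra"
  where "line_poly_algebra A L st G =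
    (let R = regular_bimodule A; AP = poly_tensor A R; LP = poly_tensor A L in \<lparr>
    carrier = carrier AP \<times> carrier LP,
    monoid.mult = (\<lambda>(U, W) (U', W').
      (extend_biadditively AP (\<lambda>(a, p) (b, q). poly_pure A R (a \<otimes>\<^bsub>A\<^esub> b) (p * q)) U U' \<oplus>\<^bsub>AP\<^esub>
       extend_biadditively AP
         (\<lambda>(e, p) (f, q). poly_pure A R (inner_product A L G e (st f)) (xi * (p * q))) W W',
       extend_biadditively LP (\<lambda>(a, p) (f, q). poly_pure A L (a \<odot>\<^bsub>L\<^esub> f) (p * q)) U W' \<oplus>\<^bsub>LP\<^esub>
       extend_biadditively LP (\<lambda>(e, p) (b, q). poly_pure A L (e \<bullet>\<^bsub>L\<^esub> b) (p * q)) W U')),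
    one = (poly_pure A R \<one>\<^bsub>A\<^esub> 1, \<zero>\<^bsub>LP\<^esub>),
    zero = (\<zero>\<^bsub>AP\<^esub>, \<zero>\<^bsub>LP\<^esub>),
    add = (\<lambda>(U, W) (U', W'). (U \<oplus>\<^bsub>AP\<^esub> U', W \<oplus>\<^bsub>LP\<^esub> W')),
    module.smult = (\<lambda>c (U, W). (c \<odot>\<^bsub>AP\<^esub> U, c \<odot>\<^bsub>LP\<^esub> W)),
    star = (\<lambda>(U, W).
      (extend_additively AP (\<lambda>(a, p). poly_pure A R (star A a) (map_poly cnj p)) U,
       extend_additively LP (\<lambda>(e, p). poly_pure A L (st e) (map_poly cnj p)) W))\<rparr>)"

definition line_poly_degree ::
    "('a, 'z) star_algebra_scheme \<Rightarrow> ('a, 'l) bimodule \<Rightarrow> nat \<Rightarrow>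
     (('a \<times> complex poly \<Rightarrow>\<^sub>0 int) set \<times> ('l \<times> complex poly \<Rightarrow>\<^sub>0 int) set) set"
  where "line_poly_degree A L n =
    (if even n
     then {(poly_pure A (regular_bimodule A) a (xi ^ (n div 2)), \<zero>\<^bsub>poly_tensor A L\<^esub>) | a. a \<in> carrier A}
     else {(\<zero>\<^bsub>poly_tensor A (regular_bimodule A)\<^esub>, poly_pure A L e (xi ^ (n div 2))) | e. e \<in> carrier L})"


section \<open>Hopf-Galois extensions for the group with two elements\<close>

text \<open>The group algebra; \<open>Poly_Mapping.single m 1\<close> is the basis element for \<open>m\<close>.\<close>

definition group_algebra_Z2 :: "(complex, bit \<Rightarrow>\<^sub>0 complex) bimodule"
  where "group_algebra_Z2 = \<lparr>carrier = UNIV, monoid.mult = (*), one = 1, zero = 0, add = (+),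
    module.smult = (\<lambda>c. Poly_Mapping.map ((*) c)), rsmult = (\<lambda>x c. Poly_Mapping.map ((*) c) x)\<rparr>"

definition canonical_map ::
    "(complex, 'c, 'z) module_scheme \<Rightarrow> (bit \<Rightarrow> 'c set) \<Rightarrow>
     ('c \<times> 'c \<Rightarrow>\<^sub>0 int) set \<Rightarrow> ('c \<times> (bit \<Rightarrow>\<^sub>0 complex) \<Rightarrow>\<^sub>0 int) set"
  where "canonical_map C gr =
    (let V = complex_restrict C (regular_bimodule C); P = tensor complex_ring V group_algebra_Z2
     in extend_additively P (\<lambda>(x, y). \<Oplus>\<^bsub>P\<^esub>m\<in>UNIV.
          pure_tensor complex_ring V group_algebra_Z2
            (x \<otimes>\<^bsub>C\<^esub> homogeneous_component C gr m y) (Poly_Mapping.single m 1)))"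

text \<open>
  In the domain of the canonical map, the algebra is a bimodule over its degree 0 part.
\<close>

definition hopf_galois_Z2 :: "(complex, 'c, 'z) module_scheme \<Rightarrow> (bit \<Rightarrow> 'c set) \<Rightarrow> bool"
  where "hopf_galois_Z2 C gr \<longleftrightarrow> graded_algebra C gr \<and>
    bij_betw (canonical_map C gr)
      (carrier (tensor (C\<lparr>carrier := gr 0\<rparr>) (regular_bimodule C) (regular_bimodule C)))
      (carrier (tensor complex_ring (complex_restrict C (regular_bimodule C)) group_algebra_Z2))"

definition even_odd_algebra ::
    "('a, 'z) star_algebra_scheme \<Rightarrow> ('a, 'l) bimodule \<Rightarrow> ('l \<Rightarrow> 'l) \<Rightarrow> ('l \<Rightarrow> 'l \<Rightarrow> 'a) \<Rightarrow>
     (complex, 'a \<times> 'l) module"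
  where "even_odd_algebra A L st G = \<lparr>
    carrier = carrier A \<times> carrier L,
    monoid.mult = (\<lambda>(a, e) (b, f).
      (a \<otimes>\<^bsub>A\<^esub> b \<oplus>\<^bsub>A\<^esub> inner_product A L G e (st f), a \<odot>\<^bsub>L\<^esub> f \<oplus>\<^bsub>L\<^esub> e \<bullet>\<^bsub>L\<^esub> b)),
    one = (\<one>\<^bsub>A\<^esub>, \<zero>\<^bsub>L\<^esub>),
    zero = (\<zero>\<^bsub>A\<^esub>, \<zero>\<^bsub>L\<^esub>),
    add = (\<lambda>(a, e) (b, f). (a \<oplus>\<^bsub>A\<^esub> b, e \<oplus>\<^bsub>L\<^esub> f)),
    module.smult = (\<lambda>c (a, e). (c \<odot>\<^bsub>A\<^esub> a, (c \<odot>\<^bsub>A\<^esub> \<one>\<^bsub>A\<^esub>) \<odot>\<^bsub>L\<^esub> e))\<rparr>"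

definition even_odd_degree ::
    "('a, 'z) ring_scheme \<Rightarrow> ('a, 'l) bimodule \<Rightarrow> bit \<Rightarrow> ('a \<times> 'l) set"
  where "even_odd_degree A L m =
    (if m = 0 then carrier A \<times> {\<zero>\<^bsub>L\<^esub>} else {\<zero>\<^bsub>A\<^esub>} \<times> carrier L)"

end

theory Submission
  imports Defs "HOL-Algebra.UnivPoly"
begin

text \<open>
  Write \<open>e\<cdot>f = \<langle>e, f\<^sup>*\<rangle>\<close>. Transporting the dual basis of \<open>L\<close> along \<open>G\<star>\<close>, star compatibility
  yields elements \<open>w\<^sub>i, u\<^sub>i\<close> of \<open>L\<close> with \<open>\<Sum>\<^sub>i w\<^sub>i\<cdot>u\<^sub>i = 1\<close> and \<open>\<Sum>\<^sub>i (x\<cdot>w\<^sub>i) u\<^sub>i = x\<close>. As \<open>ev\<close> is injective,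
  this forces \<open>(e\<cdot>f) g = e (f\<cdot>g)\<close>, so that \<open>C = A \<oplus> L\<close> is an associative star algebra in which
  \<open>1 = \<Sum>\<^sub>i w\<^sub>i u\<^sub>i\<close> with odd \<open>w\<^sub>i, u\<^sub>i\<close>. The inverse of the canonical map then sends \<open>x\<close> tensored with the
  odd group element to \<open>\<Sum>\<^sub>i x w\<^sub>i \<otimes> u\<^sub>i\<close>. The same elements show that multiplication in \<open>C\<close> identifies the \<open>n\<close>-fold tensor
  power of \<open>L\<close> with \<open>A\<close> or \<open>L\<close>, according to the parity of \<open>n\<close>. Hence both the tensor algebra and the
  algebra \<open>A[\<xi>] \<oplus> L[\<xi>]\<close> embed into the polynomials over \<open>C\<close>, with the same image: the polynomials whose
  coefficient in degree \<open>n\<close> has the parity of \<open>n\<close>.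
\<close>


section \<open>Additive maps\<close>

text \<open>Every operation on a tensor product or tensor power is given by
  \<open>extend_additively\<close>, which has a meaning only once the relators are known to be
  respected. Checking them for each action, star and product, and the algebra axioms on top, would
  dominate the proof. An injective additive map into a group that is already understood does both
  jobs: if the values on generators become, after the embedding, those of a known additive map, then
  the relators are respected automatically, and identities may be compared after the embedding.
  \<open>ev\<close> plays this role for \<open>L\<close> tensored with its dual,
  \<open>\<mu>\<close> for the tensor powers, \<open>even_poly\<close> and \<open>odd_poly\<close>
  for the two halves of the polynomial algebra. The price is that injectivity of each of these maps
  has to come before any operation of the algebras in part (a) can be used.

  Star compatibility enters only through the value 1 of the sum of the w_i\<cdot>u_i; the expansion
  of x is the dual basis property itself.\<close>

lemma (in abelian_group) int_add_pow_closed [simp]: "x \<in> carrier G \<Longrightarrow> [(n::int)] \<cdot> x \<in> carrier G"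
  by (rule add.int_pow_closed)

lemma (in abelian_group) minus_eq_zero_iff: "\<lbrakk>x \<in> carrier G; y \<in> carrier G\<rbrakk> \<Longrightarrow> x \<ominus> y = \<zero> \<longleftrightarrow> x = y"
  using add.inv_solve_right'[of \<zero> x y] by (simp add: a_minus_def)

text \<open>Only the carriers and the additions are looked at, so records that differ in their other
  fields, such as a tensor product and its underlying presented group, have the same additive
  maps.\<close>

definition add_hom :: "('p, 'y) ring_scheme \<Rightarrow> ('q, 'z) ring_scheme \<Rightarrow> ('p \<Rightarrow> 'q) set"
  where "add_hom P Q = {h \<in> carrier P \<rightarrow> carrier Q.
    \<forall>x\<in>carrier P. \<forall>y\<in>carrier P. h (x \<oplus>\<^bsub>P\<^esub> y) = h x \<oplus>\<^bsub>Q\<^esub> h y}"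

lemma add_homI:
  assumes "\<And>x. x \<in> carrier P \<Longrightarrow> h x \<in> carrier Q"
    and "\<And>x y. \<lbrakk>x \<in> carrier P; y \<in> carrier P\<rbrakk> \<Longrightarrow> h (x \<oplus>\<^bsub>P\<^esub> y) = h x \<oplus>\<^bsub>Q\<^esub> h y"
  shows "h \<in> add_hom P Q"
  using assms by (auto simp: add_hom_def)

lemma add_hom_closed: "\<lbrakk>h \<in> add_hom P Q; x \<in> carrier P\<rbrakk> \<Longrightarrow> h x \<in> carrier Q"
  by (auto simp: add_hom_def)

lemma add_hom_add:
  "\<lbrakk>h \<in> add_hom P Q; x \<in> carrier P; y \<in> carrier P\<rbrakk> \<Longrightarrow> h (x \<oplus>\<^bsub>P\<^esub> y) = h x \<oplus>\<^bsub>Q\<^esub> h y"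
  by (auto simp: add_hom_def)

lemma add_hom_compose:
  "\<lbrakk>g \<in> add_hom P Q; h \<in> add_hom Q R\<rbrakk> \<Longrightarrow> (\<lambda>x. h (g x)) \<in> add_hom P R"
  by (auto simp: add_hom_def Pi_iff)

lemma abelian_group_homI:
  assumes "abelian_group P" "abelian_group Q" "h \<in> add_hom P Q"
  shows "abelian_group_hom P Q h"
  using assms
  by (auto intro!: abelian_group_hom.intro abelian_group_hom_axioms.intro group_hom.intro
      group_hom_axioms.intro homI abelian_group.a_group simp: add_hom_closed add_hom_add)

context
  fixes P :: "('p, 'y) ring_scheme" and Q :: "('q, 'z) ring_scheme" and h
  assumes P: "abelian_group P" and Q: "abelian_group Q" and h: "h \<in> add_hom P Q"
begin

interpretation abelian_group_hom P Q h
  using P Q h by (rule abelian_group_homI)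

lemma add_hom_zero: "h \<zero>\<^bsub>P\<^esub> = \<zero>\<^bsub>Q\<^esub>"
  by simp

lemma add_hom_a_inv: "x \<in> carrier P \<Longrightarrow> h (\<ominus>\<^bsub>P\<^esub> x) = \<ominus>\<^bsub>Q\<^esub> h x"
  by simp

lemma add_hom_minus:
  "\<lbrakk>x \<in> carrier P; y \<in> carrier P\<rbrakk> \<Longrightarrow> h (x \<ominus>\<^bsub>P\<^esub> y) = h x \<ominus>\<^bsub>Q\<^esub> h y"
  by (simp add: a_minus_def)

lemma add_hom_finsum:
  assumes "f \<in> I \<rightarrow> carrier P"
  shows "h (finsum P f I) = (\<Oplus>\<^bsub>Q\<^esub>i\<in>I. h (f i))"
  using assms
proof (induction I rule: infinite_finite_induct)
  case (insert i I)
  then have "f i \<in> carrier P" "f \<in> I \<rightarrow> carrier P" by auto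
  with insert show ?case
    by (simp add: G.finsum_insert H.finsum_insert G.finsum_closed Pi_iff)
qed auto

end

lemma add_hom_id: "(\<lambda>x. x) \<in> add_hom P P"
  by (auto intro: add_homI)

lemma add_hom_pointwise_add:
  assumes "abelian_group P" "abelian_group Q" "g \<in> add_hom P Q" "h \<in> add_hom P Q"
  shows "(\<lambda>x. g x \<oplus>\<^bsub>Q\<^esub> h x) \<in> add_hom P Q"
proof -
  interpret Q: abelian_group Q by fact
  show ?thesis
    using assms by (auto intro!: add_homI simp: add_hom_closed add_hom_add Q.a_ac)
qed

text \<open>For maps that sum over the partition of unity: the section of \<open>\<mu>\<close> and
  the inverse of the canonical map.\<close>

lemma add_hom_finsum_pointwise:
  assumes P: "abelian_group P" and Q: "abelian_group Q" and h: "\<And>i. i \<in> I \<Longrightarrow> h i \<in> add_hom P Q"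
  shows "(\<lambda>x. \<Oplus>\<^bsub>Q\<^esub>i\<in>I. h i x) \<in> add_hom P Q"
proof -
  interpret Q: abelian_group Q by fact
  interpret P: abelian_group P by fact
  show ?thesis
  proof (rule add_homI)
    fix x y assume xy: "x \<in> carrier P" "y \<in> carrier P"
    have "(\<Oplus>\<^bsub>Q\<^esub>i\<in>I. h i (x \<oplus>\<^bsub>P\<^esub> y)) = (\<Oplus>\<^bsub>Q\<^esub>i\<in>I. h i x \<oplus>\<^bsub>Q\<^esub> h i y)"
      using xy h by (intro Q.finsum_cong') (auto simp: add_hom_add add_hom_closed[where P = P])
    then show "(\<Oplus>\<^bsub>Q\<^esub>i\<in>I. h i (x \<oplus>\<^bsub>P\<^esub> y)) = (\<Oplus>\<^bsub>Q\<^esub>i\<in>I. h i x) \<oplus>\<^bsub>Q\<^esub> (\<Oplus>\<^bsub>Q\<^esub>i\<in>I. h i y)"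
      using xy h by (simp add: Q.finsum_addf Pi_iff add_hom_closed[where P = P])
  qed (use h in \<open>auto simp: add_hom_closed[where P = P] intro!: Q.finsum_closed\<close>)
qed

section \<open>Abelian groups given by generators and relators\<close>

text \<open>The expression that \<open>extend_additively\<close> applies to the members of a coset:
  the additive extension of \<open>f\<close> to the free abelian group.\<close>

definition frag_eval :: "('p, 'z) ring_scheme \<Rightarrow> ('x \<Rightarrow> 'p) \<Rightarrow> ('x \<Rightarrow>\<^sub>0 int) \<Rightarrow> 'p"
  where "frag_eval P f c =
    (\<Oplus>\<^bsub>P\<^esub>x\<in>Poly_Mapping.keys c. [Poly_Mapping.lookup c x] \<cdot>\<^bsub>P\<^esub> f x)"

context abelian_group
begin

lemma int_add_pow_add: "x \<in> carrier G \<Longrightarrow> [(m + n :: int)] \<cdot> x = [m] \<cdot> x \<oplus> [n] \<cdot> x"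
  by (rule add.int_pow_mult)

text \<open>Two combinations have different supports; a common index set is needed before their sums
  can be added.\<close>

lemma frag_eval_superset:
  assumes "finite T" "Poly_Mapping.keys c \<subseteq> T" "f \<in> T \<rightarrow> carrier G"
  shows "frag_eval G f c = (\<Oplus>x\<in>T. [Poly_Mapping.lookup c x] \<cdot> f x)"
  unfolding frag_eval_def
proof (rule add.finprod_mono_neutral_cong_left)
  show "[Poly_Mapping.lookup c i] \<cdot> f i = \<zero>" if "i \<in> T - Poly_Mapping.keys c" for i
    using that by (simp add: in_keys_iff add_pow_def)
qed (use assms in auto)

lemma frag_eval_closed:
  "\<lbrakk>f \<in> S \<rightarrow> carrier G; Poly_Mapping.keys c \<subseteq> S\<rbrakk> \<Longrightarrow> frag_eval G f c \<in> carrier G"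
  unfolding frag_eval_def by (rule finsum_closed) auto

lemma frag_eval_add:
  assumes f: "f \<in> S \<rightarrow> carrier G" and c: "Poly_Mapping.keys c \<subseteq> S" and d: "Poly_Mapping.keys d \<subseteq> S"
  shows "frag_eval G f (c + d) = frag_eval G f c \<oplus> frag_eval G f d"
proof -
  let ?T = "Poly_Mapping.keys c \<union> Poly_Mapping.keys d"
  have T: "finite ?T" "f \<in> ?T \<rightarrow> carrier G"
    using f c d by auto
  have "frag_eval G f (c + d) = (\<Oplus>x\<in>?T. [Poly_Mapping.lookup (c + d) x] \<cdot> f x)"
    using T keys_add[of c d] by (intro frag_eval_superset) auto
  also have "\<dots> = (\<Oplus>x\<in>?T. [Poly_Mapping.lookup c x] \<cdot> f x \<oplus> [Poly_Mapping.lookup d x] \<cdot> f x)"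
    using T by (intro finsum_cong') (auto simp: lookup_add intro!: int_add_pow_add)
  also have "\<dots> = (\<Oplus>x\<in>?T. [Poly_Mapping.lookup c x] \<cdot> f x)
      \<oplus> (\<Oplus>x\<in>?T. [Poly_Mapping.lookup d x] \<cdot> f x)"
    using T by (intro finsum_addf) auto
  also have "\<dots> = frag_eval G f c \<oplus> frag_eval G f d"
    using T by (simp add: frag_eval_superset[of ?T])
  finally show ?thesis .
qed

lemma frag_eval_zero [simp]: "frag_eval G f 0 = \<zero>"
  by (simp add: frag_eval_def)

lemma frag_eval_minus:
  assumes f: "f \<in> S \<rightarrow> carrier G" and c: "Poly_Mapping.keys c \<subseteq> S"
  shows "frag_eval G f (- c) = \<ominus> frag_eval G f c"
proof -
  have "frag_eval G f (- c) \<oplus> frag_eval G f c = \<zero>"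
    using f c frag_eval_add[of f S "- c" c] by (simp add: keys_minus)
  then show ?thesis
    using f c by (metis frag_eval_closed keys_minus minus_equality)
qed

lemma frag_eval_diff:
  assumes "f \<in> S \<rightarrow> carrier G" "Poly_Mapping.keys c \<subseteq> S" "Poly_Mapping.keys d \<subseteq> S"
  shows "frag_eval G f (c - d) = frag_eval G f c \<ominus> frag_eval G f d"
  using frag_eval_add[of f S c "- d"] frag_eval_minus[of f S d] assms
  by (simp add: keys_minus a_minus_def)

lemma frag_eval_frag_of: "f x \<in> carrier G \<Longrightarrow> frag_eval G f (frag_of x) = f x"
  by (simp add: frag_eval_def add.int_pow_1 [folded add_pow_def])

text \<open>All relators have the shape x - y or x - y - z. Read from right to left these
  equivalences show that a map kills a relator; read from left to right they turn a relator of the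
  group into an equation between generators.\<close>

lemma frag_eval_relator2:
  assumes "f \<in> S \<rightarrow> carrier G" "x \<in> S" "y \<in> S"
  shows "frag_eval G f (frag_of x - frag_of y) = \<zero> \<longleftrightarrow> f x = f y"
  using assms by (auto simp: frag_eval_diff[of f S] frag_eval_frag_of Pi_iff minus_eq_zero_iff)

lemma frag_eval_relator3:
  assumes "f \<in> S \<rightarrow> carrier G" "x \<in> S" "y \<in> S" "z \<in> S"
  shows "frag_eval G f (frag_of x - frag_of y - frag_of z) = \<zero> \<longleftrightarrow> f x = f y \<oplus> f z"
proof -
  have f: "f x \<in> carrier G" "f y \<in> carrier G" "f z \<in> carrier G"
    using assms by auto
  have "Poly_Mapping.keys (frag_of x - frag_of y) \<subseteq> S"
    using assms keys_diff[of "frag_of x" "frag_of y"] by auto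
  then have "frag_eval G f (frag_of x - frag_of y - frag_of z) = f x \<ominus> f y \<ominus> f z"
    using assms f by (simp add: frag_eval_diff[of f S] frag_eval_frag_of)
  also have "\<dots> = f x \<ominus> (f y \<oplus> f z)"
    using f by (simp add: a_minus_def minus_add a_assoc)
  finally show ?thesis
    using f by (simp add: minus_eq_zero_iff)
qed

end

lemma add_hom_frag_eval:
  assumes P: "abelian_group P" and Q: "abelian_group Q" and h: "h \<in> add_hom P Q"
    and f: "f \<in> S \<rightarrow> carrier P" and c: "Poly_Mapping.keys c \<subseteq> S"
  shows "h (frag_eval P f c) = frag_eval Q (\<lambda>x. h (f x)) c"
proof -
  interpret P: abelian_group P by fact
  interpret Q: abelian_group Q by fact
  have hf: "(\<lambda>x. h (f x)) \<in> S \<rightarrow> carrier Q"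
    using f add_hom_closed[OF h] by auto
  show ?thesis
    using c
  proof (induction c rule: free_Abelian_group_induct [consumes 1])
    case (2 x y)
    then show ?case
      using f hf by (simp add: P.frag_eval_diff[of f S] Q.frag_eval_diff[of _ S]
          add_hom_minus[OF P Q h] P.frag_eval_closed)
  next
    case (3 a)
    then show ?case
      using f hf by (simp add: P.frag_eval_frag_of Q.frag_eval_frag_of Pi_iff)
  qed (simp add: add_hom_zero[OF P Q h])
qed

lemma frag_relator_closed:
  "\<lbrakk>p \<in> S; q \<in> S\<rbrakk> \<Longrightarrow> frag_of p - frag_of q \<in> carrier (free_Abelian_group S)"
  "\<lbrakk>p \<in> S; q \<in> S; q' \<in> S\<rbrakk> \<Longrightarrow> frag_of p - frag_of q - frag_of q' \<in> carrier (free_Abelian_group S)"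
  using keys_diff[of "frag_of p" "frag_of q"] keys_diff[of "frag_of p - frag_of q" "frag_of q'"]
  unfolding carrier_free_Abelian_group_iff subset_iff by auto

section \<open>Quotients of free abelian groups\<close>

context
  fixes S :: "'x set" and r :: "('x \<Rightarrow>\<^sub>0 int) set"
  assumes r: "r \<subseteq> carrier (free_Abelian_group S)"
begin

private abbreviation "F \<equiv> free_Abelian_group S"
private abbreviation "N \<equiv> generate F r"

interpretation F: comm_group F
  by (rule abelian_free_Abelian_group)

interpretation N: normal N F
  using F.generate_is_subgroup[OF r] by (rule F.subgroup_imp_normal)

text \<open>The presented group is the quotient group rewritten additively; this is the bridge to
  the facts about \<open>F Mod N\<close>.\<close>

private lemma add_monoid_presented_group: "add_monoid (presented_group S r) = F Mod N"
  by (simp add: presented_group_def Let_def FactGroup_def)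

lemma abelian_group_presented_group: "abelian_group (presented_group S r)"
proof -
  have "comm_group (F Mod N)"
    by (intro F.abelian_FactGroup N.is_subgroup)
  then have "comm_group (add_monoid (presented_group S r))"
    by (simp only: add_monoid_presented_group)
  then show ?thesis
    by (rule comm_group_abelian_groupI)
qed

private lemma coset_add:
  assumes "c \<in> carrier F" "d \<in> carrier F"
  shows "N #>\<^bsub>F\<^esub> (c + d) = (N #>\<^bsub>F\<^esub> c) \<oplus>\<^bsub>presented_group S r\<^esub> (N #>\<^bsub>F\<^esub> d)"
  using hom_mult[OF N.r_coset_hom_Mod assms] by (simp add: presented_group_def Let_def)

private lemma coset_closed: "c \<in> carrier F \<Longrightarrow> N #>\<^bsub>F\<^esub> c \<in> carrier (presented_group S r)"
  using hom_in_carrier[OF N.r_coset_hom_Mod, of c] by (simp add: presented_group_def Let_def)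

private lemma coset_zero: "c \<in> N \<Longrightarrow> N #>\<^bsub>F\<^esub> c = \<zero>\<^bsub>presented_group S r\<^esub>"
  using N.rcos_const by (simp add: presented_group_def Let_def FactGroup_def)

private lemma carrier_presented_groupE:
  assumes "U \<in> carrier (presented_group S r)"
  obtains c where "c \<in> carrier F" "U = N #>\<^bsub>F\<^esub> c"
  using assms by (auto simp: presented_group_def Let_def FactGroup_def RCOSETS_def)

interpretation P: abelian_group "presented_group S r"
  by (rule abelian_group_presented_group)

private lemma coset_diff:
  assumes c: "c \<in> carrier F" and d: "d \<in> carrier F"
  shows "N #>\<^bsub>F\<^esub> (c - d) = (N #>\<^bsub>F\<^esub> c) \<ominus>\<^bsub>presented_group S r\<^esub> (N #>\<^bsub>F\<^esub> d)"
proof -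
  have cd: "c - d \<in> carrier F"
    using c d keys_diff[of c d] by auto
  show ?thesis
    using coset_add[OF cd d] coset_closed[OF c] coset_closed[OF d] coset_closed[OF cd]
    by (simp add: a_minus_def P.a_assoc P.r_neg)
qed

lemma generator_class_closed: "x \<in> S \<Longrightarrow> generator_class S r x \<in> carrier (presented_group S r)"
  unfolding generator_class_def by (rule coset_closed) simp

text \<open>Closure under differences covers sums and negatives at once, and it is the form in which
  the free abelian group has its induction rule.\<close>

lemma presented_group_induct [consumes 1, case_names zero generator diff]:
  assumes U: "U \<in> carrier (presented_group S r)"
    and zero: "\<Phi> \<zero>\<^bsub>presented_group S r\<^esub>"
    and gen: "\<And>x. x \<in> S \<Longrightarrow> \<Phi> (generator_class S r x)"
    and diff: "\<And>V W. \<lbrakk>V \<in> carrier (presented_group S r); W \<in> carrier (presented_group S r); \<Phi> V; \<Phi> W\<rbrakk>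
      \<Longrightarrow> \<Phi> (V \<ominus>\<^bsub>presented_group S r\<^esub> W)"
  shows "\<Phi> U"
proof -
  obtain c where c: "Poly_Mapping.keys c \<subseteq> S" and U': "U = N #>\<^bsub>F\<^esub> c"
    using U by (auto elim: carrier_presented_groupE)
  have "\<Phi> (N #>\<^bsub>F\<^esub> c)"
    using c
  proof (induction c rule: free_Abelian_group_induct [consumes 1])
    case 1
    have "0 \<in> N" using generate.one[of F r] by simp
    then show ?case using zero by (simp add: coset_zero)
  next
    case (2 x y)
    then show ?case
      using diff[of "N #>\<^bsub>F\<^esub> x" "N #>\<^bsub>F\<^esub> y"] by (simp add: coset_diff coset_closed)
  next
    case (3 a)
    then show ?case using gen by (simp add: generator_class_def)
  qed
  then show ?thesis by (simp add: U')
qed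

text \<open>The additive extension of \<open>generator_class\<close> is the projection to cosets,
  and a relator lies in the subgroup divided out.\<close>

lemma presented_group_relator:
  assumes "c \<in> r"
  shows "frag_eval (presented_group S r) (generator_class S r) c = \<zero>\<^bsub>presented_group S r\<^esub>"
proof -
  have "frag_eval (presented_group S r) (generator_class S r) d = N #>\<^bsub>F\<^esub> d"
    if "Poly_Mapping.keys d \<subseteq> S" for d
    using that
  proof (induction d rule: free_Abelian_group_induct [consumes 1])
    case 1
    have "0 \<in> N" using generate.one[of F r] by simp
    then show ?case by (simp add: coset_zero)
  next
    case (2 x y)
    then show ?case
      by (simp add: coset_diff P.frag_eval_diff[of _ S] generator_class_closed Pi_iff)
  next
    case (3 a)
    then show ?case
      by (simp add: P.frag_eval_frag_of generator_class_closed) (simp add: generator_class_def)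
  qed
  moreover have "c \<in> N" "Poly_Mapping.keys c \<subseteq> S"
    using assms subsetD[OF r assms] by (simp_all add: generate.incl)
  ultimately show ?thesis
    using coset_zero by simp
qed

section \<open>The universal property of generators and relators\<close>

context
  fixes Q :: "('q, 'z) ring_scheme" and f :: "'x \<Rightarrow> 'q"
  assumes Q: "abelian_group Q" and f: "f \<in> S \<rightarrow> carrier Q"
    and relators: "\<And>c. c \<in> r \<Longrightarrow> frag_eval Q f c = \<zero>\<^bsub>Q\<^esub>"
begin

interpretation Q: abelian_group Q by fact

text \<open>\<open>the_elem\<close> needs \<open>frag_eval Q f\<close> to be constant on the coset.
  Members of a coset differ by elements of \<open>N\<close>, on which \<open>frag_eval\<close>
  vanishes by induction over how \<open>N\<close> is generated from the relators.\<close>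

private lemma extend_additively_coset:
  assumes c: "c \<in> carrier F"
  shows "extend_additively Q f (N #>\<^bsub>F\<^esub> c) = frag_eval Q f c"
proof -
  have zero: "frag_eval Q f d = \<zero>\<^bsub>Q\<^esub> \<and> Poly_Mapping.keys d \<subseteq> S" if "d \<in> N" for d
    using that
  proof (induction d rule: generate.induct)
    case (inv h)
    then have "Poly_Mapping.keys h \<subseteq> S"
      using subsetD[OF r] by simp
    with inv show ?case
      using f by (simp add: relators Q.frag_eval_minus[of f S])
  next
    case (eng h1 h2)
    then show ?case
      using f keys_add[of h1 h2] by (auto simp: Q.frag_eval_add[of f S])
  next
    case (incl h)
    then show ?case
      using subsetD[OF r] by (simp add: relators)
  qed simp
  have "frag_eval Q f d = frag_eval Q f c" if "d \<in> N #>\<^bsub>F\<^esub> c" for d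
  proof -
    obtain e where e: "e \<in> N" "d = e + c"
      using \<open>d \<in> N #>\<^bsub>F\<^esub> c\<close> by (auto simp: r_coset_def)
    then show ?thesis
      using zero[of e] f c by (simp add: Q.frag_eval_add[of f S] Q.frag_eval_closed[of f S])
  qed
  moreover have "c \<in> N #>\<^bsub>F\<^esub> c"
    using c F.rcos_self[OF c N.is_subgroup] by simp
  ultimately have "frag_eval Q f ` (N #>\<^bsub>F\<^esub> c) = {frag_eval Q f c}"
    by blast
  then show ?thesis
    unfolding extend_additively_def frag_eval_def by simp
qed

lemma extend_additively_generator:
  assumes "x \<in> S"
  shows "extend_additively Q f (generator_class S r x) = f x"
  using assms f by (auto simp: generator_class_def extend_additively_coset Q.frag_eval_frag_of Pi_iff)

lemma extend_additively_add_hom: "extend_additively Q f \<in> add_hom (presented_group S r) Q"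
proof (rule add_homI)
  fix U assume "U \<in> carrier (presented_group S r)"
  then obtain c where c: "c \<in> carrier F" "U = N #>\<^bsub>F\<^esub> c"
    by (rule carrier_presented_groupE)
  then show "extend_additively Q f U \<in> carrier Q"
    using f by (simp add: extend_additively_coset Q.frag_eval_closed[of f S])
  fix V assume "V \<in> carrier (presented_group S r)"
  then obtain d where d: "d \<in> carrier F" "V = N #>\<^bsub>F\<^esub> d"
    by (rule carrier_presented_groupE)
  have "c + d \<in> carrier F"
    using c d keys_add[of c d] by auto
  then show "extend_additively Q f (U \<oplus>\<^bsub>presented_group S r\<^esub> V)
      = extend_additively Q f U \<oplus>\<^bsub>Q\<^esub> extend_additively Q f V"
    using c d f by (simp flip: coset_add add: extend_additively_coset Q.frag_eval_add[of f S])
qed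

end

lemma add_hom_presented_group_eqI:
  assumes Q: "abelian_group Q" and g: "g \<in> add_hom (presented_group S r) Q"
    and h: "h \<in> add_hom (presented_group S r) Q"
    and eq: "\<And>x. x \<in> S \<Longrightarrow> g (generator_class S r x) = h (generator_class S r x)"
    and U: "U \<in> carrier (presented_group S r)"
  shows "g U = h U"
  using U
proof (induction U rule: presented_group_induct)
  case zero
  then show ?case
    by (simp add: add_hom_zero[OF abelian_group_presented_group Q g]
        add_hom_zero[OF abelian_group_presented_group Q h])
next
  case (diff V W)
  then show ?case
    by (simp add: add_hom_minus[OF abelian_group_presented_group Q g]
        add_hom_minus[OF abelian_group_presented_group Q h])
qed (rule eq)

text \<open>If an additive map with the prescribed values on generators exists, the relators need no
  separate check: \<open>frag_eval\<close> of a relator is the value of \<open>h\<close> at the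
  class of that relator, which is zero.\<close>

lemma extend_additively_eqI:
  assumes Q: "abelian_group Q" and h: "h \<in> add_hom (presented_group S r) Q"
    and eq: "\<And>x. x \<in> S \<Longrightarrow> h (generator_class S r x) = f x"
    and U: "U \<in> carrier (presented_group S r)"
  shows "extend_additively Q f U = h U"
proof -
  have f: "f \<in> S \<rightarrow> carrier Q"
    using eq generator_class_closed h by (auto simp flip: eq simp: add_hom_closed[OF h])
  have rel: "frag_eval Q f c = \<zero>\<^bsub>Q\<^esub>" if "c \<in> r" for c
  proof -
    have c: "Poly_Mapping.keys c \<subseteq> S"
      using subsetD[OF r that] by simp
    have "frag_eval Q f c = frag_eval Q (\<lambda>x. h (generator_class S r x)) c"
      unfolding frag_eval_def using c f
      by (intro abelian_monoid.finsum_cong') (use Q eq in \<open>auto simp: abelian_group.axioms abelian_group.int_add_pow_closed subset_iff Pi_iff\<close>)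
    also have "\<dots> = h (frag_eval (presented_group S r) (generator_class S r) c)"
      using c by (intro add_hom_frag_eval[symmetric, where S = S])
        (auto simp: abelian_group_presented_group Q h generator_class_closed)
    also have "\<dots> = \<zero>\<^bsub>Q\<^esub>"
      using that by (simp add: presented_group_relator add_hom_zero[OF abelian_group_presented_group Q h])
    finally show ?thesis .
  qed
  show ?thesis
  proof (rule add_hom_presented_group_eqI[OF Q _ h _ U])
    show "extend_additively Q f \<in> add_hom (presented_group S r) Q"
      using Q f rel by (rule extend_additively_add_hom)
    show "extend_additively Q f (generator_class S r x) = h (generator_class S r x)" if "x \<in> S" for x
      using extend_additively_generator[OF Q f rel that] eq[OF that] by simp
  qed
qed

text \<open>An injective map out of the target detects whether the relators are respected.\<close>

lemma extend_additively_via_embedding: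
  assumes Q: "abelian_group Q" and Q': "abelian_group Q'"
    and \<mu>: "\<mu> \<in> add_hom Q Q'" and inj: "inj_on \<mu> (carrier Q)"
    and g: "g \<in> add_hom (presented_group S r) Q'"
    and f: "f \<in> S \<rightarrow> carrier Q"
    and eq: "\<And>x. x \<in> S \<Longrightarrow> \<mu> (f x) = g (generator_class S r x)"
  shows "extend_additively Q f \<in> add_hom (presented_group S r) Q"
    and "U \<in> carrier (presented_group S r) \<Longrightarrow> \<mu> (extend_additively Q f U) = g U"
    and "x \<in> S \<Longrightarrow> extend_additively Q f (generator_class S r x) = f x"
proof -
  interpret Q: abelian_group Q by fact
  have rel: "frag_eval Q f c = \<zero>\<^bsub>Q\<^esub>" if "c \<in> r" for c
  proof -
    have c: "Poly_Mapping.keys c \<subseteq> S"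
      using subsetD[OF r that] by simp
    have "\<mu> (frag_eval Q f c) = frag_eval Q' (\<lambda>x. \<mu> (f x)) c"
      using Q Q' \<mu> f c by (rule add_hom_frag_eval)
    also have "\<dots> = frag_eval Q' (\<lambda>x. g (generator_class S r x)) c"
      unfolding frag_eval_def using c f g generator_class_closed
      by (intro abelian_monoid.finsum_cong')
        (use Q' eq in \<open>auto simp: abelian_group.axioms abelian_group.int_add_pow_closed subset_iff add_hom_closed[OF g]\<close>)
    also have "\<dots> = g (frag_eval (presented_group S r) (generator_class S r) c)"
      using c by (intro add_hom_frag_eval[symmetric, where S = S])
        (auto simp: abelian_group_presented_group Q' g generator_class_closed)
    also have "\<dots> = \<mu> \<zero>\<^bsub>Q\<^esub>"
      using that by (simp add: presented_group_relator
          add_hom_zero[OF abelian_group_presented_group Q' g] add_hom_zero[OF Q Q' \<mu>])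
    finally show ?thesis
      using inj Q.frag_eval_closed[OF f c] by (auto dest: inj_onD)
  qed
  show hom: "extend_additively Q f \<in> add_hom (presented_group S r) Q"
    using Q f rel by (rule extend_additively_add_hom)
  show gen: "extend_additively Q f (generator_class S r x) = f x" if "x \<in> S" for x
    using Q f rel that by (rule extend_additively_generator)
  show "\<mu> (extend_additively Q f U) = g U" if "U \<in> carrier (presented_group S r)"
    by (rule add_hom_presented_group_eqI[OF Q' add_hom_compose[OF hom \<mu>] g _ that]) (simp add: gen eq)
qed

end

text \<open>\<open>extend_biadditively\<close> extends in the second variable for each generator of
  the first, then in the first variable. The inner extensions are compared with
  \<open>\<beta> (generator_class S r x)\<close>, the outer one with
  \<open>\<lambda>U. \<beta> U W\<close>, so detection by the embedding is applied twice.\<close>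

lemma extend_biadditively_via_embedding:
  assumes r: "r \<subseteq> carrier (free_Abelian_group S)" and r': "r' \<subseteq> carrier (free_Abelian_group S')"
    and Q: "abelian_group Q" and Q': "abelian_group Q'"
    and \<mu>: "\<mu> \<in> add_hom Q Q'" and inj: "inj_on \<mu> (carrier Q)"
    and \<beta>1: "\<And>W. W \<in> carrier (presented_group S' r') \<Longrightarrow> (\<lambda>U. \<beta> U W) \<in> add_hom (presented_group S r) Q'"
    and \<beta>2: "\<And>U. U \<in> carrier (presented_group S r) \<Longrightarrow> \<beta> U \<in> add_hom (presented_group S' r') Q'"
    and f: "\<And>x y. \<lbrakk>x \<in> S; y \<in> S'\<rbrakk> \<Longrightarrow> f x y \<in> carrier Q"
    and eq: "\<And>x y. \<lbrakk>x \<in> S; y \<in> S'\<rbrakk> \<Longrightarrow>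
      \<mu> (f x y) = \<beta> (generator_class S r x) (generator_class S' r' y)"
    and U: "U \<in> carrier (presented_group S r)" and W: "W \<in> carrier (presented_group S' r')"
  shows "extend_biadditively Q f U W \<in> carrier Q"
    and "\<mu> (extend_biadditively Q f U W) = \<beta> U W"
proof -
  have inner: "extend_additively Q (f x) \<in> add_hom (presented_group S' r') Q"
    "\<mu> (extend_additively Q (f x) W) = \<beta> (generator_class S r x) W" if "x \<in> S" for x
    using extend_additively_via_embedding[OF r' Q Q' \<mu> inj \<beta>2[OF generator_class_closed[OF r that]], of "f x"]
      f eq W that by auto
  note outer = extend_additively_via_embedding[OF r Q Q' \<mu> inj \<beta>1[OF W], of "\<lambda>x. extend_additively Q (f x) W"]
  have "extend_additively Q (\<lambda>x. extend_additively Q (f x) W) \<in> add_hom (presented_group S r) Q"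
    using inner by (intro outer(1)) (auto intro: add_hom_closed[OF _ W])
  then show "extend_biadditively Q f U W \<in> carrier Q"
    unfolding extend_biadditively_def using U by (rule add_hom_closed)
  show "\<mu> (extend_biadditively Q f U W) = \<beta> U W"
    unfolding extend_biadditively_def
    using inner U by (intro outer(2)) (auto intro: add_hom_closed[OF _ W])
qed


section \<open>Tensor products\<close>

text \<open>One set of rules for all tensor products that occur: \<open>L\<close> with its dual on
  either side, coefficients with polynomials, and both ends of the canonical map. Closure under the
  two inner actions is what places the balancing relators in the free group; no module axioms
  enter.\<close>

locale tensor_pair = M?: abelian_group M + N?: abelian_group N
  for A :: "('a, 'z) ring_scheme" and M :: "('a, 'm) bimodule" and N :: "('a, 'n) bimodule" +
  assumes right_closed: "\<lbrakk>x \<in> carrier M; a \<in> carrier A\<rbrakk> \<Longrightarrow> x \<bullet>\<^bsub>M\<^esub> a \<in> carrier M"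
    and left_closed: "\<lbrakk>a \<in> carrier A; y \<in> carrier N\<rbrakk> \<Longrightarrow> a \<odot>\<^bsub>N\<^esub> y \<in> carrier N"
begin

abbreviation "pairs \<equiv> carrier M \<times> carrier N"
abbreviation "relators \<equiv> tensor_relators A M N"
abbreviation "T \<equiv> tensor A M N"
abbreviation "pure \<equiv> pure_tensor A M N"

lemma relators_subset: "relators \<subseteq> carrier (free_Abelian_group pairs)"
  unfolding tensor_relators_def
  by (intro Un_least subsetI; elim CollectE exE conjE; hypsubst; intro frag_relator_closed)
    (simp_all add: right_closed left_closed)

lemma tensor_simps:
  "carrier T = carrier (presented_group pairs relators)"
  "add T = add (presented_group pairs relators)"
  "zero T = zero (presented_group pairs relators)"
  by (simp_all add: tensor_def tensor_group_def Let_def)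

lemma tensor_a_inv: "a_inv T = a_inv (presented_group pairs relators)"
  by (rule ext) (simp add: a_inv_def m_inv_def tensor_simps)

lemma add_hom_tensor [simp]:
  "add_hom T Q = add_hom (presented_group pairs relators) Q"
  "add_hom Q T = add_hom Q (presented_group pairs relators)"
  by (simp_all add: add_hom_def tensor_simps)

text \<open>In \<open>tensor\<close> the actions extend into the bare group, not into the bimodule
  under definition. Sums and integer multiples use only the additive structure, so the two targets
  give the same function; \<open>tensor_smult\<close> depends on this.\<close>

lemma extend_additively_tensor:
  "extend_additively (tensor_group A M N) f = extend_additively T f"
  by (rule ext)
    (simp add: extend_additively_def finsum_def finprod_def add_pow_def int_pow_def nat_pow_def
      m_inv_def tensor_def Let_def cong: if_cong)

lemma abelian_group_tensor: "abelian_group T"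
proof -
  interpret P: abelian_group "presented_group pairs relators"
    using relators_subset by (rule abelian_group_presented_group)
  show ?thesis
  proof (rule abelian_groupI, unfold tensor_simps)
    show "\<exists>y\<in>carrier (presented_group pairs relators).
        y \<oplus>\<^bsub>presented_group pairs relators\<^esub> x = \<zero>\<^bsub>presented_group pairs relators\<^esub>"
      if "x \<in> carrier (presented_group pairs relators)" for x
      using that P.l_neg by blast
  qed (simp_all add: P.a_ac)
qed

sublocale T: abelian_group T
  by (rule abelian_group_tensor)

lemma pure_closed [simp]: "\<lbrakk>x \<in> carrier M; y \<in> carrier N\<rbrakk> \<Longrightarrow> pure x y \<in> carrier T"
  unfolding pure_tensor_def tensor_simps
  by (rule generator_class_closed[OF relators_subset]) simp

lemma pure_funcset: "(\<lambda>(x, y). pure x y) \<in> pairs \<rightarrow> carrier T"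
  by auto

lemma frag_eval_pure:
  assumes "c \<in> relators"
  shows "frag_eval T (\<lambda>(x, y). pure x y) c = \<zero>\<^bsub>T\<^esub>"
proof -
  have "(\<lambda>U. U) \<in> add_hom (presented_group pairs relators) T"
    by (rule add_homI) (simp_all add: tensor_simps)
  then have "frag_eval T (\<lambda>p. generator_class pairs relators p) c
      = frag_eval (presented_group pairs relators) (generator_class pairs relators) c"
    using add_hom_frag_eval[OF abelian_group_presented_group[OF relators_subset] abelian_group_tensor,
        of "\<lambda>U. U" "generator_class pairs relators" pairs c]
      subsetD[OF relators_subset assms] generator_class_closed[OF relators_subset]
    by simp
  then show ?thesis
    using presented_group_relator[OF relators_subset assms]
    by (simp add: pure_tensor_def tensor_simps)
qed

lemma pure_add_left:
  assumes "x \<in> carrier M" "x' \<in> carrier M" "y \<in> carrier N"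
  shows "pure (x \<oplus>\<^bsub>M\<^esub> x') y = pure x y \<oplus>\<^bsub>T\<^esub> pure x' y"
proof -
  have "frag_of (x \<oplus>\<^bsub>M\<^esub> x', y) - frag_of (x, y) - frag_of (x', y) \<in> relators"
    using assms unfolding tensor_relators_def by blast
  from frag_eval_pure[OF this] show ?thesis
    using assms by (subst (asm) T.frag_eval_relator3[OF pure_funcset]) simp_all
qed

lemma pure_add_right:
  assumes "x \<in> carrier M" "y \<in> carrier N" "y' \<in> carrier N"
  shows "pure x (y \<oplus>\<^bsub>N\<^esub> y') = pure x y \<oplus>\<^bsub>T\<^esub> pure x y'"
proof -
  have "frag_of (x, y \<oplus>\<^bsub>N\<^esub> y') - frag_of (x, y) - frag_of (x, y') \<in> relators"
    using assms unfolding tensor_relators_def by blast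
  from frag_eval_pure[OF this] show ?thesis
    using assms by (subst (asm) T.frag_eval_relator3[OF pure_funcset]) simp_all
qed

lemma pure_balanced:
  assumes "x \<in> carrier M" "a \<in> carrier A" "y \<in> carrier N"
  shows "pure (x \<bullet>\<^bsub>M\<^esub> a) y = pure x (a \<odot>\<^bsub>N\<^esub> y)"
proof -
  have "frag_of (x \<bullet>\<^bsub>M\<^esub> a, y) - frag_of (x, a \<odot>\<^bsub>N\<^esub> y) \<in> relators"
    using assms unfolding tensor_relators_def by blast
  from frag_eval_pure[OF this] show ?thesis
    using assms
    by (subst (asm) T.frag_eval_relator2[OF pure_funcset]) (simp_all add: right_closed left_closed)
qed

lemma pure_right_add_hom: "x \<in> carrier M \<Longrightarrow> pure x \<in> add_hom N T"
  by (rule add_homI) (simp_all add: pure_add_right del: add_hom_tensor)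

lemma tensor_induct [consumes 1, case_names zero pure diff]:
  assumes "U \<in> carrier T" "\<Phi> \<zero>\<^bsub>T\<^esub>"
    and "\<And>x y. \<lbrakk>x \<in> carrier M; y \<in> carrier N\<rbrakk> \<Longrightarrow> \<Phi> (pure x y)"
    and diff: "\<And>V W. \<lbrakk>V \<in> carrier T; W \<in> carrier T; \<Phi> V; \<Phi> W\<rbrakk> \<Longrightarrow> \<Phi> (V \<ominus>\<^bsub>T\<^esub> W)"
  shows "\<Phi> U"
proof -
  have "U \<in> carrier (presented_group pairs relators)"
    using assms(1) by (simp only: tensor_simps)
  then show ?thesis
  proof (induction U rule: presented_group_induct[OF relators_subset, consumes 1])
    case 1
    then show ?case using assms(2) by (simp only: tensor_simps)
  next
    case (2 p)
    then show ?case using assms(3)[of "fst p" "snd p"] by (simp add: mem_Times_iff pure_tensor_def)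
  next
    case (3 V W)
    then show ?case
      using diff[of V W] by (simp add: a_minus_def tensor_simps tensor_a_inv)
  qed
qed

lemma tensor_hom_eqI:
  assumes "abelian_group Q" "g \<in> add_hom T Q" "h \<in> add_hom T Q"
    and eq: "\<And>x y. \<lbrakk>x \<in> carrier M; y \<in> carrier N\<rbrakk> \<Longrightarrow> g (pure x y) = h (pure x y)"
    and U: "U \<in> carrier T"
  shows "g U = h U"
proof (rule add_hom_presented_group_eqI[OF relators_subset assms(1)])
  show "g (generator_class pairs relators p) = h (generator_class pairs relators p)" if "p \<in> pairs" for p
    using that eq[of "fst p" "snd p"] by (simp add: mem_Times_iff pure_tensor_def)
  show "g \<in> add_hom (presented_group pairs relators) Q" "h \<in> add_hom (presented_group pairs relators) Q"
    using assms by simp_all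
  show "U \<in> carrier (presented_group pairs relators)"
    using U by (simp only: tensor_simps)
qed

text \<open>One hypothesis on \<open>f\<close> for each of the three families of relators.\<close>

lemma tensor_extend:
  assumes Q: "abelian_group Q"
    and closed: "\<And>x y. \<lbrakk>x \<in> carrier M; y \<in> carrier N\<rbrakk> \<Longrightarrow> f (x, y) \<in> carrier Q"
    and "\<And>x x' y. \<lbrakk>x \<in> carrier M; x' \<in> carrier M; y \<in> carrier N\<rbrakk> \<Longrightarrow>
      f (x \<oplus>\<^bsub>M\<^esub> x', y) = f (x, y) \<oplus>\<^bsub>Q\<^esub> f (x', y)"
    and "\<And>x y y'. \<lbrakk>x \<in> carrier M; y \<in> carrier N; y' \<in> carrier N\<rbrakk> \<Longrightarrow>
      f (x, y \<oplus>\<^bsub>N\<^esub> y') = f (x, y) \<oplus>\<^bsub>Q\<^esub> f (x, y')"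
    and "\<And>x a y. \<lbrakk>x \<in> carrier M; a \<in> carrier A; y \<in> carrier N\<rbrakk> \<Longrightarrow>
      f (x \<bullet>\<^bsub>M\<^esub> a, y) = f (x, a \<odot>\<^bsub>N\<^esub> y)"
  shows "extend_additively Q f \<in> add_hom T Q"
    and "\<lbrakk>x \<in> carrier M; y \<in> carrier N\<rbrakk> \<Longrightarrow> extend_additively Q f (pure x y) = f (x, y)"
proof -
  interpret Q: abelian_group Q by fact
  have f: "f \<in> pairs \<rightarrow> carrier Q"
    using closed by auto
  have rel: "frag_eval Q f c = \<zero>\<^bsub>Q\<^esub>" if "c \<in> relators" for c
    using that unfolding tensor_relators_def
  proof (elim UnE CollectE exE conjE)
    fix x x' y
    assume c: "c = frag_of (x \<oplus>\<^bsub>M\<^esub> x', y) - frag_of (x, y) - frag_of (x', y)"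
      and xy: "x \<in> carrier M" "x' \<in> carrier M" "y \<in> carrier N"
    show ?thesis
      unfolding c using xy by (subst Q.frag_eval_relator3[OF f]) (simp_all add: assms(3))
  next
    fix x y y'
    assume c: "c = frag_of (x, y \<oplus>\<^bsub>N\<^esub> y') - frag_of (x, y) - frag_of (x, y')"
      and xy: "x \<in> carrier M" "y \<in> carrier N" "y' \<in> carrier N"
    show ?thesis
      unfolding c using xy by (subst Q.frag_eval_relator3[OF f]) (simp_all add: assms(4))
  next
    fix x a y
    assume c: "c = frag_of (x \<bullet>\<^bsub>M\<^esub> a, y) - frag_of (x, a \<odot>\<^bsub>N\<^esub> y)"
      and xy: "x \<in> carrier M" "a \<in> carrier A" "y \<in> carrier N"
    show ?thesis
      unfolding c using xy
      by (subst Q.frag_eval_relator2[OF f]) (simp_all add: assms(5) right_closed left_closed)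
  qed
  show "extend_additively Q f \<in> add_hom T Q"
    using extend_additively_add_hom[OF relators_subset Q f rel] by simp
  show "extend_additively Q f (pure x y) = f (x, y)" if "x \<in> carrier M" "y \<in> carrier N"
    unfolding pure_tensor_def
    by (rule extend_additively_generator[OF relators_subset Q f rel]) (use that in auto)
qed

text \<open>Detection by an embedding for tensors: biadditivity and balance of \<open>f\<close> are
  never checked in \<open>Q\<close>.\<close>

lemma tensor_extend_via_embedding:
  assumes Q: "abelian_group Q" and Q': "abelian_group Q'"
    and \<mu>: "\<mu> \<in> add_hom Q Q'" and inj: "inj_on \<mu> (carrier Q)"
    and g: "g \<in> add_hom T Q'"
    and f: "\<And>x y. \<lbrakk>x \<in> carrier M; y \<in> carrier N\<rbrakk> \<Longrightarrow> f (x, y) \<in> carrier Q"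
    and eq: "\<And>x y. \<lbrakk>x \<in> carrier M; y \<in> carrier N\<rbrakk> \<Longrightarrow> \<mu> (f (x, y)) = g (pure x y)"
  shows "extend_additively Q f \<in> add_hom T Q"
    and "U \<in> carrier T \<Longrightarrow> \<mu> (extend_additively Q f U) = g U"
    and "\<lbrakk>x \<in> carrier M; y \<in> carrier N\<rbrakk> \<Longrightarrow> extend_additively Q f (pure x y) = f (x, y)"
proof -
  have "f \<in> pairs \<rightarrow> carrier Q"
    using f by auto
  note * = extend_additively_via_embedding[OF relators_subset Q Q' \<mu> inj g[unfolded add_hom_tensor] this]
  show "extend_additively Q f \<in> add_hom T Q"
    unfolding add_hom_tensor by (rule *(1)) (use eq in \<open>auto simp: pure_tensor_def\<close>)
  show "\<mu> (extend_additively Q f U) = g U" if "U \<in> carrier T"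
    by (rule *(2)) (use eq that in \<open>auto simp: pure_tensor_def tensor_simps\<close>)
  show "extend_additively Q f (pure x y) = f (x, y)" if "x \<in> carrier M" "y \<in> carrier N"
    unfolding pure_tensor_def
    by (rule *(3)) (use eq that in \<open>auto simp: pure_tensor_def\<close>)
qed

lemma tensor_extend_eqI:
  assumes Q: "abelian_group Q" and h: "h \<in> add_hom T Q"
    and eq: "\<And>x y. \<lbrakk>x \<in> carrier M; y \<in> carrier N\<rbrakk> \<Longrightarrow> h (pure x y) = f (x, y)"
    and U: "U \<in> carrier T"
  shows "extend_additively Q f U = h U"
proof (rule extend_additively_eqI[OF relators_subset Q])
  show "h (generator_class pairs relators p) = f p" if "p \<in> pairs" for p
    using that eq[of "fst p" "snd p"] by (simp add: mem_Times_iff pure_tensor_def)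
  show "h \<in> add_hom (presented_group pairs relators) Q"
    using h by simp
  show "U \<in> carrier (presented_group pairs relators)"
    using U by (simp only: tensor_simps)
qed

lemma tensor_smult:
  "module.smult T a = extend_additively T (\<lambda>(x, y). pure (a \<odot>\<^bsub>M\<^esub> x) y)"
  by (rule ext) (simp add: tensor_def Let_def flip: extend_additively_tensor[unfolded tensor_def Let_def])

end

lemma tensor_extend_biadditively_via_embedding:
  assumes T: "tensor_pair A M N" and T': "tensor_pair B M' N'"
    and Q: "abelian_group Q" and Q': "abelian_group Q'"
    and \<mu>: "\<mu> \<in> add_hom Q Q'" and inj: "inj_on \<mu> (carrier Q)"
    and \<beta>1: "\<And>W. W \<in> carrier (tensor B M' N') \<Longrightarrow> (\<lambda>U. \<beta> U W) \<in> add_hom (tensor A M N) Q'"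
    and \<beta>2: "\<And>U. U \<in> carrier (tensor A M N) \<Longrightarrow> \<beta> U \<in> add_hom (tensor B M' N') Q'"
    and f: "\<And>x y x' y'. \<lbrakk>x \<in> carrier M; y \<in> carrier N; x' \<in> carrier M'; y' \<in> carrier N'\<rbrakk> \<Longrightarrow>
      f (x, y) (x', y') \<in> carrier Q"
    and eq: "\<And>x y x' y'. \<lbrakk>x \<in> carrier M; y \<in> carrier N; x' \<in> carrier M'; y' \<in> carrier N'\<rbrakk> \<Longrightarrow>
      \<mu> (f (x, y) (x', y')) = \<beta> (pure_tensor A M N x y) (pure_tensor B M' N' x' y')"
    and U: "U \<in> carrier (tensor A M N)" and W: "W \<in> carrier (tensor B M' N')"
  shows "extend_biadditively Q f U W \<in> carrier Q"
    and "\<mu> (extend_biadditively Q f U W) = \<beta> U W"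
proof -
  interpret T: tensor_pair A M N by fact
  interpret T': tensor_pair B M' N' by fact
  note * = extend_biadditively_via_embedding[OF T.relators_subset T'.relators_subset Q Q' \<mu> inj,
      of \<beta> f U W]
  show "extend_biadditively Q f U W \<in> carrier Q"
    by (rule *(1)) (use \<beta>1 \<beta>2 f eq U W in \<open>auto simp: T.tensor_simps T'.tensor_simps pure_tensor_def\<close>)
  show "\<mu> (extend_biadditively Q f U W) = \<beta> U W"
    by (rule *(2)) (use \<beta>1 \<beta>2 f eq U W in \<open>auto simp: T.tensor_simps T'.tensor_simps pure_tensor_def\<close>)
qed


section \<open>The pairing of a star compatible Hermitian line module\<close>

context bimodule
begin

abbreviation "D \<equiv> dual_bimodule A M"

lemma dual_apply_closed: "\<lbrakk>\<alpha> \<in> carrier D; x \<in> carrier M\<rbrakk> \<Longrightarrow> \<alpha> x \<in> carrier A"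
  by (auto simp: dual_bimodule_def)

lemma dual_apply_add:
  "\<lbrakk>\<alpha> \<in> carrier D; x \<in> carrier M; y \<in> carrier M\<rbrakk> \<Longrightarrow> \<alpha> (x \<oplus>\<^bsub>M\<^esub> y) = \<alpha> x \<oplus>\<^bsub>A\<^esub> \<alpha> y"
  by (auto simp: dual_bimodule_def)

lemma dual_apply_lact:
  "\<lbrakk>\<alpha> \<in> carrier D; a \<in> carrier A; x \<in> carrier M\<rbrakk> \<Longrightarrow> \<alpha> (a \<odot>\<^bsub>M\<^esub> x) = a \<otimes>\<^bsub>A\<^esub> \<alpha> x"
  by (auto simp: dual_bimodule_def)

lemma dual_eqI:
  assumes "\<alpha> \<in> carrier D" "\<beta> \<in> carrier D" "\<And>x. x \<in> carrier M \<Longrightarrow> \<alpha> x = \<beta> x"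
  shows "\<alpha> = \<beta>"
  using assms by (intro PiE_ext[of \<alpha> "carrier M" "\<lambda>_. carrier A" \<beta>]) (auto simp: dual_bimodule_def)

lemma dual_add_apply: "x \<in> carrier M \<Longrightarrow> (\<alpha> \<oplus>\<^bsub>D\<^esub> \<beta>) x = \<alpha> x \<oplus>\<^bsub>A\<^esub> \<beta> x"
  by (simp add: dual_bimodule_def)

lemma dual_zero_apply: "x \<in> carrier M \<Longrightarrow> \<zero>\<^bsub>D\<^esub> x = \<zero>\<^bsub>A\<^esub>"
  by (simp add: dual_bimodule_def)

lemma dual_smult_apply: "x \<in> carrier M \<Longrightarrow> (a \<odot>\<^bsub>D\<^esub> \<alpha>) x = \<alpha> (x \<bullet>\<^bsub>M\<^esub> a)"
  by (simp add: dual_bimodule_def)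

lemma dual_rsmult_apply: "x \<in> carrier M \<Longrightarrow> (\<alpha> \<bullet>\<^bsub>D\<^esub> a) x = \<alpha> x \<otimes>\<^bsub>A\<^esub> a"
  by (simp add: dual_bimodule_def)

lemma dual_add_closed: "\<lbrakk>\<alpha> \<in> carrier D; \<beta> \<in> carrier D\<rbrakk> \<Longrightarrow> \<alpha> \<oplus>\<^bsub>D\<^esub> \<beta> \<in> carrier D"
  by (auto simp: dual_bimodule_def Pi_iff PiE_iff A.r_distr A.a_ac lact_closed)

lemma dual_zero_closed: "\<zero>\<^bsub>D\<^esub> \<in> carrier D"
  by (auto simp: dual_bimodule_def lact_closed)

lemma dual_smult_closed: "\<lbrakk>a \<in> carrier A; \<alpha> \<in> carrier D\<rbrakk> \<Longrightarrow> a \<odot>\<^bsub>D\<^esub> \<alpha> \<in> carrier D"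
  by (auto simp: dual_bimodule_def Pi_iff PiE_iff lact_closed ract_closed ract_add lact_ract)

lemma dual_rsmult_closed: "\<lbrakk>\<alpha> \<in> carrier D; a \<in> carrier A\<rbrakk> \<Longrightarrow> \<alpha> \<bullet>\<^bsub>D\<^esub> a \<in> carrier D"
  by (auto simp: dual_bimodule_def Pi_iff PiE_iff lact_closed A.l_distr A.m_assoc)

lemma abelian_group_dual: "abelian_group D"
proof (rule abelian_groupI)
  fix \<alpha> assume \<alpha>: "\<alpha> \<in> carrier D"
  have "(\<lambda>x\<in>carrier M. \<ominus>\<^bsub>A\<^esub> \<alpha> x) \<in> carrier D"
    using \<alpha> by (auto simp: dual_bimodule_def Pi_iff PiE_iff lact_closed A.minus_add A.r_minus)
  moreover have "(\<lambda>x\<in>carrier M. \<ominus>\<^bsub>A\<^esub> \<alpha> x) \<oplus>\<^bsub>D\<^esub> \<alpha> = \<zero>\<^bsub>D\<^esub>"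
    using \<alpha> calculation
    by (intro dual_eqI) (auto simp: dual_add_closed dual_zero_closed dual_add_apply dual_zero_apply
        dual_apply_closed A.l_neg)
  ultimately show "\<exists>\<beta>\<in>carrier D. \<beta> \<oplus>\<^bsub>D\<^esub> \<alpha> = \<zero>\<^bsub>D\<^esub>"
    by blast
qed (auto intro!: dual_eqI simp: dual_add_closed dual_zero_closed dual_add_apply dual_zero_apply
    dual_apply_closed A.a_ac)

lemma tensor_pair_dual_right: "tensor_pair A M D"
  by (intro tensor_pair.intro tensor_pair_axioms.intro abelian_group_dual)
    (auto simp: dual_smult_closed ract_closed M.abelian_group_axioms)

lemma tensor_pair_dual_left: "tensor_pair A D M"
  by (intro tensor_pair.intro tensor_pair_axioms.intro abelian_group_dual)
    (auto simp: dual_rsmult_closed lact_closed M.abelian_group_axioms)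

text \<open>Additivity in both arguments is pointwise, and balance is the definition of the left
  action on the dual.\<close>

lemma ev_add_hom: "ev A M \<in> add_hom (tensor A M D) A"
  and ev_pure: "\<lbrakk>e \<in> carrier M; \<alpha> \<in> carrier D\<rbrakk> \<Longrightarrow> ev A M (pure_tensor A M D e \<alpha>) = \<alpha> e"
proof -
  interpret T: tensor_pair A M D
    by (rule tensor_pair_dual_right)
  have A: "abelian_group A" ..
  show "ev A M \<in> add_hom (tensor A M D) A"
    unfolding ev_def
    by (rule T.tensor_extend(1)[OF A])
      (auto simp: dual_apply_closed dual_apply_add dual_add_apply dual_smult_apply)
  show "ev A M (pure_tensor A M D e \<alpha>) = \<alpha> e" if "e \<in> carrier M" "\<alpha> \<in> carrier D"
    unfolding ev_def
    using that by (subst T.tensor_extend(2)[OF A])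
      (auto simp: dual_apply_closed dual_apply_add dual_add_apply dual_smult_apply)
qed

lemma lact_add_hom: "a \<in> carrier A \<Longrightarrow> (\<lambda>x. a \<odot>\<^bsub>M\<^esub> x) \<in> add_hom M M"
  by (rule add_homI) (simp_all add: lact_closed lact_add)

lemma ract_add_hom: "a \<in> carrier A \<Longrightarrow> (\<lambda>x. x \<bullet>\<^bsub>M\<^esub> a) \<in> add_hom M M"
  by (rule add_homI) (simp_all add: ract_closed ract_add)

lemma lact_scalar_add_hom: "x \<in> carrier M \<Longrightarrow> (\<lambda>a. a \<odot>\<^bsub>M\<^esub> x) \<in> add_hom A M"
  by (rule add_homI) (simp_all add: lact_closed lact_add_scalar)

lemma ract_scalar_add_hom: "x \<in> carrier M \<Longrightarrow> (\<lambda>a. x \<bullet>\<^bsub>M\<^esub> a) \<in> add_hom A M"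
  by (rule add_homI) (simp_all add: ract_closed ract_add_scalar)

end

section \<open>The pairing as a balanced map of bimodules\<close>

locale star_line_module = A: star_algebra A + L: bimodule A L
  for A :: "'a star_algebra" and L :: "('a, 'l) bimodule" +
  fixes st :: "'l \<Rightarrow> 'l" and G :: "'l \<Rightarrow> 'l \<Rightarrow> 'a"
  assumes line: "left_line_module A L"
    and star_op: "star_operation A L st"
    and metric: "hermitian_metric A L G"
    and compat: "star_compatible A L st G"
begin

abbreviation "D \<equiv> dual_bimodule A L"
abbreviation "pr e f \<equiv> inner_product A L G e (st f)"

lemma abelian_groups [intro, simp]: "abelian_group A" "abelian_group L"
  by (rule A.abelian_group_axioms L.M.abelian_group_axioms)+

lemma st_closed [simp]: "e \<in> carrier L \<Longrightarrow> st e \<in> carrier L"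
  and st_add: "\<lbrakk>e \<in> carrier L; f \<in> carrier L\<rbrakk> \<Longrightarrow> st (e \<oplus>\<^bsub>L\<^esub> f) = st e \<oplus>\<^bsub>L\<^esub> st f"
  and st_lact: "\<lbrakk>a \<in> carrier A; e \<in> carrier L\<rbrakk> \<Longrightarrow> st (a \<odot>\<^bsub>L\<^esub> e) = st e \<bullet>\<^bsub>L\<^esub> star A a"
  and st_ract: "\<lbrakk>a \<in> carrier A; e \<in> carrier L\<rbrakk> \<Longrightarrow> st (e \<bullet>\<^bsub>L\<^esub> a) = star A a \<odot>\<^bsub>L\<^esub> st e"
  and st_st [simp]: "e \<in> carrier L \<Longrightarrow> st (st e) = e"
  using star_op by (auto simp: star_operation_def bimod_hom_def conj_bimodule_def)

lemma G_closed: "f \<in> carrier L \<Longrightarrow> G f \<in> carrier D"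
  and G_add: "\<lbrakk>e \<in> carrier L; f \<in> carrier L\<rbrakk> \<Longrightarrow> G (e \<oplus>\<^bsub>L\<^esub> f) = G e \<oplus>\<^bsub>D\<^esub> G f"
  and G_smult: "\<lbrakk>a \<in> carrier A; f \<in> carrier L\<rbrakk> \<Longrightarrow> G (f \<bullet>\<^bsub>L\<^esub> star A a) = a \<odot>\<^bsub>D\<^esub> G f"
  and G_rsmult: "\<lbrakk>a \<in> carrier A; f \<in> carrier L\<rbrakk> \<Longrightarrow> G (star A a \<odot>\<^bsub>L\<^esub> f) = G f \<bullet>\<^bsub>D\<^esub> a"
  and G_bij: "bij_betw G (carrier L) (carrier D)"
proof -
  have "G \<in> bimod_iso A (conj_bimodule A L) D"
    using metric unfolding hermitian_metric_def by blast
  then show "f \<in> carrier L \<Longrightarrow> G f \<in> carrier D"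
    "\<lbrakk>e \<in> carrier L; f \<in> carrier L\<rbrakk> \<Longrightarrow> G (e \<oplus>\<^bsub>L\<^esub> f) = G e \<oplus>\<^bsub>D\<^esub> G f"
    "\<lbrakk>a \<in> carrier A; f \<in> carrier L\<rbrakk> \<Longrightarrow> G (f \<bullet>\<^bsub>L\<^esub> star A a) = a \<odot>\<^bsub>D\<^esub> G f"
    "\<lbrakk>a \<in> carrier A; f \<in> carrier L\<rbrakk> \<Longrightarrow> G (star A a \<odot>\<^bsub>L\<^esub> f) = G f \<bullet>\<^bsub>D\<^esub> a"
    "bij_betw G (carrier L) (carrier D)"
    by (auto simp: bimod_iso_def bimod_hom_def conj_bimodule_def)
qed

lemma hermitian: "\<lbrakk>e \<in> carrier L; f \<in> carrier L\<rbrakk> \<Longrightarrow>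
    inner_product A L G e f = star A (inner_product A L G f e)"
  using metric unfolding hermitian_metric_def by blast

lemma inner_product_eq: "\<lbrakk>e \<in> carrier L; f \<in> carrier L\<rbrakk> \<Longrightarrow> inner_product A L G e f = G f e"
  by (simp add: inner_product_def L.ev_pure G_closed)

text \<open>The composite of the metric with the star. Each of \<open>st\<close> and
  \<open>G\<close> exchanges the sides of the actions up to a star, so the composite is an ordinary
  bimodule isomorphism from \<open>L\<close> to its dual.\<close>

definition "\<phi> = G \<circ> st"
definition "\<psi> = inv_into (carrier L) \<phi>"

lemma st_bij: "bij_betw st (carrier L) (carrier L)"
  by (rule bij_betwI[where g = st]) auto

lemma \<phi>_bij: "bij_betw \<phi> (carrier L) (carrier D)"
  unfolding \<phi>_def using st_bij G_bij by (rule bij_betw_trans)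

lemma \<phi>_closed [simp]: "f \<in> carrier L \<Longrightarrow> \<phi> f \<in> carrier D"
  using \<phi>_bij by (rule bij_betw_apply)

lemma \<phi>_add: "\<lbrakk>e \<in> carrier L; f \<in> carrier L\<rbrakk> \<Longrightarrow> \<phi> (e \<oplus>\<^bsub>L\<^esub> f) = \<phi> e \<oplus>\<^bsub>D\<^esub> \<phi> f"
  by (simp add: \<phi>_def st_add G_add)

lemma \<phi>_lact: "\<lbrakk>a \<in> carrier A; f \<in> carrier L\<rbrakk> \<Longrightarrow> \<phi> (a \<odot>\<^bsub>L\<^esub> f) = a \<odot>\<^bsub>D\<^esub> \<phi> f"
  by (simp add: \<phi>_def st_lact G_smult)

lemma \<phi>_ract: "\<lbrakk>a \<in> carrier A; f \<in> carrier L\<rbrakk> \<Longrightarrow> \<phi> (f \<bullet>\<^bsub>L\<^esub> a) = \<phi> f \<bullet>\<^bsub>D\<^esub> a"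
  by (simp add: \<phi>_def st_ract G_rsmult)

lemma \<psi>_closed [simp]: "\<alpha> \<in> carrier D \<Longrightarrow> \<psi> \<alpha> \<in> carrier L"
  unfolding \<psi>_def using \<phi>_bij by (metis bij_betw_def inv_into_into)

lemma \<phi>_\<psi> [simp]: "\<alpha> \<in> carrier D \<Longrightarrow> \<phi> (\<psi> \<alpha>) = \<alpha>"
  unfolding \<psi>_def using \<phi>_bij by (rule bij_betw_inv_into_right)

lemma \<psi>_\<phi> [simp]: "f \<in> carrier L \<Longrightarrow> \<psi> (\<phi> f) = f"
  unfolding \<psi>_def using \<phi>_bij by (rule bij_betw_inv_into_left)

lemma \<psi>_add: "\<lbrakk>\<alpha> \<in> carrier D; \<beta> \<in> carrier D\<rbrakk> \<Longrightarrow> \<psi> (\<alpha> \<oplus>\<^bsub>D\<^esub> \<beta>) = \<psi> \<alpha> \<oplus>\<^bsub>L\<^esub> \<psi> \<beta>"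
  using \<phi>_add[of "\<psi> \<alpha>" "\<psi> \<beta>"] \<psi>_\<phi>[of "\<psi> \<alpha> \<oplus>\<^bsub>L\<^esub> \<psi> \<beta>"] by simp

lemma \<psi>_lact: "\<lbrakk>a \<in> carrier A; \<alpha> \<in> carrier D\<rbrakk> \<Longrightarrow> \<psi> (a \<odot>\<^bsub>D\<^esub> \<alpha>) = a \<odot>\<^bsub>L\<^esub> \<psi> \<alpha>"
  using \<phi>_lact[of a "\<psi> \<alpha>"] \<psi>_\<phi>[of "a \<odot>\<^bsub>L\<^esub> \<psi> \<alpha>"] by (simp add: L.lact_closed)

lemma \<psi>_ract: "\<lbrakk>a \<in> carrier A; \<alpha> \<in> carrier D\<rbrakk> \<Longrightarrow> \<psi> (\<alpha> \<bullet>\<^bsub>D\<^esub> a) = \<psi> \<alpha> \<bullet>\<^bsub>L\<^esub> a"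
  using \<phi>_ract[of a "\<psi> \<alpha>"] \<psi>_\<phi>[of "\<psi> \<alpha> \<bullet>\<^bsub>L\<^esub> a"] by (simp add: L.ract_closed)

lemma pr_eq: "\<lbrakk>e \<in> carrier L; f \<in> carrier L\<rbrakk> \<Longrightarrow> pr e f = \<phi> f e"
  by (simp add: \<phi>_def inner_product_eq)

lemma pr_closed [simp]: "\<lbrakk>e \<in> carrier L; f \<in> carrier L\<rbrakk> \<Longrightarrow> pr e f \<in> carrier A"
  by (simp add: pr_eq L.dual_apply_closed)

lemma pr_add_left: "\<lbrakk>e \<in> carrier L; e' \<in> carrier L; f \<in> carrier L\<rbrakk> \<Longrightarrow>
    pr (e \<oplus>\<^bsub>L\<^esub> e') f = pr e f \<oplus>\<^bsub>A\<^esub> pr e' f"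
  by (simp add: pr_eq L.dual_apply_add)

lemma pr_add_right: "\<lbrakk>e \<in> carrier L; f \<in> carrier L; f' \<in> carrier L\<rbrakk> \<Longrightarrow>
    pr e (f \<oplus>\<^bsub>L\<^esub> f') = pr e f \<oplus>\<^bsub>A\<^esub> pr e f'"
  by (simp add: pr_eq \<phi>_add L.dual_add_apply)

lemma pr_lact: "\<lbrakk>a \<in> carrier A; e \<in> carrier L; f \<in> carrier L\<rbrakk> \<Longrightarrow> pr (a \<odot>\<^bsub>L\<^esub> e) f = a \<otimes>\<^bsub>A\<^esub> pr e f"
  by (simp add: pr_eq L.lact_closed L.dual_apply_lact)

lemma pr_ract: "\<lbrakk>a \<in> carrier A; e \<in> carrier L; f \<in> carrier L\<rbrakk> \<Longrightarrow> pr e (f \<bullet>\<^bsub>L\<^esub> a) = pr e f \<otimes>\<^bsub>A\<^esub> a"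
  by (simp add: pr_eq L.ract_closed \<phi>_ract L.dual_rsmult_apply)

lemma pr_balanced: "\<lbrakk>a \<in> carrier A; e \<in> carrier L; f \<in> carrier L\<rbrakk> \<Longrightarrow>
    pr (e \<bullet>\<^bsub>L\<^esub> a) f = pr e (a \<odot>\<^bsub>L\<^esub> f)"
  by (simp add: pr_eq L.lact_closed L.ract_closed \<phi>_lact L.dual_smult_apply)

text \<open>Hermitian symmetry with \<open>e\<close> written as \<open>st (st e)\<close>. It makes
  the star reverse products of two odd elements.\<close>

lemma star_pr: "\<lbrakk>e \<in> carrier L; f \<in> carrier L\<rbrakk> \<Longrightarrow> star A (pr e f) = pr (st f) (st e)"
  by (simp flip: hermitian)

lemma pr_left_add_hom: "f \<in> carrier L \<Longrightarrow> (\<lambda>e. pr e f) \<in> add_hom L A"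
  by (rule add_homI) (simp_all add: pr_add_left)

lemma pr_right_add_hom: "e \<in> carrier L \<Longrightarrow> (\<lambda>f. pr e f) \<in> add_hom L A"
  by (rule add_homI) (simp_all add: pr_add_right)

lemma pr_zero_left [simp]: "f \<in> carrier L \<Longrightarrow> pr \<zero>\<^bsub>L\<^esub> f = \<zero>\<^bsub>A\<^esub>"
  by (rule add_hom_zero[OF _ _ pr_left_add_hom]) auto

lemma pr_zero_right [simp]: "e \<in> carrier L \<Longrightarrow> pr e \<zero>\<^bsub>L\<^esub> = \<zero>\<^bsub>A\<^esub>"
  by (rule add_hom_zero[OF _ _ pr_right_add_hom]) auto

text \<open>
  Star compatibility is the statement that the dual basis, moved to \<open>L\<close> along \<open>\<psi>\<close>, is a partition
  of unity for the pairing.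
\<close>

lemma partition_of_unity:
  obtains n :: nat and w u :: "nat \<Rightarrow> 'l" where
    "\<And>i. i < n \<Longrightarrow> w i \<in> carrier L" "\<And>i. i < n \<Longrightarrow> u i \<in> carrier L"
    "(\<Oplus>\<^bsub>A\<^esub>i\<in>{..<n}. pr (w i) (u i)) = \<one>\<^bsub>A\<^esub>"
    "\<And>x. x \<in> carrier L \<Longrightarrow> (\<Oplus>\<^bsub>L\<^esub>i\<in>{..<n}. pr x (w i) \<odot>\<^bsub>L\<^esub> u i) = x"
proof -
  interpret LD: tensor_pair A L D
    by (rule L.tensor_pair_dual_right)
  interpret DL: tensor_pair A D L
    by (rule L.tensor_pair_dual_left)
  \<comment> \<open>\<open>coev_one\<close> is built from one particular choice of dual basis;
    naming the same \<open>SOME\<close> term makes \<open>coev\<close> at 1 an explicit sum. Finite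
    projectivity guarantees that the choice satisfies \<open>dual_basis\<close>.\<close>
  define b where "b = (SOME (n, u, v). dual_basis A L n u v)"
  obtain n u v where b: "b = (n, u, v)"
    by (metis prod.exhaust)
  have "\<exists>b. case b of (n, u, v) \<Rightarrow> dual_basis A L n u v"
    using line by (auto simp: left_line_module_def left_fgp_def)
  then have "case b of (n, u, v) \<Rightarrow> dual_basis A L n u v"
    unfolding b_def by (rule someI_ex)
  then have basis: "dual_basis A L n u v"
    by (simp add: b)
  then have u [simp]: "i < n \<Longrightarrow> u i \<in> carrier L" and v [simp]: "i < n \<Longrightarrow> v i \<in> carrier D" for i
    by (auto simp: dual_basis_def)
  let ?c = "\<Oplus>\<^bsub>DL.T\<^esub>i\<in>{..<n}. DL.pure (v i) (u i)"
  have c: "?c \<in> carrier DL.T"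
    by (intro DL.T.finsum_closed) auto
  have coev: "coev A L \<one>\<^bsub>A\<^esub> = ?c"
  proof -
    have "coev A L \<one>\<^bsub>A\<^esub> = \<one>\<^bsub>A\<^esub> \<odot>\<^bsub>DL.T\<^esub> ?c"
      by (simp add: coev_def coev_one_def b flip: b_def)
    also have "\<dots> = ?c"
      unfolding DL.tensor_smult
    proof (rule DL.tensor_extend_eqI[OF DL.abelian_group_tensor add_hom_id _ c])
      fix \<alpha> y assume "\<alpha> \<in> carrier D" "y \<in> carrier L"
      then have "\<one>\<^bsub>A\<^esub> \<odot>\<^bsub>D\<^esub> \<alpha> = \<alpha>"
        by (intro L.dual_eqI) (auto simp: L.dual_smult_closed L.dual_smult_apply L.ract_one)
      then show "DL.pure \<alpha> y = (case (\<alpha>, y) of (x, y) \<Rightarrow> DL.pure (\<one>\<^bsub>A\<^esub> \<odot>\<^bsub>D\<^esub> x) y)"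
        by simp
    qed
    finally show ?thesis .
  qed
  \<comment> \<open>\<open>tensor_map\<close> extends into the tensor product of \<open>L\<close>
    and its dual, where no relator has been checked. Since \<open>ev\<close> is injective, it
    suffices that the composite with \<open>ev\<close>, which is \<open>?g\<close>, is well defined,
    and its relators are equations in \<open>A\<close>.\<close>
  let ?g = "extend_additively A (\<lambda>(\<beta>, y). \<phi> y (\<psi> \<beta>))"
  have g: "?g \<in> add_hom DL.T A"
    and g_pure: "\<And>\<beta> y. \<lbrakk>\<beta> \<in> carrier D; y \<in> carrier L\<rbrakk> \<Longrightarrow> ?g (DL.pure \<beta> y) = \<phi> y (\<psi> \<beta>)"
    using DL.tensor_extend[of A "\<lambda>(\<beta>, y). \<phi> y (\<psi> \<beta>)"]
    by (simp_all add: L.dual_apply_closed \<psi>_add L.dual_apply_add \<phi>_add L.dual_add_apply \<psi>_ract \<phi>_lact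
        L.dual_smult_apply L.dual_rsmult_closed L.lact_closed)
  have inj: "inj_on (ev A L) (carrier LD.T)"
    using line by (auto simp: left_line_module_def bimod_iso_def bij_betw_def)
  have "ev A L (tensor_map A L D \<psi> \<phi> ?c) = ?g ?c"
    unfolding tensor_map_def
    by (rule DL.tensor_extend_via_embedding(2)[OF LD.abelian_group_tensor _ L.ev_add_hom inj g _ _ c])
      (auto simp: L.ev_pure g_pure)
  moreover have "ev A L (tensor_map A L D \<psi> \<phi> ?c) = \<one>\<^bsub>A\<^esub>"
    using compat by (simp add: star_compatible_def coev \<psi>_def \<phi>_def)
  moreover have "?g ?c = (\<Oplus>\<^bsub>A\<^esub>i\<in>{..<n}. ?g (DL.pure (v i) (u i)))"
    by (rule add_hom_finsum[OF DL.abelian_group_tensor _ g]) auto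
  moreover have "\<dots> = (\<Oplus>\<^bsub>A\<^esub>i\<in>{..<n}. pr (\<psi> (v i)) (u i))"
    by (intro A.finsum_cong') (auto simp: g_pure pr_eq L.dual_apply_closed)
  ultimately have "(\<Oplus>\<^bsub>A\<^esub>i\<in>{..<n}. pr (\<psi> (v i)) (u i)) = \<one>\<^bsub>A\<^esub>"
    by simp
  \<comment> \<open>Pairing with \<open>\<psi> (v i)\<close> is evaluation of \<open>v i\<close>, as
    \<open>\<phi>\<close> undoes \<open>\<psi>\<close>; so this is the dual basis expansion of
    \<open>x\<close>.\<close>
  moreover have "(\<Oplus>\<^bsub>L\<^esub>i\<in>{..<n}. pr x (\<psi> (v i)) \<odot>\<^bsub>L\<^esub> u i) = x" if x: "x \<in> carrier L" for x
  proof -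
    have "(\<Oplus>\<^bsub>L\<^esub>i\<in>{..<n}. pr x (\<psi> (v i)) \<odot>\<^bsub>L\<^esub> u i) = (\<Oplus>\<^bsub>L\<^esub>i\<in>{..<n}. v i x \<odot>\<^bsub>L\<^esub> u i)"
      using x by (intro L.M.finsum_cong') (auto simp: pr_eq L.dual_apply_closed L.lact_closed)
    then show ?thesis
      using basis x by (simp add: dual_basis_def)
  qed
  ultimately show thesis
    by (intro that[of n "\<lambda>i. \<psi> (v i)" u]) auto
qed

text \<open>
  Since the evaluation map is injective, \<open>f \<otimes> g = \<Sum>\<^sub>i (f\<cdot>g) w\<^sub>i \<otimes> u\<^sub>i\<close>; now apply the map
  \<open>x \<otimes> y \<mapsto> (e\<cdot>x) y\<close> to both sides.
\<close>

lemma pr_assoc: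
  assumes e: "e \<in> carrier L" and f: "f \<in> carrier L" and g: "g \<in> carrier L"
  shows "pr e f \<odot>\<^bsub>L\<^esub> g = e \<bullet>\<^bsub>L\<^esub> pr f g"
proof -
  interpret LD: tensor_pair A L D
    by (rule L.tensor_pair_dual_right)
  obtain n w u where w: "\<And>i. i < n \<Longrightarrow> w i \<in> carrier L" and u: "\<And>i. i < n \<Longrightarrow> u i \<in> carrier L"
    and unit: "(\<Oplus>\<^bsub>A\<^esub>i\<in>{..<n::nat}. pr (w i) (u i)) = \<one>\<^bsub>A\<^esub>"
    and expand: "\<And>x. x \<in> carrier L \<Longrightarrow> (\<Oplus>\<^bsub>L\<^esub>i\<in>{..<n}. pr x (w i) \<odot>\<^bsub>L\<^esub> u i) = x"
    by (rule partition_of_unity) blast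
  note [simp] = w u e f g
  let ?a = "pr f g"
  let ?s = "\<Oplus>\<^bsub>LD.T\<^esub>i\<in>{..<n}. LD.pure (?a \<odot>\<^bsub>L\<^esub> w i) (\<phi> (u i))"
  have inj: "inj_on (ev A L) (carrier LD.T)"
    using line by (auto simp: left_line_module_def bimod_iso_def bij_betw_def)
  have s: "?s \<in> carrier LD.T"
    by (intro LD.T.finsum_closed) (auto simp: L.lact_closed)
  have "ev A L ?s = (\<Oplus>\<^bsub>A\<^esub>i\<in>{..<n}. ev A L (LD.pure (?a \<odot>\<^bsub>L\<^esub> w i) (\<phi> (u i))))"
    by (rule add_hom_finsum[OF LD.abelian_group_tensor _ L.ev_add_hom]) (auto simp: L.lact_closed)
  also have "\<dots> = (\<Oplus>\<^bsub>A\<^esub>i\<in>{..<n}. ?a \<otimes>\<^bsub>A\<^esub> pr (w i) (u i))"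
    by (intro A.finsum_cong')
      (auto simp: L.ev_pure pr_eq L.lact_closed L.dual_apply_lact L.dual_apply_closed)
  also have "\<dots> = ?a"
    by (subst A.finsum_rdistr[symmetric]) (auto simp: unit)
  also have "\<dots> = ev A L (LD.pure f (\<phi> g))"
    by (simp add: L.ev_pure pr_eq)
  finally have eq: "?s = LD.pure f (\<phi> g)"
    using inj s by (auto dest: inj_onD)
  let ?h = "extend_additively L (\<lambda>(x, \<beta>). pr e x \<odot>\<^bsub>L\<^esub> \<psi> \<beta>)"
  have h: "?h \<in> add_hom LD.T L"
    and h_pure: "\<And>x \<beta>. \<lbrakk>x \<in> carrier L; \<beta> \<in> carrier D\<rbrakk> \<Longrightarrow> ?h (LD.pure x \<beta>) = pr e x \<odot>\<^bsub>L\<^esub> \<psi> \<beta>"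
    using LD.tensor_extend[of L "\<lambda>(x, \<beta>). pr e x \<odot>\<^bsub>L\<^esub> \<psi> \<beta>"]
    by (simp_all add: L.lact_closed pr_add_right L.lact_add_scalar \<psi>_add L.lact_add
        pr_ract \<psi>_lact L.lact_mult)
  have "pr e f \<odot>\<^bsub>L\<^esub> g = ?h ?s"
    by (simp add: eq h_pure)
  also have "\<dots> = (\<Oplus>\<^bsub>L\<^esub>i\<in>{..<n}. ?h (LD.pure (?a \<odot>\<^bsub>L\<^esub> w i) (\<phi> (u i))))"
    by (rule add_hom_finsum[OF LD.abelian_group_tensor _ h]) (auto simp: L.lact_closed)
  \<comment> \<open>Balance moves the coefficient \<open>?a\<close> from \<open>w i\<close> over to
    \<open>e\<close>, and what remains is the expansion of \<open>e \<bullet> ?a\<close>.\<close>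
  also have "\<dots> = (\<Oplus>\<^bsub>L\<^esub>i\<in>{..<n}. pr (e \<bullet>\<^bsub>L\<^esub> ?a) (w i) \<odot>\<^bsub>L\<^esub> u i)"
    by (intro L.M.finsum_cong') (auto simp: h_pure L.lact_closed L.ract_closed pr_balanced)
  also have "\<dots> = e \<bullet>\<^bsub>L\<^esub> ?a"
    by (simp add: expand L.ract_closed)
  finally show ?thesis .
qed

end


section \<open>The even-odd algebra\<close>

context complex_algebra
begin

lemma smult_closed: "x \<in> carrier A \<Longrightarrow> c \<odot> x \<in> carrier A"
  using module.smult_closed[OF vector_space, of c x] by (simp add: ring_of_type_algebra_def)

lemma smult_add_scalar: "x \<in> carrier A \<Longrightarrow> (c + d) \<odot> x = c \<odot> x \<oplus> d \<odot> x"
  using module.smult_l_distr[OF vector_space, of c d x] by (simp add: ring_of_type_algebra_def)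

lemma smult_add: "\<lbrakk>x \<in> carrier A; y \<in> carrier A\<rbrakk> \<Longrightarrow> c \<odot> (x \<oplus> y) = c \<odot> x \<oplus> c \<odot> y"
  using module.smult_r_distr[OF vector_space, of c x y] by (simp add: ring_of_type_algebra_def)

lemma smult_mult: "x \<in> carrier A \<Longrightarrow> (c * d) \<odot> x = c \<odot> (d \<odot> x)"
  using module.smult_assoc1[OF vector_space, of c d x] by (simp add: ring_of_type_algebra_def)

lemma smult_one: "x \<in> carrier A \<Longrightarrow> 1 \<odot> x = x"
  using module.smult_one[OF vector_space, of x] by (simp add: ring_of_type_algebra_def)

lemma scalar_closed: "c \<odot> \<one> \<in> carrier A"
  by (simp add: smult_closed)

lemma scalar_mult_left: "x \<in> carrier A \<Longrightarrow> (c \<odot> \<one>) \<otimes> x = c \<odot> x"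
  by (simp add: smult_mult_left)

lemma scalar_mult_right: "x \<in> carrier A \<Longrightarrow> x \<otimes> (c \<odot> \<one>) = c \<odot> x"
  by (simp add: smult_mult_right)

lemma smult_add_hom: "(\<lambda>x. c \<odot> x) \<in> add_hom A A"
  by (rule add_homI) (simp_all add: smult_closed smult_add)

lemma smult_zero [simp]: "c \<odot> \<zero> = \<zero>"
  by (rule add_hom_zero[OF abelian_group_axioms abelian_group_axioms smult_add_hom])

lemma smult_scalar_zero: "x \<in> carrier A \<Longrightarrow> 0 \<odot> x = \<zero>"
  using smult_add_scalar[of x 0 0] smult_closed[of x 0] by (simp add: add.r_cancel_one)

end

lemma complex_algebraI:
  fixes C :: "(complex, 'c, 'z) module_scheme"
  assumes "ring C"
    and "\<And>c x. x \<in> carrier C \<Longrightarrow> c \<odot>\<^bsub>C\<^esub> x \<in> carrier C"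
    and "\<And>c d x. x \<in> carrier C \<Longrightarrow> (c + d) \<odot>\<^bsub>C\<^esub> x = c \<odot>\<^bsub>C\<^esub> x \<oplus>\<^bsub>C\<^esub> d \<odot>\<^bsub>C\<^esub> x"
    and "\<And>c x y. \<lbrakk>x \<in> carrier C; y \<in> carrier C\<rbrakk> \<Longrightarrow> c \<odot>\<^bsub>C\<^esub> (x \<oplus>\<^bsub>C\<^esub> y) = c \<odot>\<^bsub>C\<^esub> x \<oplus>\<^bsub>C\<^esub> c \<odot>\<^bsub>C\<^esub> y"
    and "\<And>c d x. x \<in> carrier C \<Longrightarrow> (c * d) \<odot>\<^bsub>C\<^esub> x = c \<odot>\<^bsub>C\<^esub> (d \<odot>\<^bsub>C\<^esub> x)"
    and "\<And>x. x \<in> carrier C \<Longrightarrow> 1 \<odot>\<^bsub>C\<^esub> x = x"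
    and "\<And>c x y. \<lbrakk>x \<in> carrier C; y \<in> carrier C\<rbrakk> \<Longrightarrow> (c \<odot>\<^bsub>C\<^esub> x) \<otimes>\<^bsub>C\<^esub> y = c \<odot>\<^bsub>C\<^esub> (x \<otimes>\<^bsub>C\<^esub> y)"
    and "\<And>c x y. \<lbrakk>x \<in> carrier C; y \<in> carrier C\<rbrakk> \<Longrightarrow> x \<otimes>\<^bsub>C\<^esub> (c \<odot>\<^bsub>C\<^esub> y) = c \<odot>\<^bsub>C\<^esub> (x \<otimes>\<^bsub>C\<^esub> y)"
  shows "complex_algebra C"
proof -
  interpret C: ring C by fact
  have "module complex_ring C"
  proof (rule moduleI)
    show "cring complex_ring" ..
    show "abelian_group C" ..
  qed (use assms in \<open>simp_all add: ring_of_type_algebra_def\<close>)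
  then show ?thesis
    using assms by (intro complex_algebra.intro complex_algebra_axioms.intro)
qed

context star_algebra
begin

lemma star_one: "star A \<one> = \<one>"
  using star_mult[of "star A \<one>" \<one>] star_closed[of \<one>] by (simp add: star_star)

lemma star_add_hom: "star A \<in> add_hom A A"
  by (rule add_homI) (simp_all add: star_closed star_add)

end

context bimodule
begin

lemma smult_eq_left: "\<lbrakk>a \<in> carrier A; x \<in> carrier M\<rbrakk> \<Longrightarrow> (c \<odot>\<^bsub>A\<^esub> a) \<odot>\<^bsub>M\<^esub> x = (c \<odot>\<^bsub>A\<^esub> \<one>\<^bsub>A\<^esub>) \<odot>\<^bsub>M\<^esub> (a \<odot>\<^bsub>M\<^esub> x)"
  by (simp add: A.scalar_closed A.scalar_mult_left flip: lact_mult)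

lemma smult_eq_right: "\<lbrakk>a \<in> carrier A; x \<in> carrier M\<rbrakk> \<Longrightarrow> x \<bullet>\<^bsub>M\<^esub> (c \<odot>\<^bsub>A\<^esub> a) = (c \<odot>\<^bsub>A\<^esub> \<one>\<^bsub>A\<^esub>) \<odot>\<^bsub>M\<^esub> (x \<bullet>\<^bsub>M\<^esub> a)"
  by (simp add: complex_central ract_closed A.scalar_closed A.scalar_mult_right flip: ract_mult)

lemma lact_scalar_commute:
  "\<lbrakk>a \<in> carrier A; x \<in> carrier M\<rbrakk> \<Longrightarrow> a \<odot>\<^bsub>M\<^esub> ((c \<odot>\<^bsub>A\<^esub> \<one>\<^bsub>A\<^esub>) \<odot>\<^bsub>M\<^esub> x) = (c \<odot>\<^bsub>A\<^esub> \<one>\<^bsub>A\<^esub>) \<odot>\<^bsub>M\<^esub> (a \<odot>\<^bsub>M\<^esub> x)"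
  by (simp add: A.scalar_closed A.scalar_mult_left A.scalar_mult_right flip: lact_mult)

lemma scalar_lact_assoc: "x \<in> carrier M \<Longrightarrow>
    (c \<odot>\<^bsub>A\<^esub> (d \<odot>\<^bsub>A\<^esub> \<one>\<^bsub>A\<^esub>)) \<odot>\<^bsub>M\<^esub> x = (c \<odot>\<^bsub>A\<^esub> \<one>\<^bsub>A\<^esub>) \<odot>\<^bsub>M\<^esub> ((d \<odot>\<^bsub>A\<^esub> \<one>\<^bsub>A\<^esub>) \<odot>\<^bsub>M\<^esub> x)"
  by (rule smult_eq_left) (simp_all add: A.scalar_closed)

lemma lact_zero [simp]: "a \<in> carrier A \<Longrightarrow> a \<odot>\<^bsub>M\<^esub> \<zero>\<^bsub>M\<^esub> = \<zero>\<^bsub>M\<^esub>"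
  by (rule add_hom_zero[OF M.abelian_group_axioms M.abelian_group_axioms lact_add_hom])

lemma ract_zero [simp]: "a \<in> carrier A \<Longrightarrow> \<zero>\<^bsub>M\<^esub> \<bullet>\<^bsub>M\<^esub> a = \<zero>\<^bsub>M\<^esub>"
  by (rule add_hom_zero[OF M.abelian_group_axioms M.abelian_group_axioms ract_add_hom])

lemma zero_lact [simp]: "x \<in> carrier M \<Longrightarrow> \<zero>\<^bsub>A\<^esub> \<odot>\<^bsub>M\<^esub> x = \<zero>\<^bsub>M\<^esub>"
  by (rule add_hom_zero[OF A.abelian_group_axioms M.abelian_group_axioms lact_scalar_add_hom])

lemma zero_ract [simp]: "x \<in> carrier M \<Longrightarrow> x \<bullet>\<^bsub>M\<^esub> \<zero>\<^bsub>A\<^esub> = \<zero>\<^bsub>M\<^esub>"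
  by (rule add_hom_zero[OF A.abelian_group_axioms M.abelian_group_axioms ract_scalar_add_hom])

lemmas action_simps = lact_closed ract_closed lact_add_scalar ract_add_scalar lact_add ract_add
  lact_mult ract_mult lact_one ract_one lact_ract

end

section \<open>Ring structure, star and partition of unity of the even-odd algebra\<close>

context star_line_module
begin

abbreviation "C \<equiv> even_odd_algebra A L st G"

lemma C_carrier_iff [simp]: "(a, e) \<in> carrier C \<longleftrightarrow> a \<in> carrier A \<and> e \<in> carrier L"
  by (simp add: even_odd_algebra_def)

lemma C_carrier: "carrier C = carrier A \<times> carrier L"
  by (simp add: even_odd_algebra_def)

lemma C_simps:
  "(a, e) \<otimes>\<^bsub>C\<^esub> (b, f) = (a \<otimes>\<^bsub>A\<^esub> b \<oplus>\<^bsub>A\<^esub> pr e f, a \<odot>\<^bsub>L\<^esub> f \<oplus>\<^bsub>L\<^esub> e \<bullet>\<^bsub>L\<^esub> b)"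
  "(a, e) \<oplus>\<^bsub>C\<^esub> (b, f) = (a \<oplus>\<^bsub>A\<^esub> b, e \<oplus>\<^bsub>L\<^esub> f)"
  "\<one>\<^bsub>C\<^esub> = (\<one>\<^bsub>A\<^esub>, \<zero>\<^bsub>L\<^esub>)"
  "\<zero>\<^bsub>C\<^esub> = (\<zero>\<^bsub>A\<^esub>, \<zero>\<^bsub>L\<^esub>)"
  "c \<odot>\<^bsub>C\<^esub> (a, e) = (c \<odot>\<^bsub>A\<^esub> a, (c \<odot>\<^bsub>A\<^esub> \<one>\<^bsub>A\<^esub>) \<odot>\<^bsub>L\<^esub> e)"
  by (simp_all add: even_odd_algebra_def)

lemmas pr_simps = pr_closed pr_add_left pr_add_right pr_lact pr_ract pr_balanced

text \<open>Associativity with one odd factor is the bimodule axioms, with two odd factors it is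
  linearity and balance of the pairing, and with three odd factors it is exactly
  \<open>pr_assoc\<close>.\<close>

lemma ring_C: "ring C"
proof (rule ringI)
  show "abelian_group C"
  proof (rule abelian_groupI)
    fix x assume "x \<in> carrier C"
    then show "\<exists>y\<in>carrier C. y \<oplus>\<^bsub>C\<^esub> x = \<zero>\<^bsub>C\<^esub>"
      by (cases x) (auto simp: C_simps A.l_neg L.M.l_neg C_carrier
          intro!: bexI[of _ "\<ominus>\<^bsub>A\<^esub> fst x"] bexI[of _ "\<ominus>\<^bsub>L\<^esub> snd x"])
  qed (auto simp: C_simps C_carrier A.a_ac L.M.a_ac)
  show "monoid C"
  proof (rule monoidI)
    fix x y z assume "x \<in> carrier C" "y \<in> carrier C" "z \<in> carrier C"
    then show "x \<otimes>\<^bsub>C\<^esub> y \<otimes>\<^bsub>C\<^esub> z = x \<otimes>\<^bsub>C\<^esub> (y \<otimes>\<^bsub>C\<^esub> z)"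
      by (auto simp: C_simps C_carrier L.action_simps pr_simps pr_assoc A.l_distr A.r_distr
          A.m_assoc A.a_ac L.M.a_ac)
  qed (auto simp: C_simps C_carrier L.action_simps)
qed (auto simp: C_simps C_carrier L.action_simps pr_simps A.l_distr A.r_distr A.a_ac L.M.a_ac)

text \<open>Balance carries the scalar to the right of \<open>e\<close>,
  \<open>complex_central\<close> to its left, and left linearity takes it out.\<close>

lemma pr_scalar_right:
  "\<lbrakk>e \<in> carrier L; f \<in> carrier L\<rbrakk> \<Longrightarrow> pr e ((c \<odot>\<^bsub>A\<^esub> \<one>\<^bsub>A\<^esub>) \<odot>\<^bsub>L\<^esub> f) = c \<odot>\<^bsub>A\<^esub> pr e f"
  by (simp add: A.scalar_closed A.scalar_mult_left pr_lact flip: pr_balanced L.complex_central)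

lemma complex_algebra_C: "complex_algebra C"
proof (rule complex_algebraI[OF ring_C])
  fix c x y assume "x \<in> carrier C" "y \<in> carrier C"
  then obtain a e b f where xy: "x = (a, e)" "y = (b, f)" "a \<in> carrier A" "e \<in> carrier L"
    "b \<in> carrier A" "f \<in> carrier L"
    by (auto simp: C_carrier)
  show "c \<odot>\<^bsub>C\<^esub> x \<otimes>\<^bsub>C\<^esub> y = c \<odot>\<^bsub>C\<^esub> (x \<otimes>\<^bsub>C\<^esub> y)"
    using xy L.smult_eq_left[of a f c]
    by (simp add: C_simps A.scalar_closed pr_lact A.scalar_mult_left A.smult_mult_left A.smult_add
        L.lact_ract L.lact_add L.lact_closed L.ract_closed)
  show "x \<otimes>\<^bsub>C\<^esub> (c \<odot>\<^bsub>C\<^esub> y) = c \<odot>\<^bsub>C\<^esub> (x \<otimes>\<^bsub>C\<^esub> y)"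
    using xy L.lact_scalar_commute[of a f c]
    by (simp add: C_simps A.scalar_closed pr_scalar_right A.smult_mult_right A.smult_add
        L.smult_eq_right L.lact_add L.lact_closed L.ract_closed)
qed (auto simp: C_simps C_carrier A.smult_closed L.lact_closed A.smult_add_scalar A.smult_add
      A.smult_mult A.smult_one L.scalar_lact_assoc L.lact_add_scalar L.lact_add L.lact_one A.scalar_closed)

sublocale C: complex_algebra C
  by (rule complex_algebra_C)

lemma C_a_inv: "\<lbrakk>a \<in> carrier A; e \<in> carrier L\<rbrakk> \<Longrightarrow> \<ominus>\<^bsub>C\<^esub> (a, e) = (\<ominus>\<^bsub>A\<^esub> a, \<ominus>\<^bsub>L\<^esub> e)"
  by (rule C.minus_equality) (simp_all add: C_simps A.l_neg L.M.l_neg)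

text \<open>The record of the even-odd algebra has no star field, so its star is kept as a separate
  function. It induces the stars of both graded algebras of part (a).\<close>

definition cst :: "'a \<times> 'l \<Rightarrow> 'a \<times> 'l"
  where "cst = (\<lambda>(a, e). (star A a, st e))"

lemma cst_closed: "x \<in> carrier C \<Longrightarrow> cst x \<in> carrier C"
  by (auto simp: cst_def C_carrier A.star_closed)

lemma cst_cst: "x \<in> carrier C \<Longrightarrow> cst (cst x) = x"
  by (auto simp: cst_def C_carrier A.star_star)

lemma cst_add: "\<lbrakk>x \<in> carrier C; y \<in> carrier C\<rbrakk> \<Longrightarrow> cst (x \<oplus>\<^bsub>C\<^esub> y) = cst x \<oplus>\<^bsub>C\<^esub> cst y"
  by (auto simp: cst_def C_simps C_carrier A.star_add st_add)

lemma cst_mult: "\<lbrakk>x \<in> carrier C; y \<in> carrier C\<rbrakk> \<Longrightarrow> cst (x \<otimes>\<^bsub>C\<^esub> y) = cst y \<otimes>\<^bsub>C\<^esub> cst x"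
  by (auto simp: cst_def C_simps C_carrier A.star_add A.star_mult A.star_closed star_pr st_add st_lact st_ract
      L.lact_closed L.ract_closed L.M.a_ac)

lemma st_smult: "e \<in> carrier L \<Longrightarrow> st ((c \<odot>\<^bsub>A\<^esub> \<one>\<^bsub>A\<^esub>) \<odot>\<^bsub>L\<^esub> e) = (cnj c \<odot>\<^bsub>A\<^esub> \<one>\<^bsub>A\<^esub>) \<odot>\<^bsub>L\<^esub> st e"
  by (simp add: st_ract A.scalar_closed A.star_smult A.star_one L.complex_central)

lemma cst_smult: "x \<in> carrier C \<Longrightarrow> cst (c \<odot>\<^bsub>C\<^esub> x) = cnj c \<odot>\<^bsub>C\<^esub> cst x"
  by (auto simp: cst_def C_simps C_carrier A.star_smult st_smult)

lemma cst_add_hom: "cst \<in> add_hom C C"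
  by (rule add_homI) (simp_all add: cst_closed cst_add)

lemma even_embedding_add_hom: "(\<lambda>a. (a, \<zero>\<^bsub>L\<^esub>)) \<in> add_hom A C"
  by (rule add_homI) (simp_all add: C_simps)

lemma snd_add_hom: "snd \<in> add_hom C L"
  by (rule add_homI) (auto simp: C_simps C_carrier)

text \<open>Multiplying \<open>x\<close> by 1, written as a sum of products of two odd elements.
  Bracketing to the left isolates the odd factor \<open>u i\<close>, which is what gets split off
  into a second tensor factor later on.\<close>

lemma C_partition_of_unity:
  obtains n :: nat and w u :: "nat \<Rightarrow> 'l" where
    "\<And>i. i < n \<Longrightarrow> w i \<in> carrier L" "\<And>i. i < n \<Longrightarrow> u i \<in> carrier L"
    "\<And>x. x \<in> carrier C \<Longrightarrow>
      (\<Oplus>\<^bsub>C\<^esub>i\<in>{..<n}. x \<otimes>\<^bsub>C\<^esub> (\<zero>\<^bsub>A\<^esub>, w i) \<otimes>\<^bsub>C\<^esub> (\<zero>\<^bsub>A\<^esub>, u i)) = x"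
proof -
  obtain n w u where w: "\<And>i. i < n \<Longrightarrow> w i \<in> carrier L" and u: "\<And>i. i < n \<Longrightarrow> u i \<in> carrier L"
    and unit: "(\<Oplus>\<^bsub>A\<^esub>i\<in>{..<n::nat}. pr (w i) (u i)) = \<one>\<^bsub>A\<^esub>"
    by (rule partition_of_unity) blast
  have "(\<Oplus>\<^bsub>C\<^esub>i\<in>{..<n}. x \<otimes>\<^bsub>C\<^esub> (\<zero>\<^bsub>A\<^esub>, w i) \<otimes>\<^bsub>C\<^esub> (\<zero>\<^bsub>A\<^esub>, u i)) = x" if x: "x \<in> carrier C" for x
  proof -
    have "(\<Oplus>\<^bsub>C\<^esub>i\<in>{..<n}. x \<otimes>\<^bsub>C\<^esub> (\<zero>\<^bsub>A\<^esub>, w i) \<otimes>\<^bsub>C\<^esub> (\<zero>\<^bsub>A\<^esub>, u i))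
        = (\<Oplus>\<^bsub>C\<^esub>i\<in>{..<n}. x \<otimes>\<^bsub>C\<^esub> (pr (w i) (u i), \<zero>\<^bsub>L\<^esub>))"
      using x w u by (intro C.finsum_cong') (auto simp: C.m_assoc C_simps)
    also have "\<dots> = x \<otimes>\<^bsub>C\<^esub> (\<Oplus>\<^bsub>C\<^esub>i\<in>{..<n}. (pr (w i) (u i), \<zero>\<^bsub>L\<^esub>))"
      using x w u by (intro C.finsum_rdistr[symmetric]) auto
    also have "(\<Oplus>\<^bsub>C\<^esub>i\<in>{..<n}. (pr (w i) (u i), \<zero>\<^bsub>L\<^esub>)) = (\<one>\<^bsub>A\<^esub>, \<zero>\<^bsub>L\<^esub>)"
      using add_hom_finsum[OF _ C.abelian_group_axioms even_embedding_add_hom, of "\<lambda>i. pr (w i) (u i)" "{..<n}"] w u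
      by (simp add: unit)
    finally show ?thesis
      using x by (simp flip: C_simps)
  qed
  with w u show thesis
    by (intro that[of n w u])
qed

lemma even_odd_degree_mult:
  "\<lbrakk>x \<in> even_odd_degree A L i; y \<in> even_odd_degree A L j\<rbrakk> \<Longrightarrow> x \<otimes>\<^bsub>C\<^esub> y \<in> even_odd_degree A L (i + j)"
  by (cases i; cases j) (auto simp: even_odd_degree_def C_simps L.lact_closed L.ract_closed)

lemma even_odd_degree_subset: "even_odd_degree A L i \<subseteq> carrier C"
  by (auto simp: even_odd_degree_def)

lemma even_odd_degree_submodule: "submodule (even_odd_degree A L i) complex_ring C"
proof (rule module.submoduleI[OF C.vector_space])
  show "\<ominus>\<^bsub>C\<^esub> x \<in> even_odd_degree A L i" if "x \<in> even_odd_degree A L i" for x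
    using that by (auto simp: even_odd_degree_def C_a_inv split: if_splits)
qed (auto simp: even_odd_degree_def C_simps A.smult_closed L.lact_closed A.scalar_closed
    L.lact_zero split: if_splits)

end


section \<open>Graded star algebras realised by polynomials over the even-odd algebra\<close>

context star_line_module
begin

text \<open>The coefficient ring need not be commutative here. Elements are functions from degrees
  to coefficients, so equalities can be tested in each degree separately.\<close>

abbreviation "P \<equiv> UP C"

lemma ring_P: "ring P"
  by (rule UP_ring.UP_ring) (simp add: UP_ring_def C.ring_axioms)

lemma P_zero_apply [simp]: "\<zero>\<^bsub>P\<^esub> n = \<zero>\<^bsub>C\<^esub>"
  by (simp add: UP_def)

lemma P_one_apply: "\<one>\<^bsub>P\<^esub> n = (if n = 0 then \<one>\<^bsub>C\<^esub> else \<zero>\<^bsub>C\<^esub>)"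
  by (simp add: UP_def)

lemma P_add_apply: "\<lbrakk>f \<in> carrier P; g \<in> carrier P\<rbrakk> \<Longrightarrow> (f \<oplus>\<^bsub>P\<^esub> g) n = f n \<oplus>\<^bsub>C\<^esub> g n"
  unfolding UP_def by simp

lemma P_mult_apply: "\<lbrakk>f \<in> carrier P; g \<in> carrier P\<rbrakk> \<Longrightarrow>
    (f \<otimes>\<^bsub>P\<^esub> g) n = (\<Oplus>\<^bsub>C\<^esub>i\<in>{..n}. f i \<otimes>\<^bsub>C\<^esub> g (n - i))"
  unfolding UP_def by simp

sublocale P: ring P
  by (rule ring_P)

lemma P_carrier: "carrier P = up C"
  by (simp add: UP_def)

lemma P_closed: "f \<in> carrier P \<Longrightarrow> f n \<in> carrier C"
  by (auto simp: P_carrier)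

lemma P_finite:
  assumes "f \<in> carrier P"
  shows "finite {n. f n \<noteq> \<zero>\<^bsub>C\<^esub>}"
proof -
  obtain b where "bound \<zero>\<^bsub>C\<^esub> b f"
    using assms by (auto simp: P_carrier up_def)
  then have "{n. f n \<noteq> \<zero>\<^bsub>C\<^esub>} \<subseteq> {..b}"
    using bound_below[of "\<zero>\<^bsub>C\<^esub>" b f] by auto
  then show ?thesis
    by (rule finite_subset) simp
qed

lemma P_I:
  assumes "\<And>n. f n \<in> carrier C" "finite {n. f n \<noteq> \<zero>\<^bsub>C\<^esub>}"
  shows "f \<in> carrier P"
proof -
  obtain b where "\<forall>n\<in>{n. f n \<noteq> \<zero>\<^bsub>C\<^esub>}. n \<le> b"
    using assms(2) finite_nat_set_iff_bounded_le by auto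
  then have "bound \<zero>\<^bsub>C\<^esub> b f"
    by (intro bound.intro) (auto simp: not_le[symmetric])
  with assms(1) show ?thesis
    by (auto simp: P_carrier)
qed

lemma P_apply_add_hom: "(\<lambda>f. f n) \<in> add_hom P C"
  by (rule add_homI) (simp_all add: P_closed P_add_apply)

lemma P_a_inv_apply: "f \<in> carrier P \<Longrightarrow> (\<ominus>\<^bsub>P\<^esub> f) n = \<ominus>\<^bsub>C\<^esub> f n"
  by (rule add_hom_a_inv[OF P.abelian_group_axioms C.abelian_group_axioms P_apply_add_hom])

lemma P_finsum_apply: "f \<in> I \<rightarrow> carrier P \<Longrightarrow> (\<Oplus>\<^bsub>P\<^esub>i\<in>I. f i) n = (\<Oplus>\<^bsub>C\<^esub>i\<in>I. f i n)"
  by (rule add_hom_finsum[OF P.abelian_group_axioms C.abelian_group_axioms P_apply_add_hom])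

text \<open>Star and complex scalars act on each coefficient. The scalars that \<open>UP C\<close>
  itself provides are elements of \<open>C\<close>, hence the separate
  \<open>P_smult\<close>.\<close>

definition P_star :: "(nat \<Rightarrow> 'a \<times> 'l) \<Rightarrow> nat \<Rightarrow> 'a \<times> 'l"
  where "P_star f = (\<lambda>n. cst (f n))"

definition P_smult :: "complex \<Rightarrow> (nat \<Rightarrow> 'a \<times> 'l) \<Rightarrow> nat \<Rightarrow> 'a \<times> 'l"
  where "P_smult c f = (\<lambda>n. c \<odot>\<^bsub>C\<^esub> f n)"

lemma P_map_add_hom:
  assumes g: "g \<in> add_hom C C"
  shows "(\<lambda>f n. g (f n)) \<in> add_hom P P"
proof (rule add_homI)
  have zero: "g \<zero>\<^bsub>C\<^esub> = \<zero>\<^bsub>C\<^esub>"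
    using g by (rule add_hom_zero[OF C.abelian_group_axioms C.abelian_group_axioms])
  show closed: "(\<lambda>n. g (f n)) \<in> carrier P" if f: "f \<in> carrier P" for f
  proof (rule P_I)
    have "{n. g (f n) \<noteq> \<zero>\<^bsub>C\<^esub>} \<subseteq> {n. f n \<noteq> \<zero>\<^bsub>C\<^esub>}"
      using zero by auto
    then show "finite {n. g (f n) \<noteq> \<zero>\<^bsub>C\<^esub>}"
      using P_finite[OF f] by (rule finite_subset)
  qed (rule add_hom_closed[OF g P_closed[OF f]])
  show "(\<lambda>n. g ((f \<oplus>\<^bsub>P\<^esub> f') n)) = (\<lambda>n. g (f n)) \<oplus>\<^bsub>P\<^esub> (\<lambda>n. g (f' n))"
    if "f \<in> carrier P" "f' \<in> carrier P" for f f'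
    using that by (intro ext) (simp add: P_add_apply closed add_hom_add[OF g] P_closed)
qed

lemma P_star_add_hom: "P_star \<in> add_hom P P"
  unfolding P_star_def[abs_def] using cst_add_hom by (rule P_map_add_hom)

lemma P_smult_add_hom: "P_smult c \<in> add_hom P P"
  unfolding P_smult_def[abs_def] using C.smult_add_hom by (rule P_map_add_hom)

lemmas P_star_closed = add_hom_closed[OF P_star_add_hom]
  and P_star_add = add_hom_add[OF P_star_add_hom]
  and P_smult_closed = add_hom_closed[OF P_smult_add_hom]
  and P_smult_add = add_hom_add[OF P_smult_add_hom]

lemma P_star_mult:
  assumes f: "f \<in> carrier P" and g: "g \<in> carrier P"
  shows "P_star (f \<otimes>\<^bsub>P\<^esub> g) = P_star g \<otimes>\<^bsub>P\<^esub> P_star f"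
proof
  fix n
  note [simp] = P_closed[OF f] P_closed[OF g] cst_closed
  let ?F = "\<lambda>k. cst (g k) \<otimes>\<^bsub>C\<^esub> cst (f (n - k))"
  have "P_star (f \<otimes>\<^bsub>P\<^esub> g) n = cst (\<Oplus>\<^bsub>C\<^esub>i\<in>{..n}. f i \<otimes>\<^bsub>C\<^esub> g (n - i))"
    using f g by (simp add: P_star_def P_mult_apply)
  also have "\<dots> = (\<Oplus>\<^bsub>C\<^esub>i\<in>{..n}. cst (f i \<otimes>\<^bsub>C\<^esub> g (n - i)))"
    by (rule add_hom_finsum[OF C.abelian_group_axioms C.abelian_group_axioms cst_add_hom]) auto
  also have "\<dots> = (\<Oplus>\<^bsub>C\<^esub>i\<in>{..n}. ?F (n - i))"
    by (intro C.finsum_cong') (auto simp: cst_mult)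
  \<comment> \<open>The star reverses each product, so the convolution has to be read backwards:
    reindex by i to n - i.\<close>
  also have "\<dots> = (\<Oplus>\<^bsub>C\<^esub>i\<in>(\<lambda>i. n - i) ` {..n}. ?F i)"
    by (rule C.finsum_reindex[symmetric]) (auto simp: inj_on_def)
  also have "(\<lambda>i. n - i) ` {..n} = {..n}"
    by (auto simp: image_iff) (metis atMost_iff diff_diff_cancel diff_le_self)
  finally show "P_star (f \<otimes>\<^bsub>P\<^esub> g) n = (P_star g \<otimes>\<^bsub>P\<^esub> P_star f) n"
    using f g by (simp add: P_mult_apply P_star_closed, simp add: P_star_def)
qed

lemma P_smult_mult_left:
  assumes f: "f \<in> carrier P" and g: "g \<in> carrier P"
  shows "P_smult c f \<otimes>\<^bsub>P\<^esub> g = P_smult c (f \<otimes>\<^bsub>P\<^esub> g)"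
proof
  fix n
  note [simp] = P_closed[OF f] P_closed[OF g]
  have "(P_smult c f \<otimes>\<^bsub>P\<^esub> g) n = (\<Oplus>\<^bsub>C\<^esub>i\<in>{..n}. c \<odot>\<^bsub>C\<^esub> (f i \<otimes>\<^bsub>C\<^esub> g (n - i)))"
    using f g by (simp add: P_mult_apply P_smult_closed, simp add: P_smult_def C.smult_mult_left)
  also have "\<dots> = c \<odot>\<^bsub>C\<^esub> (\<Oplus>\<^bsub>C\<^esub>i\<in>{..n}. f i \<otimes>\<^bsub>C\<^esub> g (n - i))"
    by (rule add_hom_finsum[OF C.abelian_group_axioms C.abelian_group_axioms C.smult_add_hom, symmetric]) auto
  finally show "(P_smult c f \<otimes>\<^bsub>P\<^esub> g) n = P_smult c (f \<otimes>\<^bsub>P\<^esub> g) n"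
    using f g by (simp add: P_mult_apply P_smult_def)
qed

lemma P_smult_mult_right:
  assumes f: "f \<in> carrier P" and g: "g \<in> carrier P"
  shows "f \<otimes>\<^bsub>P\<^esub> P_smult c g = P_smult c (f \<otimes>\<^bsub>P\<^esub> g)"
proof
  fix n
  note [simp] = P_closed[OF f] P_closed[OF g]
  have "(f \<otimes>\<^bsub>P\<^esub> P_smult c g) n = (\<Oplus>\<^bsub>C\<^esub>i\<in>{..n}. c \<odot>\<^bsub>C\<^esub> (f i \<otimes>\<^bsub>C\<^esub> g (n - i)))"
    using f g by (simp add: P_mult_apply P_smult_closed, simp add: P_smult_def C.smult_mult_right)
  also have "\<dots> = c \<odot>\<^bsub>C\<^esub> (\<Oplus>\<^bsub>C\<^esub>i\<in>{..n}. f i \<otimes>\<^bsub>C\<^esub> g (n - i))"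
    by (rule add_hom_finsum[OF C.abelian_group_axioms C.abelian_group_axioms C.smult_add_hom, symmetric]) auto
  finally show "(f \<otimes>\<^bsub>P\<^esub> P_smult c g) n = P_smult c (f \<otimes>\<^bsub>P\<^esub> g) n"
    using f g by (simp add: P_mult_apply P_smult_def)
qed

text \<open>\<open>of_nat n\<close> in type \<open>bit\<close> is the parity of
  \<open>n\<close>.\<close>

definition graded_polys :: "(nat \<Rightarrow> 'a \<times> 'l) set"
  where "graded_polys = {f \<in> carrier P. \<forall>n. f n \<in> even_odd_degree A L (of_nat n)}"

definition single :: "nat \<Rightarrow> 'a \<times> 'l \<Rightarrow> nat \<Rightarrow> 'a \<times> 'l"
  where "single n x = (\<lambda>m. if m = n then x else \<zero>\<^bsub>C\<^esub>)"

lemma zero_in_even_odd_degree: "\<zero>\<^bsub>C\<^esub> \<in> even_odd_degree A L i"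
  by (simp add: even_odd_degree_def C_simps)

lemma single_graded:
  assumes "x \<in> even_odd_degree A L (of_nat n)"
  shows "single n x \<in> graded_polys"
proof -
  have "single n x \<in> carrier P"
    using assms even_odd_degree_subset
    by (intro P_I) (auto simp: single_def intro: finite_subset[of _ "{n}"])
  then show ?thesis
    using assms by (auto simp: graded_polys_def single_def zero_in_even_odd_degree)
qed

lemma graded_polys_carrier: "f \<in> graded_polys \<Longrightarrow> f \<in> carrier P"
  by (simp add: graded_polys_def)

lemma graded_polys_single: "f \<in> graded_polys \<Longrightarrow> single n (f n) \<in> graded_polys"
  by (rule single_graded) (simp add: graded_polys_def)

lemma graded_polys_a_inv: "f \<in> graded_polys \<Longrightarrow> \<ominus>\<^bsub>P\<^esub> f \<in> graded_polys"
  using subgroup.m_inv_closed[OF submodule.axioms(1)[OF even_odd_degree_submodule]]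
  by (simp add: graded_polys_def P_a_inv_apply flip: a_inv_def)

end

text \<open>
  Both algebras of part (a) satisfy this locale, so their ring and star axioms, their gradings, and the
  isomorphism between them are all read off from \<open>h\<close>.
\<close>

locale graded_model = star_line_module A L st G
  for A :: "'a star_algebra" and L :: "('a, 'l) bimodule" and st :: "'l \<Rightarrow> 'l" and G :: "'l \<Rightarrow> 'l \<Rightarrow> 'a" +
  fixes T :: "'d star_algebra" and gr :: "nat \<Rightarrow> 'd set" and h :: "'d \<Rightarrow> nat \<Rightarrow> 'a \<times> 'l"
  assumes T_zero: "\<zero>\<^bsub>T\<^esub> \<in> carrier T" "h \<zero>\<^bsub>T\<^esub> = \<zero>\<^bsub>P\<^esub>"
    and T_one: "\<one>\<^bsub>T\<^esub> \<in> carrier T" "h \<one>\<^bsub>T\<^esub> = \<one>\<^bsub>P\<^esub>"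
    and T_add_closed: "\<lbrakk>x \<in> carrier T; y \<in> carrier T\<rbrakk> \<Longrightarrow> x \<oplus>\<^bsub>T\<^esub> y \<in> carrier T"
    and h_add: "\<lbrakk>x \<in> carrier T; y \<in> carrier T\<rbrakk> \<Longrightarrow> h (x \<oplus>\<^bsub>T\<^esub> y) = h x \<oplus>\<^bsub>P\<^esub> h y"
    and T_mult_closed: "\<lbrakk>x \<in> carrier T; y \<in> carrier T\<rbrakk> \<Longrightarrow> x \<otimes>\<^bsub>T\<^esub> y \<in> carrier T"
    and h_mult: "\<lbrakk>x \<in> carrier T; y \<in> carrier T\<rbrakk> \<Longrightarrow> h (x \<otimes>\<^bsub>T\<^esub> y) = h x \<otimes>\<^bsub>P\<^esub> h y"
    and T_smult_closed: "x \<in> carrier T \<Longrightarrow> c \<odot>\<^bsub>T\<^esub> x \<in> carrier T"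
    and h_smult: "x \<in> carrier T \<Longrightarrow> h (c \<odot>\<^bsub>T\<^esub> x) = P_smult c (h x)"
    and T_star_closed: "x \<in> carrier T \<Longrightarrow> star T x \<in> carrier T"
    and h_star: "x \<in> carrier T \<Longrightarrow> h (star T x) = P_star (h x)"
    and h_inj: "inj_on h (carrier T)"
    and h_image: "h ` carrier T = graded_polys"
    and gr_eq: "gr n = {x \<in> carrier T. \<forall>m. m \<noteq> n \<longrightarrow> h x m = \<zero>\<^bsub>C\<^esub>}"
begin

lemma h_graded: "x \<in> carrier T \<Longrightarrow> h x \<in> graded_polys"
  using h_image by blast

lemma h_closed [simp]: "x \<in> carrier T \<Longrightarrow> h x \<in> carrier P"
  using h_graded by (rule graded_polys_carrier)

lemma h_apply_closed [simp]: "x \<in> carrier T \<Longrightarrow> h x n \<in> carrier C"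
  using h_closed by (rule P_closed)

lemma h_eqI: "\<lbrakk>h x = h y; x \<in> carrier T; y \<in> carrier T\<rbrakk> \<Longrightarrow> x = y"
  using h_inj by (rule inj_onD)

lemmas T_closed = T_zero(1) T_one(1) T_add_closed T_mult_closed T_smult_closed T_star_closed
lemmas h_simps = T_zero(2) T_one(2) h_add h_mult h_smult h_star

lemma ring_T: "ring T"
proof (rule ringI)
  show "abelian_group T"
  proof (rule abelian_groupI)
    fix x assume x: "x \<in> carrier T"
    \<comment> \<open>Negatives in \<open>T\<close> are not given but pulled back: the image of
      \<open>h\<close> is closed under negation.\<close>
    have "\<ominus>\<^bsub>P\<^esub> h x \<in> h ` carrier T"
      using h_graded[OF x] by (simp add: h_image graded_polys_a_inv)
    then obtain y where y: "y \<in> carrier T" "h y = \<ominus>\<^bsub>P\<^esub> h x"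
      by auto
    then have "y \<oplus>\<^bsub>T\<^esub> x = \<zero>\<^bsub>T\<^esub>"
      using x by (intro h_eqI) (auto simp: T_closed h_simps P.l_neg)
    with y show "\<exists>y\<in>carrier T. y \<oplus>\<^bsub>T\<^esub> x = \<zero>\<^bsub>T\<^esub>"
      by blast
  qed (auto intro!: h_eqI simp: T_closed h_simps P.a_ac)
  show "monoid T"
    by (rule monoidI) (auto intro!: h_eqI simp: T_closed h_simps P.m_assoc)
qed (auto intro!: h_eqI simp: T_closed h_simps P.l_distr P.r_distr)

lemma complex_algebra_T: "complex_algebra T"
proof (rule complex_algebraI[OF ring_T])
  fix c d x y
  assume x: "x \<in> carrier T"
  show "c \<odot>\<^bsub>T\<^esub> x \<in> carrier T"
    using x by (rule T_smult_closed)
  show "(c + d) \<odot>\<^bsub>T\<^esub> x = c \<odot>\<^bsub>T\<^esub> x \<oplus>\<^bsub>T\<^esub> d \<odot>\<^bsub>T\<^esub> x"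
    using x by (intro h_eqI ext)
      (auto simp: T_closed h_simps P_add_apply P_smult_closed, auto simp: P_smult_def C.smult_add_scalar)
  show "(c * d) \<odot>\<^bsub>T\<^esub> x = c \<odot>\<^bsub>T\<^esub> (d \<odot>\<^bsub>T\<^esub> x)"
    using x by (intro h_eqI ext) (auto simp: T_closed h_simps P_smult_def C.smult_mult)
  show "1 \<odot>\<^bsub>T\<^esub> x = x"
    using x by (intro h_eqI ext) (auto simp: T_closed h_simps P_smult_def C.smult_one)
  assume y: "y \<in> carrier T"
  show "c \<odot>\<^bsub>T\<^esub> (x \<oplus>\<^bsub>T\<^esub> y) = c \<odot>\<^bsub>T\<^esub> x \<oplus>\<^bsub>T\<^esub> c \<odot>\<^bsub>T\<^esub> y"
    using x y by (intro h_eqI) (auto simp: T_closed h_simps P_smult_add)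
  show "c \<odot>\<^bsub>T\<^esub> x \<otimes>\<^bsub>T\<^esub> y = c \<odot>\<^bsub>T\<^esub> (x \<otimes>\<^bsub>T\<^esub> y)"
    using x y by (intro h_eqI) (auto simp: T_closed h_simps P_smult_mult_left)
  show "x \<otimes>\<^bsub>T\<^esub> (c \<odot>\<^bsub>T\<^esub> y) = c \<odot>\<^bsub>T\<^esub> (x \<otimes>\<^bsub>T\<^esub> y)"
    using x y by (intro h_eqI) (auto simp: T_closed h_simps P_smult_mult_right)
qed

sublocale T: complex_algebra T
  by (rule complex_algebra_T)

lemma star_algebra_T: "star_algebra T"
proof (intro star_algebra.intro star_algebra_axioms.intro)
  show "complex_algebra T" ..
  show "star T (c \<odot>\<^bsub>T\<^esub> x) = cnj c \<odot>\<^bsub>T\<^esub> star T x" if "x \<in> carrier T" for c x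
    using that by (intro h_eqI ext)
      (auto simp: T_closed h_simps P_smult_def P_star_def cst_smult)
  show "star T (star T x) = x" if "x \<in> carrier T" for x
    using that by (intro h_eqI ext) (auto simp: T_closed h_simps P_star_def cst_cst)
qed (auto intro!: h_eqI simp: T_closed h_simps P_star_add P_star_mult)

lemma h_add_hom: "h \<in> add_hom T P"
  by (rule add_homI) (simp_all add: h_add)

lemma h_a_inv: "x \<in> carrier T \<Longrightarrow> h (\<ominus>\<^bsub>T\<^esub> x) = \<ominus>\<^bsub>P\<^esub> h x"
  by (rule add_hom_a_inv[OF T.abelian_group_axioms P.abelian_group_axioms h_add_hom])

lemma h_eq_zero_iff: "x \<in> carrier T \<Longrightarrow> h x = \<zero>\<^bsub>P\<^esub> \<longleftrightarrow> x = \<zero>\<^bsub>T\<^esub>"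
  using h_eqI[of x "\<zero>\<^bsub>T\<^esub>"] T_zero by auto

lemma gr_carrier: "x \<in> gr n \<Longrightarrow> x \<in> carrier T"
  by (simp add: gr_eq)

lemma h_gr: "x \<in> gr n \<Longrightarrow> h x = single n (h x n)"
  by (rule ext) (simp add: gr_eq single_def)

text \<open>The component of \<open>x\<close> in degree \<open>n\<close> can only be the preimage of
  the monomial that carries the coefficient \<open>h x n\<close>. Injectivity of \<open>h\<close>
  then gives uniqueness of the decomposition, and \<open>h_image\<close> its existence.\<close>

lemma h_decomposition_iff:
  assumes x: "x \<in> carrier T"
  shows "homogeneous_decomposition T gr x f \<longleftrightarrow> (\<forall>n. f n \<in> carrier T \<and> h (f n) = single n (h x n))"
    (is "_ \<longleftrightarrow> ?single")
proof -
  \<comment> \<open>The decomposition sums over the support of \<open>f\<close> in \<open>T\<close>;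
    this matches it with the support of the polynomial, from which finiteness comes.\<close>
  have fin_iff: "f n = \<zero>\<^bsub>T\<^esub> \<longleftrightarrow> h (f n) n = \<zero>\<^bsub>C\<^esub>" if "f n \<in> gr n" for n
  proof
    assume "h (f n) n = \<zero>\<^bsub>C\<^esub>"
    then have "h (f n) = \<zero>\<^bsub>P\<^esub>"
      using h_gr[OF that] by (intro ext) (simp add: single_def fun_eq_iff split: if_splits)
    then show "f n = \<zero>\<^bsub>T\<^esub>"
      using gr_carrier[OF that] by (simp add: h_eq_zero_iff)
  qed (simp add: T_zero)
  \<comment> \<open>In degree \<open>n\<close> only the summand \<open>f n\<close> can contribute,
    and if \<open>n\<close> is not an index then \<open>f n\<close> is zero, so the value is the
    same.\<close>
  have sum: "h (\<Oplus>\<^bsub>T\<^esub>i\<in>{i. f i \<noteq> \<zero>\<^bsub>T\<^esub>}. f i) n = h (f n) n"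
    if f: "\<And>i. f i \<in> gr i" and fin: "finite {i. f i \<noteq> \<zero>\<^bsub>T\<^esub>}" for n
  proof -
    let ?I = "{i. f i \<noteq> \<zero>\<^bsub>T\<^esub>}"
    have closed: "f i \<in> carrier T" for i
      using f by (rule gr_carrier)
    have "h (\<Oplus>\<^bsub>T\<^esub>i\<in>?I. f i) n = (\<Oplus>\<^bsub>C\<^esub>i\<in>?I. h (f i) n)"
      using closed by (subst add_hom_finsum[OF T.abelian_group_axioms P.abelian_group_axioms h_add_hom])
        (auto simp: P_finsum_apply)
    also have "\<dots> = (\<Oplus>\<^bsub>C\<^esub>i\<in>?I. if n = i then h (f i) i else \<zero>\<^bsub>C\<^esub>)"
      using closed f by (intro C.finsum_cong') (auto simp: gr_eq)
    also have "\<dots> = h (f n) n"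
    proof (cases "n \<in> ?I")
      case True
      then show ?thesis
        using fin closed by (subst C.add.finprod_singleton) auto
    next
      case False
      then have "(\<Oplus>\<^bsub>C\<^esub>i\<in>?I. if n = i then h (f i) i else \<zero>\<^bsub>C\<^esub>) = (\<Oplus>\<^bsub>C\<^esub>i\<in>?I. \<zero>\<^bsub>C\<^esub>)"
        by (intro C.finsum_cong') auto
      with False show ?thesis
        by (simp add: T_zero)
    qed
    finally show ?thesis .
  qed
  show ?thesis
  proof
    assume "homogeneous_decomposition T gr x f"
    then have f: "\<And>i. f i \<in> gr i" and fin: "finite {i. f i \<noteq> \<zero>\<^bsub>T\<^esub>}"
      and x_eq: "x = (\<Oplus>\<^bsub>T\<^esub>i\<in>{i. f i \<noteq> \<zero>\<^bsub>T\<^esub>}. f i)"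
      by (auto simp: homogeneous_decomposition_def)
    show ?single
      using sum[OF f fin] h_gr[OF f] gr_carrier[OF f] x_eq by metis
  next
    assume single: ?single
    then have f: "f i \<in> gr i" for i
      by (auto simp: gr_eq single_def)
    have eq: "h (f n) n = h x n" for n
      using single by (simp add: single_def)
    have "{i. f i \<noteq> \<zero>\<^bsub>T\<^esub>} = {n. h x n \<noteq> \<zero>\<^bsub>C\<^esub>}"
      using fin_iff[OF f] eq by auto
    then have fin: "finite {i. f i \<noteq> \<zero>\<^bsub>T\<^esub>}"
      using x by (simp add: P_finite)
    have "x = (\<Oplus>\<^bsub>T\<^esub>i\<in>{i. f i \<noteq> \<zero>\<^bsub>T\<^esub>}. f i)"
      using x single sum[OF f fin] eq by (intro h_eqI ext T.finsum_closed) auto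
    with f fin show "homogeneous_decomposition T gr x f"
      unfolding homogeneous_decomposition_def by blast
  qed
qed

lemma graded_algebra_T: "graded_algebra T gr"
proof (intro graded_algebra.intro graded_algebra_axioms.intro)
  show "complex_algebra T" ..
  show "submodule (gr i) complex_ring T" for i
  proof (rule module.submoduleI[OF T.vector_space])
    show "\<ominus>\<^bsub>T\<^esub> x \<in> gr i" if "x \<in> gr i" for x
      using that by (auto simp: gr_eq h_a_inv P_a_inv_apply)
  qed (auto simp: gr_eq T_closed h_simps P_add_apply P_smult_def)
  show "\<one>\<^bsub>T\<^esub> \<in> gr 0"
    by (simp add: gr_eq T_one P_one_apply)
  show "x \<otimes>\<^bsub>T\<^esub> y \<in> gr (i + j)" if x: "x \<in> gr i" and y: "y \<in> gr j" for x y i j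
  proof -
    \<comment> \<open>A term of the convolution survives only if both its indices are
      \<open>i\<close> and \<open>j\<close>, hence only in degree \<open>i + j\<close>.\<close>
    have "h x k \<otimes>\<^bsub>C\<^esub> h y (m - k) = \<zero>\<^bsub>C\<^esub>" if "m \<noteq> i + j" "k \<le> m" for m k
    proof (cases "k = i")
      case True
      then have "m - k \<noteq> j" using that by auto
      then show ?thesis using x y by (simp add: gr_eq)
    qed (use x y in \<open>simp add: gr_eq\<close>)
    then have "(\<Oplus>\<^bsub>C\<^esub>k\<in>{..m}. h x k \<otimes>\<^bsub>C\<^esub> h y (m - k)) = (\<Oplus>\<^bsub>C\<^esub>k\<in>{..m}. \<zero>\<^bsub>C\<^esub>)" if "m \<noteq> i + j" for m
      using that by (intro C.finsum_cong') auto
    then show ?thesis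
      using x y by (simp add: gr_eq T_closed h_mult P_mult_apply)
  qed
  show "\<exists>!f. homogeneous_decomposition T gr x f" if x: "x \<in> carrier T" for x
  proof -
    have "\<exists>y. y \<in> carrier T \<and> h y = single n (h x n)" for n
      using graded_polys_single[OF h_graded[OF x], of n] h_image by (metis imageE)
    then obtain f where "\<And>n. f n \<in> carrier T \<and> h (f n) = single n (h x n)"
      by metis
    then show ?thesis
      unfolding h_decomposition_iff[OF x] by (intro ex1I[of _ f] ext h_eqI) auto
  qed
qed

end

text \<open>Both maps have the image \<open>graded_polys\<close>, so \<open>h\<close> can be
  followed by the inverse of \<open>h'\<close>. Every compatibility is compared after applying the
  injective \<open>h'\<close>.\<close>

lemma graded_models_iso:
  assumes "graded_model A L st G T gr h" "graded_model A L st G T' gr' h'"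
  shows "\<exists>g. graded_star_algebra_iso T gr T' gr' g"
proof -
  interpret T: graded_model A L st G T gr h by fact
  interpret T': graded_model A L st G T' gr' h' by fact
  define g where "g x = inv_into (carrier T') h' (h x)" for x
  have g: "g x \<in> carrier T'" "h' (g x) = h x" if "x \<in> carrier T" for x
    using T.h_graded[OF that] unfolding T'.h_image[symmetric] g_def
    by (auto intro: inv_into_into f_inv_into_f)
  have surj: "\<exists>x\<in>carrier T. g x = y" if y: "y \<in> carrier T'" for y
  proof -
    obtain x where "x \<in> carrier T" "h x = h' y"
      using T'.h_graded[OF y] unfolding T.h_image[symmetric] by auto
    with y g show ?thesis
      by (metis T'.h_eqI)
  qed
  have "g \<in> ring_hom T T'"
    by (rule ring_hom_memI) (auto intro!: T'.h_eqI simp: g T.T_closed T'.T_closed T.h_simps T'.h_simps)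
  moreover have "bij_betw g (carrier T) (carrier T')"
    unfolding bij_betw_def
  proof
    show "inj_on g (carrier T)"
      using g by (intro inj_onI) (metis T.h_eqI)
    show "g ` carrier T = carrier T'"
      using g surj by blast
  qed
  moreover have "g ` gr n = gr' n" for n
  proof
    show "g ` gr n \<subseteq> gr' n"
      using g by (auto simp: T.gr_eq T'.gr_eq)
    show "gr' n \<subseteq> g ` gr n"
    proof
      fix y assume y: "y \<in> gr' n"
      then obtain x where "x \<in> carrier T" "g x = y"
        using surj T'.gr_carrier by blast
      with y g[of x] show "y \<in> g ` gr n"
        by (auto simp: T.gr_eq T'.gr_eq)
    qed
  qed
  moreover have "\<forall>c. \<forall>x\<in>carrier T. g (c \<odot>\<^bsub>T\<^esub> x) = c \<odot>\<^bsub>T'\<^esub> g x"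
    by (auto intro!: T'.h_eqI simp: g T.T_closed T'.T_closed T.h_simps T'.h_simps)
  moreover have "\<forall>x\<in>carrier T. g (star T x) = star T' (g x)"
    by (auto intro!: T'.h_eqI simp: g T.T_closed T'.T_closed T.h_simps T'.h_simps)
  ultimately show ?thesis
    unfolding graded_star_algebra_iso_def ring_iso_def by blast
qed


section \<open>The tensor algebra\<close>

context star_line_module
begin

lemma tpow_relators_subset: "tpow_relators A L n \<subseteq> carrier (free_Abelian_group (tpow_gens L n))"
  unfolding tpow_relators_def
  by (intro Un_least subsetI; elim CollectE exE conjE; hypsubst; intro frag_relator_closed)
    (simp_all add: tpow_gens_def L.lact_closed L.ract_closed)

lemma abelian_group_tpow: "abelian_group (tpow A L n)"
  unfolding tpow_def using tpow_relators_subset by (rule abelian_group_presented_group)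

lemma tpow_pure_closed: "xs \<in> tpow_gens L n \<Longrightarrow> tpow_pure A L n xs \<in> carrier (tpow A L n)"
  unfolding tpow_def tpow_pure_def using tpow_relators_subset by (rule generator_class_closed)

lemma tpow_pure_funcset: "tpow_pure A L n \<in> tpow_gens L n \<rightarrow> carrier (tpow A L n)"
  by (simp add: tpow_pure_closed)

lemma tpow_relator: "c \<in> tpow_relators A L n \<Longrightarrow> frag_eval (tpow A L n) (tpow_pure A L n) c = \<zero>\<^bsub>tpow A L n\<^esub>"
  unfolding tpow_def tpow_pure_def[abs_def]
  using presented_group_relator[OF tpow_relators_subset] by simp

lemma tpow_pure_add:
  assumes "us @ [x] @ vs \<in> tpow_gens L n" "y \<in> carrier L"
  shows "tpow_pure A L n (us @ [x \<oplus>\<^bsub>L\<^esub> y] @ vs)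
    = tpow_pure A L n (us @ [x] @ vs) \<oplus>\<^bsub>tpow A L n\<^esub> tpow_pure A L n (us @ [y] @ vs)"
proof -
  interpret T: abelian_group "tpow A L n"
    by (rule abelian_group_tpow)
  have "frag_of (us @ [x \<oplus>\<^bsub>L\<^esub> y] @ vs) - frag_of (us @ [x] @ vs) - frag_of (us @ [y] @ vs)
      \<in> tpow_relators A L n"
    using assms unfolding tpow_relators_def by blast
  from tpow_relator[OF this] show ?thesis
    using assms by (subst (asm) T.frag_eval_relator3[OF tpow_pure_funcset]) (auto simp: tpow_gens_def)
qed

lemma tpow_pure_balanced:
  assumes "us @ [x, y] @ vs \<in> tpow_gens L n" "a \<in> carrier A"
  shows "tpow_pure A L n (us @ [x \<bullet>\<^bsub>L\<^esub> a, y] @ vs) = tpow_pure A L n (us @ [x, a \<odot>\<^bsub>L\<^esub> y] @ vs)"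
proof -
  interpret T: abelian_group "tpow A L n"
    by (rule abelian_group_tpow)
  have "frag_of (us @ [x \<bullet>\<^bsub>L\<^esub> a, y] @ vs) - frag_of (us @ [x, a \<odot>\<^bsub>L\<^esub> y] @ vs) \<in> tpow_relators A L n"
    using assms unfolding tpow_relators_def by blast
  from tpow_relator[OF this] show ?thesis
    using assms by (subst (asm) T.frag_eval_relator2[OF tpow_pure_funcset])
      (auto simp: tpow_gens_def L.lact_closed L.ract_closed)
qed

lemma tpow_extend:
  assumes Q: "abelian_group Q" and f: "f \<in> tpow_gens L n \<rightarrow> carrier Q"
    and add: "\<And>us x y vs. \<lbrakk>us @ [x] @ vs \<in> tpow_gens L n; y \<in> carrier L\<rbrakk> \<Longrightarrow>
      f (us @ [x \<oplus>\<^bsub>L\<^esub> y] @ vs) = f (us @ [x] @ vs) \<oplus>\<^bsub>Q\<^esub> f (us @ [y] @ vs)"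
    and balanced: "\<And>us x a y vs. \<lbrakk>us @ [x, y] @ vs \<in> tpow_gens L n; a \<in> carrier A\<rbrakk> \<Longrightarrow>
      f (us @ [x \<bullet>\<^bsub>L\<^esub> a, y] @ vs) = f (us @ [x, a \<odot>\<^bsub>L\<^esub> y] @ vs)"
  shows "extend_additively Q f \<in> add_hom (tpow A L n) Q"
    and "xs \<in> tpow_gens L n \<Longrightarrow> extend_additively Q f (tpow_pure A L n xs) = f xs"
proof -
  interpret Q: abelian_group Q by fact
  have rel: "frag_eval Q f c = \<zero>\<^bsub>Q\<^esub>" if "c \<in> tpow_relators A L n" for c
    using that unfolding tpow_relators_def
  proof (elim UnE CollectE exE conjE)
    fix us x y vs
    assume c: "c = frag_of (us @ [x \<oplus>\<^bsub>L\<^esub> y] @ vs) - frag_of (us @ [x] @ vs) - frag_of (us @ [y] @ vs)"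
      and *: "us @ [x] @ vs \<in> tpow_gens L n" "y \<in> carrier L"
    show ?thesis
      unfolding c using * add[OF *] by (subst Q.frag_eval_relator3[OF f]) (auto simp: tpow_gens_def)
  next
    fix us x a y vs
    assume c: "c = frag_of (us @ [x \<bullet>\<^bsub>L\<^esub> a, y] @ vs) - frag_of (us @ [x, a \<odot>\<^bsub>L\<^esub> y] @ vs)"
      and *: "us @ [x, y] @ vs \<in> tpow_gens L n" "a \<in> carrier A"
    show ?thesis
      unfolding c using * balanced[OF *]
      by (subst Q.frag_eval_relator2[OF f]) (auto simp: tpow_gens_def L.lact_closed L.ract_closed)
  qed
  show "extend_additively Q f \<in> add_hom (tpow A L n) Q"
    unfolding tpow_def by (rule extend_additively_add_hom[OF tpow_relators_subset Q f rel])
  show "extend_additively Q f (tpow_pure A L n xs) = f xs" if "xs \<in> tpow_gens L n"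
    unfolding tpow_pure_def by (rule extend_additively_generator[OF tpow_relators_subset Q f rel that])
qed

lemma tpow_hom_eqI:
  assumes "abelian_group Q" "g \<in> add_hom (tpow A L n) Q" "h \<in> add_hom (tpow A L n) Q"
    and "\<And>xs. xs \<in> tpow_gens L n \<Longrightarrow> g (tpow_pure A L n xs) = h (tpow_pure A L n xs)"
    and "U \<in> carrier (tpow A L n)"
  shows "g U = h U"
  using add_hom_presented_group_eqI[OF tpow_relators_subset, of Q g n h U] assms
  by (simp add: tpow_def tpow_pure_def)

definition word :: "'l list \<Rightarrow> 'a \<times> 'l"
  where "word xs = foldr (\<lambda>x y. (\<zero>\<^bsub>A\<^esub>, x) \<otimes>\<^bsub>C\<^esub> y) xs \<one>\<^bsub>C\<^esub>"

lemma word_simps [simp]: "word [] = \<one>\<^bsub>C\<^esub>" "word (x # xs) = (\<zero>\<^bsub>A\<^esub>, x) \<otimes>\<^bsub>C\<^esub> word xs"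
  by (simp_all add: word_def)

lemma word_closed: "set xs \<subseteq> carrier L \<Longrightarrow> word xs \<in> carrier C"
  by (induction xs) simp_all

lemma word_append:
  "\<lbrakk>set xs \<subseteq> carrier L; set ys \<subseteq> carrier L\<rbrakk> \<Longrightarrow> word (xs @ ys) = word xs \<otimes>\<^bsub>C\<^esub> word ys"
  by (induction xs) (simp_all add: word_closed C.m_assoc)

lemma word_degree:
  "set xs \<subseteq> carrier L \<Longrightarrow> word xs \<in> even_odd_degree A L (of_nat (length xs))"
proof (induction xs)
  case Nil
  then show ?case by (simp add: even_odd_degree_def C_simps)
next
  case (Cons x xs)
  then have "(\<zero>\<^bsub>A\<^esub>, x) \<in> even_odd_degree A L 1"
    by (simp add: even_odd_degree_def)
  with Cons show ?case
    using even_odd_degree_mult by fastforce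
qed

lemma word_star: "set xs \<subseteq> carrier L \<Longrightarrow> word (rev (map st xs)) = cst (word xs)"
proof (induction xs)
  case Nil
  then show ?case using add_hom_zero[of L L st] by (simp add: cst_def C_simps A.star_one add_homI st_add)
next
  case (Cons x xs)
  have "set (rev (map st xs)) \<subseteq> carrier L"
    using Cons.prems by auto
  moreover have "cst (\<zero>\<^bsub>A\<^esub>, x) = (\<zero>\<^bsub>A\<^esub>, st x)"
    using add_hom_zero[OF _ _ A.star_add_hom] by (simp add: cst_def)
  ultimately show ?case
    using Cons by (simp add: word_append cst_mult word_closed)
qed

text \<open>For positive \<open>n\<close> this turns out to be injective with image the part of
  \<open>C\<close> of the parity of \<open>n\<close>, so that all operations on tensor powers can be
  computed in \<open>C\<close>.\<close>

definition \<mu> :: "nat \<Rightarrow> ('l list \<Rightarrow>\<^sub>0 int) set \<Rightarrow> 'a \<times> 'l"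
  where "\<mu> n = extend_additively C word"

lemma \<mu>_add_hom: "\<mu> n \<in> add_hom (tpow A L n) C"
  and \<mu>_pure: "xs \<in> tpow_gens L n \<Longrightarrow> \<mu> n (tpow_pure A L n xs) = word xs"
proof -
  have f: "word \<in> tpow_gens L n \<rightarrow> carrier C"
    by (auto simp: tpow_gens_def word_closed)
  have add: "word (us @ [x \<oplus>\<^bsub>L\<^esub> y] @ vs) = word (us @ [x] @ vs) \<oplus>\<^bsub>C\<^esub> word (us @ [y] @ vs)"
    if "us @ [x] @ vs \<in> tpow_gens L n" "y \<in> carrier L" for us x y vs
  proof -
    have "(\<zero>\<^bsub>A\<^esub>, x \<oplus>\<^bsub>L\<^esub> y) = (\<zero>\<^bsub>A\<^esub>, x) \<oplus>\<^bsub>C\<^esub> (\<zero>\<^bsub>A\<^esub>, y)"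
      using that by (simp add: C_simps)
    with that show ?thesis
      by (simp add: tpow_gens_def word_append word_closed C.l_distr C.r_distr)
  qed
  have balanced: "word (us @ [x \<bullet>\<^bsub>L\<^esub> a, y] @ vs) = word (us @ [x, a \<odot>\<^bsub>L\<^esub> y] @ vs)"
    if "us @ [x, y] @ vs \<in> tpow_gens L n" "a \<in> carrier A" for us x y a vs
  proof -
    have "(\<zero>\<^bsub>A\<^esub>, x \<bullet>\<^bsub>L\<^esub> a) \<otimes>\<^bsub>C\<^esub> (\<zero>\<^bsub>A\<^esub>, y) = (\<zero>\<^bsub>A\<^esub>, x) \<otimes>\<^bsub>C\<^esub> (\<zero>\<^bsub>A\<^esub>, a \<odot>\<^bsub>L\<^esub> y)"
      using that by (simp add: C_simps tpow_gens_def pr_balanced L.lact_closed L.ract_closed)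
    with that show ?thesis
      by (simp add: tpow_gens_def word_append word_closed L.lact_closed L.ract_closed flip: C.m_assoc)
  qed
  show "\<mu> n \<in> add_hom (tpow A L n) C"
    unfolding \<mu>_def by (rule tpow_extend(1)[OF C.abelian_group_axioms f add balanced])
  show "\<mu> n (tpow_pure A L n xs) = word xs" if "xs \<in> tpow_gens L n"
    unfolding \<mu>_def by (rule tpow_extend(2)[OF C.abelian_group_axioms f add balanced that])
qed

text \<open>Tensoring with a letter on the right. It is needed to prove that \<open>\<mu>\<close> is
  injective, so its relators cannot yet be detected through \<open>\<mu>\<close> and are checked
  directly.\<close>

definition \<rho> :: "nat \<Rightarrow> 'l \<Rightarrow> ('l list \<Rightarrow>\<^sub>0 int) set \<Rightarrow> ('l list \<Rightarrow>\<^sub>0 int) set"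
  where "\<rho> n u = extend_additively (tpow A L (Suc n)) (\<lambda>xs. tpow_pure A L (Suc n) (xs @ [u]))"

lemma \<rho>_add_hom: "u \<in> carrier L \<Longrightarrow> \<rho> n u \<in> add_hom (tpow A L n) (tpow A L (Suc n))"
  and \<rho>_pure: "\<lbrakk>u \<in> carrier L; xs \<in> tpow_gens L n\<rbrakk> \<Longrightarrow>
    \<rho> n u (tpow_pure A L n xs) = tpow_pure A L (Suc n) (xs @ [u])"
proof -
  assume u: "u \<in> carrier L"
  let ?f = "\<lambda>xs. tpow_pure A L (Suc n) (xs @ [u])"
  have f: "?f \<in> tpow_gens L n \<rightarrow> carrier (tpow A L (Suc n))"
    using u by (auto simp: tpow_gens_def intro!: tpow_pure_closed)
  have add: "?f (us @ [x \<oplus>\<^bsub>L\<^esub> y] @ vs) = ?f (us @ [x] @ vs) \<oplus>\<^bsub>tpow A L (Suc n)\<^esub> ?f (us @ [y] @ vs)"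
    if "us @ [x] @ vs \<in> tpow_gens L n" "y \<in> carrier L" for us x y vs
    using tpow_pure_add[of us x "vs @ [u]" "Suc n" y] that u by (simp add: tpow_gens_def)
  have balanced: "?f (us @ [x \<bullet>\<^bsub>L\<^esub> a, y] @ vs) = ?f (us @ [x, a \<odot>\<^bsub>L\<^esub> y] @ vs)"
    if "us @ [x, y] @ vs \<in> tpow_gens L n" "a \<in> carrier A" for us x y a vs
    using tpow_pure_balanced[of us x y "vs @ [u]" "Suc n" a] that u by (simp add: tpow_gens_def)
  show "\<rho> n u \<in> add_hom (tpow A L n) (tpow A L (Suc n))"
    unfolding \<rho>_def by (rule tpow_extend(1)[OF abelian_group_tpow f add balanced])
  show "\<rho> n u (tpow_pure A L n xs) = ?f xs" if "xs \<in> tpow_gens L n"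
    unfolding \<rho>_def by (rule tpow_extend(2)[OF abelian_group_tpow f add balanced that])
qed

lemma C_mult_right_add_hom: "y \<in> carrier C \<Longrightarrow> (\<lambda>x. x \<otimes>\<^bsub>C\<^esub> y) \<in> add_hom C C"
  by (rule add_homI) (simp_all add: C.l_distr)

lemma C_mult_left_add_hom: "x \<in> carrier C \<Longrightarrow> (\<lambda>y. x \<otimes>\<^bsub>C\<^esub> y) \<in> add_hom C C"
  by (rule add_homI) (simp_all add: C.r_distr)

lemma \<mu>_\<rho>:
  assumes u: "u \<in> carrier L" and U: "U \<in> carrier (tpow A L n)"
  shows "\<mu> (Suc n) (\<rho> n u U) = \<mu> n U \<otimes>\<^bsub>C\<^esub> (\<zero>\<^bsub>A\<^esub>, u)"
proof (rule tpow_hom_eqI[OF C.abelian_group_axioms _ _ _ U])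
  show "(\<lambda>U. \<mu> (Suc n) (\<rho> n u U)) \<in> add_hom (tpow A L n) C"
    using \<rho>_add_hom[OF u] \<mu>_add_hom by (rule add_hom_compose)
  show "(\<lambda>U. \<mu> n U \<otimes>\<^bsub>C\<^esub> (\<zero>\<^bsub>A\<^esub>, u)) \<in> add_hom (tpow A L n) C"
    using \<mu>_add_hom C_mult_right_add_hom by (rule add_hom_compose) (simp add: u)
  show "\<mu> (Suc n) (\<rho> n u (tpow_pure A L n xs)) = \<mu> n (tpow_pure A L n xs) \<otimes>\<^bsub>C\<^esub> (\<zero>\<^bsub>A\<^esub>, u)"
    if "xs \<in> tpow_gens L n" for xs
  proof -
    have "xs @ [u] \<in> tpow_gens L (Suc n)"
      using that u by (simp add: tpow_gens_def)
    with that u show ?thesis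
      by (simp add: \<rho>_pure \<mu>_pure) (simp add: tpow_gens_def word_append)
  qed
qed

text \<open>
  The inverse of \<open>\<mu>\<close> is built by splitting off one letter at a time with \<open>c = \<Sum>\<^sub>i (c w\<^sub>i) u\<^sub>i\<close>.
\<close>

lemma tpow_section:
  "\<exists>\<nu>\<in>add_hom C (tpow A L (Suc n)).
    (\<forall>xs\<in>tpow_gens L (Suc n). \<nu> (word xs) = tpow_pure A L (Suc n) xs) \<and>
    (\<forall>c\<in>even_odd_degree A L (of_nat (Suc n)). \<mu> (Suc n) (\<nu> c) = c)"
proof (induction n)
  case 0
  \<comment> \<open>One letter is its own word: the odd component is taken as the letter.\<close>
  let ?\<nu> = "\<lambda>c. tpow_pure A L (Suc 0) [snd c]"
  have "?\<nu> \<in> add_hom C (tpow A L (Suc 0))"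
  proof (rule add_homI)
    fix x y assume "x \<in> carrier C" "y \<in> carrier C"
    then show "?\<nu> (x \<oplus>\<^bsub>C\<^esub> y) = ?\<nu> x \<oplus>\<^bsub>tpow A L (Suc 0)\<^esub> ?\<nu> y"
      using tpow_pure_add[of "[]" "snd x" "[]" "Suc 0" "snd y"]
      by (auto simp: C_simps C_carrier tpow_gens_def)
  qed (auto simp: C_carrier tpow_gens_def intro!: tpow_pure_closed)
  moreover have "?\<nu> (word xs) = tpow_pure A L (Suc 0) xs" if "xs \<in> tpow_gens L (Suc 0)" for xs
    using that by (auto simp: tpow_gens_def length_Suc_conv)
  moreover have "\<mu> (Suc 0) (?\<nu> c) = c" if "c \<in> even_odd_degree A L (of_nat (Suc 0))" for c
    using that by (subst \<mu>_pure) (auto simp: tpow_gens_def even_odd_degree_def)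
  ultimately show ?case
    by (intro bexI[of _ ?\<nu>]) auto
next
  case (Suc n)
  then obtain \<nu> where \<nu>: "\<nu> \<in> add_hom C (tpow A L (Suc n))"
    and \<nu>_word: "\<And>xs. xs \<in> tpow_gens L (Suc n) \<Longrightarrow> \<nu> (word xs) = tpow_pure A L (Suc n) xs"
    and \<mu>_\<nu>: "\<And>c. c \<in> even_odd_degree A L (of_nat (Suc n)) \<Longrightarrow> \<mu> (Suc n) (\<nu> c) = c"
    by blast
  obtain m w u where w [simp]: "\<And>i. i < m \<Longrightarrow> w i \<in> carrier L" and u [simp]: "\<And>i. i < m \<Longrightarrow> u i \<in> carrier L"
    and unit: "\<And>x. x \<in> carrier C \<Longrightarrow>
      (\<Oplus>\<^bsub>C\<^esub>i\<in>{..<m::nat}. x \<otimes>\<^bsub>C\<^esub> (\<zero>\<^bsub>A\<^esub>, w i) \<otimes>\<^bsub>C\<^esub> (\<zero>\<^bsub>A\<^esub>, u i)) = x"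
    by (rule C_partition_of_unity) blast
  let ?T = "tpow A L (Suc (Suc n))"
  interpret T: abelian_group ?T
    by (rule abelian_group_tpow)
  let ?\<nu> = "\<lambda>c. \<Oplus>\<^bsub>?T\<^esub>i\<in>{..<m}. \<rho> (Suc n) (u i) (\<nu> (c \<otimes>\<^bsub>C\<^esub> (\<zero>\<^bsub>A\<^esub>, w i)))"
  have hom: "(\<lambda>c. \<rho> (Suc n) (u i) (\<nu> (c \<otimes>\<^bsub>C\<^esub> (\<zero>\<^bsub>A\<^esub>, w i)))) \<in> add_hom C ?T" if "i < m" for i
    using that
    by (intro add_hom_compose[OF add_hom_compose[OF C_mult_right_add_hom \<nu>] \<rho>_add_hom]) simp_all
  then have "?\<nu> \<in> add_hom C ?T"
    by (intro add_hom_finsum_pointwise[OF C.abelian_group_axioms abelian_group_tpow]) simp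
  moreover have "?\<nu> (word xs) = tpow_pure A L (Suc (Suc n)) xs" if "xs \<in> tpow_gens L (Suc (Suc n))" for xs
  proof -
    \<comment> \<open>Two letters at the end are singled out, since the scalar
      \<open>pr x (w i)\<close> has to cross a tensor sign. This is why the induction starts at
      length 1.\<close>
    note xs_gens = that
    obtain ys y x where xs: "xs = ys @ [y, x]" and y [simp]: "y \<in> carrier L" and x [simp]: "x \<in> carrier L"
      and ys: "set ys \<subseteq> carrier L" "length ys = n"
    proof -
      have len: "length xs = Suc (Suc n)" "set xs \<subseteq> carrier L"
        using xs_gens by (simp_all add: tpow_gens_def)
      then obtain zs x where zs: "xs = zs @ [x]"
        by (cases xs rule: rev_cases) auto
      with len obtain ys y where "zs = ys @ [y]"
        by (cases zs rule: rev_cases) auto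
      with zs len show ?thesis
        by (intro that[of ys y x]) auto
    qed
    let ?g = "\<lambda>z. tpow_pure A L (Suc (Suc n)) (ys @ [y] @ [z])"
    have g: "?g \<in> add_hom L ?T"
    proof (rule add_homI)
      fix v v' assume "v \<in> carrier L" "v' \<in> carrier L"
      then show "?g (v \<oplus>\<^bsub>L\<^esub> v') = ?g v \<oplus>\<^bsub>?T\<^esub> ?g v'"
        using tpow_pure_add[of "ys @ [y]" v "[]" "Suc (Suc n)" v'] ys by (simp add: tpow_gens_def)
    qed (use ys in \<open>auto simp: tpow_gens_def intro!: tpow_pure_closed\<close>)
    \<comment> \<open>Appending \<open>w i\<close> merges the last two letters with it into the
      single letter \<open>y \<bullet> pr x (w i)\<close>, so \<open>\<nu>\<close> is known on the
      result. After \<open>u i\<close> is appended, the scalar crosses to \<open>u i\<close>, and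
      summing reassembles \<open>x\<close>.\<close>
    have "\<rho> (Suc n) (u i) (\<nu> (word xs \<otimes>\<^bsub>C\<^esub> (\<zero>\<^bsub>A\<^esub>, w i))) = ?g (pr x (w i) \<odot>\<^bsub>L\<^esub> u i)" if i: "i < m" for i
    proof -
      have "word xs \<otimes>\<^bsub>C\<^esub> (\<zero>\<^bsub>A\<^esub>, w i) = word ys \<otimes>\<^bsub>C\<^esub> ((\<zero>\<^bsub>A\<^esub>, y) \<otimes>\<^bsub>C\<^esub> ((\<zero>\<^bsub>A\<^esub>, x) \<otimes>\<^bsub>C\<^esub> (\<zero>\<^bsub>A\<^esub>, w i)))"
        using ys i by (simp add: xs word_append word_closed C.m_assoc)
      also have "(\<zero>\<^bsub>A\<^esub>, y) \<otimes>\<^bsub>C\<^esub> ((\<zero>\<^bsub>A\<^esub>, x) \<otimes>\<^bsub>C\<^esub> (\<zero>\<^bsub>A\<^esub>, w i)) = (\<zero>\<^bsub>A\<^esub>, y \<bullet>\<^bsub>L\<^esub> pr x (w i))"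
        using i by (simp add: C_simps L.ract_closed)
      also have "word ys \<otimes>\<^bsub>C\<^esub> \<dots> = word (ys @ [y \<bullet>\<^bsub>L\<^esub> pr x (w i)])"
        using i ys by (simp add: word_append L.ract_closed)
      also have "\<nu> \<dots> = tpow_pure A L (Suc n) (ys @ [y \<bullet>\<^bsub>L\<^esub> pr x (w i)])"
        using i ys by (intro \<nu>_word) (simp add: tpow_gens_def L.ract_closed)
      also have "\<rho> (Suc n) (u i) \<dots> = tpow_pure A L (Suc (Suc n)) (ys @ [y \<bullet>\<^bsub>L\<^esub> pr x (w i), u i] @ [])"
        using i ys by (subst \<rho>_pure) (simp_all add: tpow_gens_def L.ract_closed)
      also have "\<dots> = ?g (pr x (w i) \<odot>\<^bsub>L\<^esub> u i)"
        using i ys by (subst tpow_pure_balanced) (simp_all add: tpow_gens_def)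
      finally show ?thesis .
    qed
    then have "?\<nu> (word xs) = (\<Oplus>\<^bsub>?T\<^esub>i\<in>{..<m}. ?g (pr x (w i) \<odot>\<^bsub>L\<^esub> u i))"
      using add_hom_closed[OF g] by (intro T.finsum_cong') (auto simp: L.lact_closed)
    also have "\<dots> = ?g (\<Oplus>\<^bsub>L\<^esub>i\<in>{..<m}. pr x (w i) \<odot>\<^bsub>L\<^esub> u i)"
      by (rule add_hom_finsum[OF _ abelian_group_tpow g, symmetric]) (auto simp: L.lact_closed)
    \<comment> \<open>The expansion of \<open>x\<close> in \<open>L\<close> is the odd component of
      the partition of unity in \<open>C\<close>.\<close>
    also have "(\<Oplus>\<^bsub>L\<^esub>i\<in>{..<m}. pr x (w i) \<odot>\<^bsub>L\<^esub> u i)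
        = (\<Oplus>\<^bsub>L\<^esub>i\<in>{..<m}. snd ((\<zero>\<^bsub>A\<^esub>, x) \<otimes>\<^bsub>C\<^esub> (\<zero>\<^bsub>A\<^esub>, w i) \<otimes>\<^bsub>C\<^esub> (\<zero>\<^bsub>A\<^esub>, u i)))"
      by (intro L.M.finsum_cong') (auto simp: C_simps L.lact_closed)
    also have "\<dots> = snd (\<Oplus>\<^bsub>C\<^esub>i\<in>{..<m}. (\<zero>\<^bsub>A\<^esub>, x) \<otimes>\<^bsub>C\<^esub> (\<zero>\<^bsub>A\<^esub>, w i) \<otimes>\<^bsub>C\<^esub> (\<zero>\<^bsub>A\<^esub>, u i))"
      by (rule add_hom_finsum[OF C.abelian_group_axioms _ snd_add_hom, symmetric]) auto
    also have "\<dots> = x"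
      by (simp add: unit)
    finally show ?thesis
      by (simp add: xs)
  qed
  moreover have "\<mu> (Suc (Suc n)) (?\<nu> c) = c" if c: "c \<in> even_odd_degree A L (of_nat (Suc (Suc n)))" for c
  proof -
    have c' [simp]: "c \<in> carrier C"
      using c even_odd_degree_subset by blast
    \<comment> \<open>In \<open>bit\<close>, adding 1 is the same as subtracting 1: multiplication
      by an odd element brings the parity back to that of the previous length.\<close>
    have deg: "c \<otimes>\<^bsub>C\<^esub> (\<zero>\<^bsub>A\<^esub>, w i) \<in> even_odd_degree A L (of_nat (Suc n))" if "i < m" for i
      using even_odd_degree_mult[OF c, of "(\<zero>\<^bsub>A\<^esub>, w i)" 1] that by (simp add: even_odd_degree_def)
    have "\<mu> (Suc (Suc n)) (?\<nu> c)
        = (\<Oplus>\<^bsub>C\<^esub>i\<in>{..<m}. \<mu> (Suc (Suc n)) (\<rho> (Suc n) (u i) (\<nu> (c \<otimes>\<^bsub>C\<^esub> (\<zero>\<^bsub>A\<^esub>, w i)))))"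
      by (rule add_hom_finsum[OF abelian_group_tpow C.abelian_group_axioms \<mu>_add_hom])
        (auto intro: add_hom_closed[OF hom])
    also have "\<dots> = (\<Oplus>\<^bsub>C\<^esub>i\<in>{..<m}. c \<otimes>\<^bsub>C\<^esub> (\<zero>\<^bsub>A\<^esub>, w i) \<otimes>\<^bsub>C\<^esub> (\<zero>\<^bsub>A\<^esub>, u i))"
      by (intro C.finsum_cong') (auto simp: \<mu>_\<rho> add_hom_closed[OF \<nu>] \<mu>_\<nu>[OF deg])
    also have "\<dots> = c"
      by (simp add: unit)
    finally show ?thesis .
  qed
  ultimately show ?case
    by (intro bexI[of _ ?\<nu>]) auto
qed

lemma \<mu>_closed: "U \<in> carrier (tpow A L n) \<Longrightarrow> \<mu> n U \<in> carrier C"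
  using \<mu>_add_hom by (rule add_hom_closed)

lemma \<mu>_zero [simp]: "\<mu> n \<zero>\<^bsub>tpow A L n\<^esub> = \<zero>\<^bsub>C\<^esub>"
  by (rule add_hom_zero[OF abelian_group_tpow C.abelian_group_axioms \<mu>_add_hom])

text \<open>\<open>\<nu>\<close> undoes \<open>\<mu>\<close> on pure tensors, and both are
  additive.\<close>

lemma \<mu>_inj: "inj_on (\<mu> (Suc n)) (carrier (tpow A L (Suc n)))"
proof -
  obtain \<nu> where \<nu>: "\<nu> \<in> add_hom C (tpow A L (Suc n))"
    and \<nu>_word: "\<And>xs. xs \<in> tpow_gens L (Suc n) \<Longrightarrow> \<nu> (word xs) = tpow_pure A L (Suc n) xs"
    using tpow_section[of n] by blast
  have hom: "(\<lambda>U. \<nu> (\<mu> (Suc n) U)) \<in> add_hom (tpow A L (Suc n)) (tpow A L (Suc n))"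
    using \<mu>_add_hom \<nu> by (rule add_hom_compose)
  have "\<nu> (\<mu> (Suc n) U) = U" if "U \<in> carrier (tpow A L (Suc n))" for U
    by (rule tpow_hom_eqI[OF abelian_group_tpow hom add_hom_id _ that]) (simp add: \<mu>_pure \<nu>_word)
  then show ?thesis
    by (rule inj_on_inverseI)
qed

lemma \<mu>_degree:
  assumes "U \<in> carrier (tpow A L n)"
  shows "\<mu> n U \<in> even_odd_degree A L (of_nat n)"
proof -
  have "U \<in> carrier (presented_group (tpow_gens L n) (tpow_relators A L n))"
    using assms by (simp add: tpow_def)
  then show ?thesis
  proof (induction U rule: presented_group_induct[OF tpow_relators_subset, consumes 1])
    case 1
    then show ?case
      using \<mu>_zero[of n] by (simp add: tpow_def zero_in_even_odd_degree)
  next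
    case (2 xs)
    then show ?case
      using \<mu>_pure[of xs n] word_degree[of xs] by (simp add: tpow_pure_def tpow_gens_def)
  next
    case (3 V W)
    then have "\<mu> n (V \<ominus>\<^bsub>tpow A L n\<^esub> W) = \<mu> n V \<ominus>\<^bsub>C\<^esub> \<mu> n W"
      by (intro add_hom_minus[OF abelian_group_tpow C.abelian_group_axioms \<mu>_add_hom]) (simp_all add: tpow_def)
    moreover have "\<dots> \<in> even_odd_degree A L (of_nat n)"
      using 3 subgroup.m_inv_closed[OF submodule.axioms(1)[OF even_odd_degree_submodule]]
        subgroup.m_closed[OF submodule.axioms(1)[OF even_odd_degree_submodule]]
      by (simp add: a_minus_def flip: a_inv_def)
    ultimately show ?case
      by (simp add: tpow_def)
  qed
qed

lemma \<mu>_surj: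
  assumes "c \<in> even_odd_degree A L (of_nat (Suc n))"
  obtains U where "U \<in> carrier (tpow A L (Suc n))" "\<mu> (Suc n) U = c"
proof -
  obtain \<nu> where "\<nu> \<in> add_hom C (tpow A L (Suc n))" "\<mu> (Suc n) (\<nu> c) = c"
    using tpow_section[of n] assms by blast
  then show thesis
    using assms even_odd_degree_subset by (intro that[of "\<nu> c"]) (auto intro: add_hom_closed)
qed

lemma \<mu>_eq_zero_iff: "U \<in> carrier (tpow A L (Suc n)) \<Longrightarrow> \<mu> (Suc n) U = \<zero>\<^bsub>C\<^esub> \<longleftrightarrow> U = \<zero>\<^bsub>tpow A L (Suc n)\<^esub>"
  using inj_onD[OF \<mu>_inj, of n U "\<zero>\<^bsub>tpow A L (Suc n)\<^esub>"] abelian_group.axioms(1)[OF abelian_group_tpow, of "Suc n"]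
  by (auto simp: abelian_monoid.zero_closed)

text \<open>An operation on lists that becomes an additive map \<theta> of \<open>C\<close> under
  \<open>word\<close> respects the relators automatically. Left action, right action and star are of
  this form, with \<theta> a left multiplication, a right multiplication and
  \<open>cst\<close>.\<close>

lemma tpow_extend_via_\<mu>:
  assumes \<theta>: "\<theta> \<in> add_hom C C"
    and f: "\<And>xs. xs \<in> tpow_gens L m \<Longrightarrow> f xs \<in> tpow_gens L (Suc n)"
    and word: "\<And>xs. xs \<in> tpow_gens L m \<Longrightarrow> word (f xs) = \<theta> (word xs)"
    and U: "U \<in> carrier (tpow A L m)"
  shows "extend_additively (tpow A L (Suc n)) (\<lambda>xs. tpow_pure A L (Suc n) (f xs)) U \<in> carrier (tpow A L (Suc n))"
    and "\<mu> (Suc n) (extend_additively (tpow A L (Suc n)) (\<lambda>xs. tpow_pure A L (Suc n) (f xs)) U) = \<theta> (\<mu> m U)"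
proof -
  have g: "(\<lambda>U. \<theta> (\<mu> m U)) \<in> add_hom (presented_group (tpow_gens L m) (tpow_relators A L m)) C"
    using add_hom_compose[OF \<mu>_add_hom \<theta>] by (simp add: tpow_def)
  have U': "U \<in> carrier (presented_group (tpow_gens L m) (tpow_relators A L m))"
    using U by (simp add: tpow_def)
  have f': "(\<lambda>xs. tpow_pure A L (Suc n) (f xs)) \<in> tpow_gens L m \<rightarrow> carrier (tpow A L (Suc n))"
    using f by (auto intro: tpow_pure_closed)
  have eq: "\<mu> (Suc n) (tpow_pure A L (Suc n) (f xs))
      = \<theta> (\<mu> m (generator_class (tpow_gens L m) (tpow_relators A L m) xs))" if "xs \<in> tpow_gens L m" for xs
    using \<mu>_pure[OF f[OF that]] \<mu>_pure[OF that] word[OF that] by (simp add: tpow_pure_def)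
  note * = extend_additively_via_embedding[OF tpow_relators_subset abelian_group_tpow
      C.abelian_group_axioms \<mu>_add_hom \<mu>_inj g f' eq]
  show "extend_additively (tpow A L (Suc n)) (\<lambda>xs. tpow_pure A L (Suc n) (f xs)) U \<in> carrier (tpow A L (Suc n))"
    using *(1) U' by (rule add_hom_closed)
  show "\<mu> (Suc n) (extend_additively (tpow A L (Suc n)) (\<lambda>xs. tpow_pure A L (Suc n) (f xs)) U) = \<theta> (\<mu> m U)"
    using *(2)[of U] U' by simp
qed

lemma tpow_lact:
  assumes "a \<in> carrier A" "U \<in> carrier (tpow A L (Suc n))"
  shows "tpow_lact A L (Suc n) a U \<in> carrier (tpow A L (Suc n))"
    and "\<mu> (Suc n) (tpow_lact A L (Suc n) a U) = (a, \<zero>\<^bsub>L\<^esub>) \<otimes>\<^bsub>C\<^esub> \<mu> (Suc n) U"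
proof -
  have hom: "(\<lambda>y. (a, \<zero>\<^bsub>L\<^esub>) \<otimes>\<^bsub>C\<^esub> y) \<in> add_hom C C"
    using assms by (intro C_mult_left_add_hom) simp
  have gens: "(a \<odot>\<^bsub>L\<^esub> hd xs) # tl xs \<in> tpow_gens L (Suc n)" if "xs \<in> tpow_gens L (Suc n)" for xs
    using that assms by (auto simp: tpow_gens_def L.lact_closed length_Suc_conv)
  have word: "word ((a \<odot>\<^bsub>L\<^esub> hd xs) # tl xs) = (a, \<zero>\<^bsub>L\<^esub>) \<otimes>\<^bsub>C\<^esub> word xs" if xs: "xs \<in> tpow_gens L (Suc n)" for xs
  proof -
    obtain y ys where [simp]: "xs = y # ys" "y \<in> carrier L" "set ys \<subseteq> carrier L"
      using xs by (auto simp: tpow_gens_def length_Suc_conv)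
    have "(\<zero>\<^bsub>A\<^esub>, a \<odot>\<^bsub>L\<^esub> y) = (a, \<zero>\<^bsub>L\<^esub>) \<otimes>\<^bsub>C\<^esub> (\<zero>\<^bsub>A\<^esub>, y)"
      using assms by (simp add: C_simps L.lact_closed)
    with assms show ?thesis
      by (simp add: C.m_assoc word_closed)
  qed
  show "tpow_lact A L (Suc n) a U \<in> carrier (tpow A L (Suc n))"
    unfolding tpow_lact_def by (rule tpow_extend_via_\<mu>(1)[OF hom gens word assms(2)])
  show "\<mu> (Suc n) (tpow_lact A L (Suc n) a U) = (a, \<zero>\<^bsub>L\<^esub>) \<otimes>\<^bsub>C\<^esub> \<mu> (Suc n) U"
    unfolding tpow_lact_def by (rule tpow_extend_via_\<mu>(2)[OF hom gens word assms(2)])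
qed

lemma tpow_ract:
  assumes "a \<in> carrier A" "U \<in> carrier (tpow A L (Suc n))"
  shows "tpow_ract A L (Suc n) U a \<in> carrier (tpow A L (Suc n))"
    and "\<mu> (Suc n) (tpow_ract A L (Suc n) U a) = \<mu> (Suc n) U \<otimes>\<^bsub>C\<^esub> (a, \<zero>\<^bsub>L\<^esub>)"
proof -
  have hom: "(\<lambda>y. y \<otimes>\<^bsub>C\<^esub> (a, \<zero>\<^bsub>L\<^esub>)) \<in> add_hom C C"
    using assms by (intro C_mult_right_add_hom) simp
  have snoc: "\<exists>ys y. xs = ys @ [y] \<and> y \<in> carrier L \<and> set ys \<subseteq> carrier L \<and> length ys = n"
    if "xs \<in> tpow_gens L (Suc n)" for xs
    using that by (cases xs rule: rev_cases) (auto simp: tpow_gens_def)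
  have gens: "butlast xs @ [last xs \<bullet>\<^bsub>L\<^esub> a] \<in> tpow_gens L (Suc n)" if "xs \<in> tpow_gens L (Suc n)" for xs
    using snoc[OF that] assms by (auto simp: tpow_gens_def L.ract_closed)
  have word: "word (butlast xs @ [last xs \<bullet>\<^bsub>L\<^esub> a]) = word xs \<otimes>\<^bsub>C\<^esub> (a, \<zero>\<^bsub>L\<^esub>)" if xs: "xs \<in> tpow_gens L (Suc n)" for xs
  proof -
    obtain y ys where [simp]: "xs = ys @ [y]" "y \<in> carrier L" "set ys \<subseteq> carrier L"
      using snoc[OF xs] by blast
    have "(\<zero>\<^bsub>A\<^esub>, y \<bullet>\<^bsub>L\<^esub> a) = (\<zero>\<^bsub>A\<^esub>, y) \<otimes>\<^bsub>C\<^esub> (a, \<zero>\<^bsub>L\<^esub>)"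
      using assms by (simp add: C_simps L.ract_closed)
    with assms show ?thesis
      by (simp add: C.m_assoc word_closed word_append L.ract_closed)
  qed
  show "tpow_ract A L (Suc n) U a \<in> carrier (tpow A L (Suc n))"
    unfolding tpow_ract_def by (rule tpow_extend_via_\<mu>(1)[OF hom gens word assms(2)])
  show "\<mu> (Suc n) (tpow_ract A L (Suc n) U a) = \<mu> (Suc n) U \<otimes>\<^bsub>C\<^esub> (a, \<zero>\<^bsub>L\<^esub>)"
    unfolding tpow_ract_def by (rule tpow_extend_via_\<mu>(2)[OF hom gens word assms(2)])
qed

lemma tpow_star:
  assumes "U \<in> carrier (tpow A L (Suc n))"
  shows "tpow_star A L st (Suc n) U \<in> carrier (tpow A L (Suc n))"
    and "\<mu> (Suc n) (tpow_star A L st (Suc n) U) = cst (\<mu> (Suc n) U)"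
proof -
  have gens: "rev (map st xs) \<in> tpow_gens L (Suc n)" if "xs \<in> tpow_gens L (Suc n)" for xs
    using that by (auto simp: tpow_gens_def)
  have word: "word (rev (map st xs)) = cst (word xs)" if "xs \<in> tpow_gens L (Suc n)" for xs
    using that by (intro word_star) (simp add: tpow_gens_def)
  show "tpow_star A L st (Suc n) U \<in> carrier (tpow A L (Suc n))"
    unfolding tpow_star_def by (rule tpow_extend_via_\<mu>(1)[OF cst_add_hom gens word assms])
  show "\<mu> (Suc n) (tpow_star A L st (Suc n) U) = cst (\<mu> (Suc n) U)"
    unfolding tpow_star_def by (rule tpow_extend_via_\<mu>(2)[OF cst_add_hom gens word assms])
qed

text \<open>Only the total length must be positive for \<open>\<mu>\<close> to be injective. The
  arbitrary second length accommodates the \<open>k - i\<close> in the product of the tensor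
  algebra.\<close>

lemma tpow_mult:
  assumes U: "U \<in> carrier (tpow A L (Suc m))" and W: "W \<in> carrier (tpow A L n)"
  shows "tpow_mult A L (Suc m) n U W \<in> carrier (tpow A L (Suc m + n))"
    and "\<mu> (Suc m + n) (tpow_mult A L (Suc m) n U W) = \<mu> (Suc m) U \<otimes>\<^bsub>C\<^esub> \<mu> n W"
proof -
  let ?\<beta> = "\<lambda>U W. \<mu> (Suc m) U \<otimes>\<^bsub>C\<^esub> \<mu> n W"
  let ?f = "\<lambda>xs ys. tpow_pure A L (Suc m + n) (xs @ ys)"
  have inj: "inj_on (\<mu> (Suc m + n)) (carrier (tpow A L (Suc m + n)))"
    using \<mu>_inj[of "m + n"] by simp
  have \<beta>1: "(\<lambda>U. ?\<beta> U W) \<in> add_hom (presented_group (tpow_gens L (Suc m)) (tpow_relators A L (Suc m))) C"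
    if "W \<in> carrier (presented_group (tpow_gens L n) (tpow_relators A L n))" for W
    using add_hom_compose[OF \<mu>_add_hom C_mult_right_add_hom[OF \<mu>_closed]] that by (simp add: tpow_def)
  have \<beta>2: "?\<beta> U \<in> add_hom (presented_group (tpow_gens L n) (tpow_relators A L n)) C"
    if "U \<in> carrier (presented_group (tpow_gens L (Suc m)) (tpow_relators A L (Suc m)))" for U
    using add_hom_compose[OF \<mu>_add_hom C_mult_left_add_hom[OF \<mu>_closed]] that by (simp add: tpow_def)
  have f: "?f xs ys \<in> carrier (tpow A L (Suc m + n))" if "xs \<in> tpow_gens L (Suc m)" "ys \<in> tpow_gens L n" for xs ys
    using that by (intro tpow_pure_closed) (simp add: tpow_gens_def)
  have eq: "\<mu> (Suc m + n) (?f xs ys) = ?\<beta> (generator_class (tpow_gens L (Suc m)) (tpow_relators A L (Suc m)) xs)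
      (generator_class (tpow_gens L n) (tpow_relators A L n) ys)"
    if "xs \<in> tpow_gens L (Suc m)" "ys \<in> tpow_gens L n" for xs ys
  proof -
    have "xs @ ys \<in> tpow_gens L (Suc m + n)"
      using that by (simp add: tpow_gens_def)
    then have "\<mu> (Suc m + n) (?f xs ys) = word xs \<otimes>\<^bsub>C\<^esub> word ys"
      using that by (subst \<mu>_pure) (simp_all add: tpow_gens_def word_append)
    then show ?thesis
      using \<mu>_pure[OF that(1)] \<mu>_pure[OF that(2)] by (simp add: tpow_pure_def)
  qed
  note * = extend_biadditively_via_embedding[OF tpow_relators_subset tpow_relators_subset abelian_group_tpow
      C.abelian_group_axioms \<mu>_add_hom inj \<beta>1 \<beta>2 f eq U[unfolded tpow_def] W[unfolded tpow_def]]
  show "tpow_mult A L (Suc m) n U W \<in> carrier (tpow A L (Suc m + n))"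
    unfolding tpow_mult_def by (rule *(1))
  show "\<mu> (Suc m + n) (tpow_mult A L (Suc m) n U W) = \<mu> (Suc m) U \<otimes>\<^bsub>C\<^esub> \<mu> n W"
    unfolding tpow_mult_def by (rule *(2))
qed

end


section \<open>The whole tensor algebra as polynomials\<close>

context star_line_module
begin

abbreviation "TA \<equiv> tensor_algebra A L st"

text \<open>Polynomial coefficients are indexed by degree, while \<open>t k\<close> has degree
  \<open>k + 1\<close>; degree 0 is \<open>A\<close> itself and not a tensor power.\<close>

definition tensor_poly :: "'a \<times> (nat \<Rightarrow> ('l list \<Rightarrow>\<^sub>0 int) set) \<Rightarrow> nat \<Rightarrow> 'a \<times> 'l"
  where "tensor_poly x n = (case n of 0 \<Rightarrow> (fst x, \<zero>\<^bsub>L\<^esub>) | Suc k \<Rightarrow> \<mu> (Suc k) (snd x k))"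

lemma tensor_poly_simps [simp]:
  "tensor_poly (a, t) 0 = (a, \<zero>\<^bsub>L\<^esub>)" "tensor_poly (a, t) (Suc k) = \<mu> (Suc k) (t k)"
  by (simp_all add: tensor_poly_def)

lemma TA_carrier_iff: "(a, t) \<in> carrier TA \<longleftrightarrow> a \<in> carrier A \<and>
    (\<forall>k. t k \<in> carrier (tpow A L (Suc k))) \<and> finite {k. t k \<noteq> \<zero>\<^bsub>tpow A L (Suc k)\<^esub>}"
  by (simp add: tensor_algebra_def)

text \<open>The tensor algebra treats products with a factor of degree 0 as module actions, apart
  from the products of positive degrees. The convolution has to be split in the same way.\<close>

lemma C_finsum_split_ends:
  assumes "\<And>i. g i \<in> carrier C"
  shows "(\<Oplus>\<^bsub>C\<^esub>i\<in>{..Suc k}. g i) = g 0 \<oplus>\<^bsub>C\<^esub> g (Suc k) \<oplus>\<^bsub>C\<^esub> (\<Oplus>\<^bsub>C\<^esub>i\<in>{..<k}. g (Suc i))"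
proof (cases k)
  case 0
  then show ?thesis
    using assms by (simp add: Pi_iff C.a_comm)
next
  case (Suc j)
  have "(\<Oplus>\<^bsub>C\<^esub>i\<in>{..Suc k}. g i) = g (Suc k) \<oplus>\<^bsub>C\<^esub> ((\<Oplus>\<^bsub>C\<^esub>i\<in>{..j}. g (Suc i)) \<oplus>\<^bsub>C\<^esub> g 0)"
    unfolding Suc using assms by (subst C.finsum_Suc, simp) (subst C.finsum_Suc2, simp_all)
  then show ?thesis
    using assms by (simp add: Suc lessThan_Suc_atMost C.a_ac)
qed

lemma tpow_finsum_closed:
  "(\<And>i. i \<in> I \<Longrightarrow> f i \<in> carrier (tpow A L n)) \<Longrightarrow> finsum (tpow A L n) f I \<in> carrier (tpow A L n)"
  using abelian_group_tpow[of n] by (intro abelian_monoid.finsum_closed) (auto simp: abelian_group.axioms)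

lemma tpow_a_closed:
  "\<lbrakk>U \<in> carrier (tpow A L n); W \<in> carrier (tpow A L n)\<rbrakk> \<Longrightarrow> U \<oplus>\<^bsub>tpow A L n\<^esub> W \<in> carrier (tpow A L n)"
  by (intro abelian_groupE(1) abelian_group_tpow)

lemma tpow_zero_closed: "\<zero>\<^bsub>tpow A L n\<^esub> \<in> carrier (tpow A L n)"
  by (intro abelian_groupE(2) abelian_group_tpow)

lemma \<mu>_add: "\<lbrakk>U \<in> carrier (tpow A L n); W \<in> carrier (tpow A L n)\<rbrakk> \<Longrightarrow>
    \<mu> n (U \<oplus>\<^bsub>tpow A L n\<^esub> W) = \<mu> n U \<oplus>\<^bsub>C\<^esub> \<mu> n W"
  by (rule add_hom_add[OF \<mu>_add_hom])

text \<open>Degree 0 is removed because it has no counterpart in \<open>t\<close>; one coefficient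
  does not affect finiteness.\<close>

lemma TA_finite_iff:
  assumes "\<And>k. t k \<in> carrier (tpow A L (Suc k))"
  shows "finite {k. t k \<noteq> \<zero>\<^bsub>tpow A L (Suc k)\<^esub>} \<longleftrightarrow> finite {n. tensor_poly (a, t) n \<noteq> \<zero>\<^bsub>C\<^esub>}"
proof -
  have "{n. tensor_poly (a, t) n \<noteq> \<zero>\<^bsub>C\<^esub>} - {0} = Suc ` {k. t k \<noteq> \<zero>\<^bsub>tpow A L (Suc k)\<^esub>}"
  proof (rule Set.set_eqI)
    show "n \<in> {n. tensor_poly (a, t) n \<noteq> \<zero>\<^bsub>C\<^esub>} - {0} \<longleftrightarrow> n \<in> Suc ` {k. t k \<noteq> \<zero>\<^bsub>tpow A L (Suc k)\<^esub>}" for n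
      using assms by (cases n) (auto simp: \<mu>_eq_zero_iff)
  qed
  moreover have "finite (Suc ` {k. t k \<noteq> \<zero>\<^bsub>tpow A L (Suc k)\<^esub>})
      \<longleftrightarrow> finite {k. t k \<noteq> \<zero>\<^bsub>tpow A L (Suc k)\<^esub>}"
    by (rule finite_image_iff) simp
  ultimately show ?thesis
    using finite_Diff2[of "{0}" "{n. tensor_poly (a, t) n \<noteq> \<zero>\<^bsub>C\<^esub>}"] by simp
qed

lemma tensor_poly_closed: "x \<in> carrier TA \<Longrightarrow> tensor_poly x \<in> carrier P"
proof (cases x)
  case (Pair a t)
  assume "x \<in> carrier TA"
  then have *: "a \<in> carrier A" "\<And>k. t k \<in> carrier (tpow A L (Suc k))"
    "finite {k. t k \<noteq> \<zero>\<^bsub>tpow A L (Suc k)\<^esub>}"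
    by (auto simp: Pair TA_carrier_iff)
  show ?thesis
    unfolding Pair
  proof (rule P_I)
    show "tensor_poly (a, t) n \<in> carrier C" for n
      using * by (cases n) (simp_all add: \<mu>_closed)
    show "finite {n. tensor_poly (a, t) n \<noteq> \<zero>\<^bsub>C\<^esub>}"
      using *(3) TA_finite_iff[OF *(2)] by simp
  qed
qed

text \<open>Finite support is inherited from the polynomial, so once the polynomial of a result has
  been identified, no separate support argument is needed.\<close>

lemma TA_I:
  assumes "a \<in> carrier A" "\<And>k. t k \<in> carrier (tpow A L (Suc k))" "f \<in> carrier P" "tensor_poly (a, t) = f"
  shows "(a, t) \<in> carrier TA"
  using assms P_finite[OF assms(3)] TA_finite_iff[of t a] by (simp add: TA_carrier_iff)

lemma TA_mult:
  assumes x: "x \<in> carrier TA" and y: "y \<in> carrier TA"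
  shows "x \<otimes>\<^bsub>TA\<^esub> y \<in> carrier TA" and "tensor_poly (x \<otimes>\<^bsub>TA\<^esub> y) = tensor_poly x \<otimes>\<^bsub>P\<^esub> tensor_poly y"
proof -
  obtain a s b t where xy: "x = (a, s)" "y = (b, t)"
    by (metis prod.exhaust)
  have [simp]: "a \<in> carrier A" "b \<in> carrier A" "s k \<in> carrier (tpow A L (Suc k))"
    "t k \<in> carrier (tpow A L (Suc k))" for k
    using x y by (simp_all add: xy TA_carrier_iff)
  let ?l = "\<lambda>k. tpow_lact A L (Suc k) a (t k)"
  let ?r = "\<lambda>k. tpow_ract A L (Suc k) (s k) b"
  let ?m = "\<lambda>k i. tpow_mult A L (Suc i) (k - i) (s i) (t (k - Suc i))"
  let ?u = "\<lambda>k. ?l k \<oplus>\<^bsub>tpow A L (Suc k)\<^esub> ?r k \<oplus>\<^bsub>tpow A L (Suc k)\<^esub> (\<Oplus>\<^bsub>tpow A L (Suc k)\<^esub>i\<in>{..<k}. ?m k i)"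
  have prod: "x \<otimes>\<^bsub>TA\<^esub> y = (a \<otimes>\<^bsub>A\<^esub> b, ?u)"
    by (simp add: xy tensor_algebra_def)
  \<comment> \<open>Index bookkeeping: \<open>t (k - Suc i)\<close> has degree \<open>k - i\<close>,
    and \<open>Suc i + (k - i)\<close> is \<open>Suc k\<close> because \<open>i < k\<close>.\<close>
  have m: "?m k i \<in> carrier (tpow A L (Suc k))"
    "\<mu> (Suc k) (?m k i) = \<mu> (Suc i) (s i) \<otimes>\<^bsub>C\<^esub> \<mu> (Suc k - Suc i) (t (k - Suc i))" if "i < k" for k i
  proof -
    have t: "t (k - Suc i) \<in> carrier (tpow A L (k - i))"
      using that \<open>t (k - Suc i) \<in> _\<close> by (simp add: Suc_diff_Suc)
    have k: "Suc i + (k - i) = Suc k"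
      using that by simp
    show "?m k i \<in> carrier (tpow A L (Suc k))"
      using tpow_mult(1)[of "s i" i "t (k - Suc i)" "k - i"] t unfolding k by simp
    show "\<mu> (Suc k) (?m k i) = \<mu> (Suc i) (s i) \<otimes>\<^bsub>C\<^esub> \<mu> (Suc k - Suc i) (t (k - Suc i))"
      using tpow_mult(2)[of "s i" i "t (k - Suc i)" "k - i"] t unfolding k by simp
  qed
  have u: "?u k \<in> carrier (tpow A L (Suc k))" for k
    by (intro tpow_a_closed tpow_finsum_closed) (auto simp: tpow_lact tpow_ract m)
  have P: "tensor_poly x \<in> carrier P" "tensor_poly y \<in> carrier P"
    using x y by (simp_all add: tensor_poly_closed)
  show eq: "tensor_poly (x \<otimes>\<^bsub>TA\<^esub> y) = tensor_poly x \<otimes>\<^bsub>P\<^esub> tensor_poly y"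
  proof
    fix n
    show "tensor_poly (x \<otimes>\<^bsub>TA\<^esub> y) n = (tensor_poly x \<otimes>\<^bsub>P\<^esub> tensor_poly y) n"
    proof (cases n)
      case 0
      then show ?thesis
        using P by (simp add: P_mult_apply prod) (simp add: xy C_simps)
    next
      \<comment> \<open>The end terms of the convolution are the two actions on \<open>t k\<close>
        and \<open>s k\<close>; the inner terms are the products \<open>?m k i\<close>.\<close>
      case (Suc k)
      have fin: "(\<Oplus>\<^bsub>tpow A L (Suc k)\<^esub>i\<in>{..<k}. ?m k i) \<in> carrier (tpow A L (Suc k))"
        by (intro tpow_finsum_closed) (simp add: m)
      have "(tensor_poly x \<otimes>\<^bsub>P\<^esub> tensor_poly y) n
          = (\<Oplus>\<^bsub>C\<^esub>i\<in>{..Suc k}. tensor_poly x i \<otimes>\<^bsub>C\<^esub> tensor_poly y (Suc k - i))"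
        using P by (simp add: P_mult_apply Suc)
      also have "\<dots> = (a, \<zero>\<^bsub>L\<^esub>) \<otimes>\<^bsub>C\<^esub> \<mu> (Suc k) (t k) \<oplus>\<^bsub>C\<^esub> \<mu> (Suc k) (s k) \<otimes>\<^bsub>C\<^esub> (b, \<zero>\<^bsub>L\<^esub>)
          \<oplus>\<^bsub>C\<^esub> (\<Oplus>\<^bsub>C\<^esub>i\<in>{..<k}. \<mu> (Suc i) (s i) \<otimes>\<^bsub>C\<^esub> tensor_poly y (Suc k - Suc i))"
        using P_closed[OF P(1)] P_closed[OF P(2)]
        by (subst C_finsum_split_ends) (simp_all add: xy)
      also have "(\<Oplus>\<^bsub>C\<^esub>i\<in>{..<k}. \<mu> (Suc i) (s i) \<otimes>\<^bsub>C\<^esub> tensor_poly y (Suc k - Suc i))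
          = (\<Oplus>\<^bsub>C\<^esub>i\<in>{..<k}. \<mu> (Suc k) (?m k i))"
      proof (intro C.finsum_cong' refl)
        fix i assume i: "i \<in> {..<k}"
        then have k: "Suc k - Suc i = Suc (k - Suc i)"
          by (simp add: Suc_diff_Suc)
        have "tensor_poly y (Suc k - Suc i) = \<mu> (Suc k - Suc i) (t (k - Suc i))"
          unfolding k by (simp add: xy)
        then show "\<mu> (Suc i) (s i) \<otimes>\<^bsub>C\<^esub> tensor_poly y (Suc k - Suc i) = \<mu> (Suc k) (?m k i)"
          using m(2)[of i k] i by simp
      qed (auto intro!: \<mu>_closed m)
      also have "\<dots> = \<mu> (Suc k) (\<Oplus>\<^bsub>tpow A L (Suc k)\<^esub>i\<in>{..<k}. ?m k i)"
        by (rule add_hom_finsum[OF abelian_group_tpow C.abelian_group_axioms \<mu>_add_hom, symmetric])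
          (auto intro!: m)
      also have "(a, \<zero>\<^bsub>L\<^esub>) \<otimes>\<^bsub>C\<^esub> \<mu> (Suc k) (t k) \<oplus>\<^bsub>C\<^esub> \<mu> (Suc k) (s k) \<otimes>\<^bsub>C\<^esub> (b, \<zero>\<^bsub>L\<^esub>) \<oplus>\<^bsub>C\<^esub> \<dots> = \<mu> (Suc k) (?u k)"
        using fin by (simp add: \<mu>_add tpow_a_closed tpow_lact tpow_ract)
      finally show ?thesis
        by (simp add: prod Suc)
    qed
  qed
  show "x \<otimes>\<^bsub>TA\<^esub> y \<in> carrier TA"
    using u P eq unfolding prod by (intro TA_I[of _ _ "tensor_poly x \<otimes>\<^bsub>P\<^esub> tensor_poly y"]) auto
qed

lemma graded_model_TA: "graded_model A L st G TA (tensor_algebra_degree A L st) tensor_poly"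
proof (intro graded_model.intro graded_model_axioms.intro star_line_module_axioms)
  have zero: "\<zero>\<^bsub>TA\<^esub> = (\<zero>\<^bsub>A\<^esub>, \<lambda>k. \<zero>\<^bsub>tpow A L (Suc k)\<^esub>)" and one: "\<one>\<^bsub>TA\<^esub> = (\<one>\<^bsub>A\<^esub>, \<lambda>k. \<zero>\<^bsub>tpow A L (Suc k)\<^esub>)"
    by (simp_all add: tensor_algebra_def)
  show "\<zero>\<^bsub>TA\<^esub> \<in> carrier TA" "\<one>\<^bsub>TA\<^esub> \<in> carrier TA"
    by (simp_all add: zero one TA_carrier_iff tpow_zero_closed)
  show "tensor_poly \<zero>\<^bsub>TA\<^esub> = \<zero>\<^bsub>P\<^esub>"
  proof
    show "tensor_poly \<zero>\<^bsub>TA\<^esub> n = \<zero>\<^bsub>P\<^esub> n" for n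
      by (cases n) (simp_all add: zero C_simps del: P_zero_apply, simp_all add: C_simps)
  qed
  show "tensor_poly \<one>\<^bsub>TA\<^esub> = \<one>\<^bsub>P\<^esub>"
  proof
    show "tensor_poly \<one>\<^bsub>TA\<^esub> n = \<one>\<^bsub>P\<^esub> n" for n
      by (cases n) (simp_all add: one P_one_apply C_simps)
  qed
  fix x assume x: "x \<in> carrier TA"
  obtain a s where x_eq: "x = (a, s)"
    by (cases x)
  have a: "a \<in> carrier A" and s: "\<And>k. s k \<in> carrier (tpow A L (Suc k))"
    using x by (simp_all add: x_eq TA_carrier_iff)
  note P = tensor_poly_closed[OF x]
  show "tensor_poly (c \<odot>\<^bsub>TA\<^esub> x) = P_smult c (tensor_poly x)" and "c \<odot>\<^bsub>TA\<^esub> x \<in> carrier TA" for c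
  proof -
    have smult: "c \<odot>\<^bsub>TA\<^esub> x = (c \<odot>\<^bsub>A\<^esub> a, \<lambda>k. tpow_lact A L (Suc k) (c \<odot>\<^bsub>A\<^esub> \<one>\<^bsub>A\<^esub>) (s k))"
      by (simp add: x_eq tensor_algebra_def)
    have scalar: "(c \<odot>\<^bsub>A\<^esub> \<one>\<^bsub>A\<^esub>, \<zero>\<^bsub>L\<^esub>) = c \<odot>\<^bsub>C\<^esub> \<one>\<^bsub>C\<^esub>"
      by (simp add: C_simps A.scalar_closed)
    show eq: "tensor_poly (c \<odot>\<^bsub>TA\<^esub> x) = P_smult c (tensor_poly x)"
    proof
      show "tensor_poly (c \<odot>\<^bsub>TA\<^esub> x) n = P_smult c (tensor_poly x) n" for n
        unfolding smult
        by (cases n) (simp_all add: P_smult_def x_eq a s tpow_lact A.scalar_closed scalar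
            C.scalar_mult_left \<mu>_closed, simp add: C_simps a A.scalar_closed)
    qed
    show "c \<odot>\<^bsub>TA\<^esub> x \<in> carrier TA"
      using eq unfolding smult by (intro TA_I[of _ _ "P_smult c (tensor_poly x)"])
        (simp_all add: P P_smult_closed tpow_lact A.scalar_closed A.smult_closed a s)
  qed
  show "tensor_poly (star TA x) = P_star (tensor_poly x)" and "star TA x \<in> carrier TA"
  proof -
    have star: "star TA x = (star A a, \<lambda>k. tpow_star A L st (Suc k) (s k))"
      by (simp add: x_eq tensor_algebra_def)
    have st_zero: "cst (a, \<zero>\<^bsub>L\<^esub>) = (star A a, \<zero>\<^bsub>L\<^esub>)"
      using add_hom_zero[of L L st] by (simp add: cst_def add_homI st_add)
    show eq: "tensor_poly (star TA x) = P_star (tensor_poly x)"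
    proof
      show "tensor_poly (star TA x) n = P_star (tensor_poly x) n" for n
        unfolding star by (cases n) (simp_all add: P_star_def x_eq s tpow_star st_zero)
    qed
    show "star TA x \<in> carrier TA"
      using eq unfolding star by (intro TA_I[of _ _ "P_star (tensor_poly x)"])
        (simp_all add: P P_star_closed tpow_star A.star_closed a s)
  qed
  fix y assume y: "y \<in> carrier TA"
  obtain b t where y_eq: "y = (b, t)"
    by (cases y)
  have b: "b \<in> carrier A" and t: "\<And>k. t k \<in> carrier (tpow A L (Suc k))"
    using y by (simp_all add: y_eq TA_carrier_iff)
  note P' = tensor_poly_closed[OF y]
  have add: "x \<oplus>\<^bsub>TA\<^esub> y = (a \<oplus>\<^bsub>A\<^esub> b, \<lambda>k. s k \<oplus>\<^bsub>tpow A L (Suc k)\<^esub> t k)"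
    by (simp add: x_eq y_eq tensor_algebra_def)
  show eq: "tensor_poly (x \<oplus>\<^bsub>TA\<^esub> y) = tensor_poly x \<oplus>\<^bsub>P\<^esub> tensor_poly y"
  proof
    show "tensor_poly (x \<oplus>\<^bsub>TA\<^esub> y) n = (tensor_poly x \<oplus>\<^bsub>P\<^esub> tensor_poly y) n" for n
      by (cases n) (simp_all add: P_add_apply P P' add, simp_all add: x_eq y_eq C_simps \<mu>_add s t)
  qed
  show "x \<oplus>\<^bsub>TA\<^esub> y \<in> carrier TA"
    using eq unfolding add by (intro TA_I[of _ _ "tensor_poly x \<oplus>\<^bsub>P\<^esub> tensor_poly y"])
      (simp_all add: P P' a b s t tpow_a_closed)
  show "x \<otimes>\<^bsub>TA\<^esub> y \<in> carrier TA" and "tensor_poly (x \<otimes>\<^bsub>TA\<^esub> y) = tensor_poly x \<otimes>\<^bsub>P\<^esub> tensor_poly y"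
    using x y by (rule TA_mult)+
next
  show "inj_on tensor_poly (carrier TA)"
  proof (rule inj_onI)
    fix x y assume x: "x \<in> carrier TA" and y: "y \<in> carrier TA" and eq: "tensor_poly x = tensor_poly y"
    obtain a s b t where xy: "x = (a, s)" "y = (b, t)"
      by (metis prod.exhaust)
    have "a = b"
      using fun_cong[OF eq, of 0] by (simp add: xy)
    moreover have "s = t"
    proof
      fix k
      show "s k = t k"
        using fun_cong[OF eq, of "Suc k"] x y inj_onD[OF \<mu>_inj, of k "s k" "t k"]
        by (simp add: xy TA_carrier_iff)
    qed
    ultimately show "x = y"
      by (simp add: xy)
  qed
  show "tensor_poly ` carrier TA = graded_polys"
  proof
    show "tensor_poly ` carrier TA \<subseteq> graded_polys"
    proof clarify
      fix a t assume x: "(a, t) \<in> carrier TA"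
      then have "tensor_poly (a, t) n \<in> even_odd_degree A L (of_nat n)" for n
        using \<mu>_degree[of "t (n - 1)" n]
        by (cases n) (auto simp: TA_carrier_iff even_odd_degree_def)
      then show "tensor_poly (a, t) \<in> graded_polys"
        using tensor_poly_closed[OF x] by (simp add: graded_polys_def)
    qed
    show "graded_polys \<subseteq> tensor_poly ` carrier TA"
    proof
      fix f assume f: "f \<in> graded_polys"
      then have deg: "f n \<in> even_odd_degree A L (of_nat n)" for n
        by (simp add: graded_polys_def)
      obtain a where a: "f 0 = (a, \<zero>\<^bsub>L\<^esub>)" "a \<in> carrier A"
        using deg[of 0] by (auto simp: even_odd_degree_def)
      have "\<exists>U. U \<in> carrier (tpow A L (Suc k)) \<and> \<mu> (Suc k) U = f (Suc k)" for k
        by (rule \<mu>_surj[OF deg[of "Suc k"]]) blast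
      then obtain t where t: "t k \<in> carrier (tpow A L (Suc k))" "\<mu> (Suc k) (t k) = f (Suc k)" for k
        by metis
      have eq: "tensor_poly (a, t) = f"
      proof
        show "tensor_poly (a, t) n = f n" for n
          using a t by (cases n) simp_all
      qed
      have "(a, t) \<in> carrier TA"
        using a t eq graded_polys_carrier[OF f] by (intro TA_I[of a t f])
      with eq show "f \<in> tensor_poly ` carrier TA"
        by blast
    qed
  qed
  show "tensor_algebra_degree A L st n = {x \<in> carrier TA. \<forall>m. m \<noteq> n \<longrightarrow> tensor_poly x m = \<zero>\<^bsub>C\<^esub>}" for n
  proof -
    have "x \<in> tensor_algebra_degree A L st n \<longleftrightarrow> (\<forall>m. m \<noteq> n \<longrightarrow> tensor_poly x m = \<zero>\<^bsub>C\<^esub>)"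
      if x: "x \<in> carrier TA" for x
    proof -
      obtain a t where x_eq: "x = (a, t)"
        by (cases x)
      have \<mu>: "\<mu> (Suc k) (t k) = \<zero>\<^bsub>C\<^esub> \<longleftrightarrow> t k = \<zero>\<^bsub>tpow A L (Suc k)\<^esub>" for k
        using x by (intro \<mu>_eq_zero_iff) (simp add: x_eq TA_carrier_iff)
      have zero: "(a, \<zero>\<^bsub>L\<^esub>) = \<zero>\<^bsub>C\<^esub> \<longleftrightarrow> a = \<zero>\<^bsub>A\<^esub>"
        by (simp add: C_simps)
      have split: "(\<forall>m. Q m) \<longleftrightarrow> Q 0 \<and> (\<forall>k. Q (Suc k))" for Q :: "nat \<Rightarrow> bool"
        by (metis nat.exhaust)
      show ?thesis
        using x zero unfolding x_eq by (cases n; subst split) (auto simp: \<mu>)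
    qed
    moreover have "tensor_algebra_degree A L st n \<subseteq> carrier TA"
      by (cases n) auto
    ultimately show ?thesis
      by blast
  qed
qed

end


section \<open>Polynomials with coefficients in a bimodule\<close>

lemma xi_eq_monom: "xi = Polynomial.monom 1 1"
  by (simp add: xi_def monom_Suc monom_0)

lemma xi_power: "xi ^ k = Polynomial.monom 1 k"
  by (simp add: xi_eq_monom monom_power)

lemma coeff_xi_mult: "Polynomial.coeff (xi * p) n = (case n of 0 \<Rightarrow> 0 | Suc k \<Rightarrow> Polynomial.coeff p k)"
  by (simp add: xi_def coeff_pCons)

text \<open>
  As \<open>\<xi>\<close> has degree 2, \<open>p(\<xi>)\<close> corresponds to \<open>p(t\<^sup>2)\<close> for the variable \<open>t\<close> that counts degrees.
\<close>

definition spread :: "complex poly \<Rightarrow> complex poly"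
  where "spread p = pcompose p (xi * xi)"

lemma spread_mult: "spread (p * q) = spread p * spread q"
  by (simp add: spread_def pcompose_mult)

lemma spread_xi: "spread xi = xi * xi"
  by (simp add: spread_def xi_def pcompose_pCons)

lemma coeff_spread: "Polynomial.coeff (spread p) n = (if even n then Polynomial.coeff p (n div 2) else 0)"
proof (induction p arbitrary: n)
  case 0
  then show ?case by (simp add: spread_def)
next
  case (pCons c p)
  have "spread (pCons c p) = [:c:] + xi * (xi * spread p)"
    by (simp add: spread_def pcompose_pCons mult.assoc)
  moreover have "Polynomial.coeff ([:c:] + xi * (xi * spread p)) n
      = (if even n then Polynomial.coeff (pCons c p) (n div 2) else 0)"
  proof (cases n)
    case 0
    then show ?thesis by (simp add: coeff_xi_mult)
  next
    case (Suc m)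
    then show ?thesis
      by (cases m) (simp_all add: coeff_xi_mult pCons.IH)
  qed
  ultimately show ?case by simp
qed

lemma poly_bimodule_simps:
  "carrier poly_bimodule = UNIV" "add poly_bimodule = (+)" "zero poly_bimodule = 0"
  "module.smult poly_bimodule = Polynomial.smult" "rsmult poly_bimodule = (\<lambda>p c. Polynomial.smult c p)"
  by (simp_all add: poly_bimodule_def)

lemma abelian_group_poly_bimodule: "abelian_group poly_bimodule"
  by (rule abelian_groupI) (auto simp: poly_bimodule_simps intro: exI[of _ "- x" for x])

lemma finsum_poly_bimodule: "finite I \<Longrightarrow> finsum poly_bimodule f I = sum f I"
proof (induction I rule: finite_induct)
  case empty
  interpret abelian_group poly_bimodule by (rule abelian_group_poly_bimodule)
  show ?case by (simp add: poly_bimodule_simps)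
next
  case (insert i I)
  interpret abelian_group poly_bimodule by (rule abelian_group_poly_bimodule)
  show ?case using insert by (simp add: poly_bimodule_simps finsum_insert)
qed

section \<open>The tensor product of a bimodule with the complex polynomials\<close>

context bimodule
begin

abbreviation "CM \<equiv> complex_restrict A M"
abbreviation "MP \<equiv> poly_tensor A M"

lemma CM_simps:
  "carrier CM = carrier M" "add CM = add M" "zero CM = zero M"
  "c \<odot>\<^bsub>CM\<^esub> x = (c \<odot>\<^bsub>A\<^esub> \<one>\<^bsub>A\<^esub>) \<odot>\<^bsub>M\<^esub> x" "x \<bullet>\<^bsub>CM\<^esub> c = x \<bullet>\<^bsub>M\<^esub> (c \<odot>\<^bsub>A\<^esub> \<one>\<^bsub>A\<^esub>)"
  by (simp_all add: complex_restrict_def)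

lemma abelian_group_CM: "abelian_group CM"
proof (rule abelian_groupI)
  show "\<exists>y\<in>carrier CM. y \<oplus>\<^bsub>CM\<^esub> x = \<zero>\<^bsub>CM\<^esub>" if "x \<in> carrier CM" for x
    using that M.l_neg[of x] by (auto simp: CM_simps intro!: bexI[of _ "\<ominus>\<^bsub>M\<^esub> x"])
qed (simp_all add: CM_simps M.a_ac)

lemma tensor_pair_poly: "tensor_pair complex_ring CM poly_bimodule"
  by (intro tensor_pair.intro tensor_pair_axioms.intro abelian_group_CM abelian_group_poly_bimodule)
    (auto simp: CM_simps poly_bimodule_simps ract_closed A.scalar_closed)

sublocale PT: tensor_pair complex_ring CM poly_bimodule
  rewrites "tensor complex_ring CM poly_bimodule \<equiv> MP" and "pure_tensor complex_ring CM poly_bimodule \<equiv> poly_pure A M"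
  by (rule tensor_pair_poly) (simp_all add: poly_tensor_def poly_pure_def)

text \<open>The coefficient at \<open>xi ^ k\<close> when the tensor product is read as polynomials
  over \<open>M\<close>. These additive coordinates determine an element, and every finitely
  supported family of them occurs.\<close>

definition poly_coeff :: "nat \<Rightarrow> ('m \<times> complex poly \<Rightarrow>\<^sub>0 int) set \<Rightarrow> 'm"
  where "poly_coeff k = extend_additively M (\<lambda>(x, p). (Polynomial.coeff p k \<odot>\<^bsub>A\<^esub> \<one>\<^bsub>A\<^esub>) \<odot>\<^bsub>M\<^esub> x)"

lemma poly_coeff_add_hom: "poly_coeff k \<in> add_hom MP M"
  and poly_coeff_pure: "x \<in> carrier M \<Longrightarrow>
    poly_coeff k (poly_pure A M x p) = (Polynomial.coeff p k \<odot>\<^bsub>A\<^esub> \<one>\<^bsub>A\<^esub>) \<odot>\<^bsub>M\<^esub> x"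
proof -
  let ?f = "\<lambda>(x, p). (Polynomial.coeff p k \<odot>\<^bsub>A\<^esub> \<one>\<^bsub>A\<^esub>) \<odot>\<^bsub>M\<^esub> x"
  have f: "?f (x, p) \<in> carrier M" if "x \<in> carrier CM" for x p
    using that by (simp add: CM_simps lact_closed A.scalar_closed)
  have add_left: "?f (x \<oplus>\<^bsub>CM\<^esub> x', p) = ?f (x, p) \<oplus>\<^bsub>M\<^esub> ?f (x', p)"
    if "x \<in> carrier CM" "x' \<in> carrier CM" for x x' p
    using that by (simp add: CM_simps lact_add A.scalar_closed)
  have add_right: "?f (x, p \<oplus>\<^bsub>poly_bimodule\<^esub> q) = ?f (x, p) \<oplus>\<^bsub>M\<^esub> ?f (x, q)"
    if "x \<in> carrier CM" for x p q
    using that by (simp add: CM_simps poly_bimodule_simps A.smult_add_scalar lact_add_scalar A.scalar_closed)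
  have balanced: "?f (x \<bullet>\<^bsub>CM\<^esub> c, p) = ?f (x, c \<odot>\<^bsub>poly_bimodule\<^esub> p)" if "x \<in> carrier CM" for x c p
    using that scalar_lact_assoc[of x "Polynomial.coeff p k" c]
    by (simp add: CM_simps poly_bimodule_simps mult.commute[of c] A.smult_mult flip: complex_central)
  show "poly_coeff k \<in> add_hom MP M"
    unfolding poly_coeff_def
    by (rule PT.tensor_extend(1)[OF M.abelian_group_axioms]) (rule f add_left add_right balanced, assumption+)+
  show "poly_coeff k (poly_pure A M x p) = (Polynomial.coeff p k \<odot>\<^bsub>A\<^esub> \<one>\<^bsub>A\<^esub>) \<odot>\<^bsub>M\<^esub> x"
    if "x \<in> carrier M"
    unfolding poly_coeff_def
    using PT.tensor_extend(2)[OF M.abelian_group_axioms, of ?f x p] f add_left add_right balanced that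
    by (simp add: CM_simps poly_bimodule_simps)
qed

lemma poly_coeff_closed: "U \<in> carrier MP \<Longrightarrow> poly_coeff k U \<in> carrier M"
  using poly_coeff_add_hom by (rule add_hom_closed)

lemma poly_pure_closed: "x \<in> carrier M \<Longrightarrow> poly_pure A M x p \<in> carrier MP"
  by (rule PT.pure_closed) (simp_all add: CM_simps poly_bimodule_simps)

lemma poly_pure_left_add_hom: "(\<lambda>x. poly_pure A M x p) \<in> add_hom M MP"
proof (rule add_homI)
  show "poly_pure A M (x \<oplus>\<^bsub>M\<^esub> y) p = poly_pure A M x p \<oplus>\<^bsub>MP\<^esub> poly_pure A M y p"
    if "x \<in> carrier M" "y \<in> carrier M" for x y
    using PT.pure_add_left[of x y p] that by (simp add: CM_simps poly_bimodule_simps)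
qed (rule poly_pure_closed)

lemma poly_pure_expand:
  assumes x: "x \<in> carrier M" and m: "Polynomial.degree p < m"
  shows "poly_pure A M x p = (\<Oplus>\<^bsub>MP\<^esub>k\<in>{..<m}. poly_pure A M ((Polynomial.coeff p k \<odot>\<^bsub>A\<^esub> \<one>\<^bsub>A\<^esub>) \<odot>\<^bsub>M\<^esub> x) (xi ^ k))"
proof -
  have hom: "poly_pure A M x \<in> add_hom poly_bimodule MP"
    using PT.pure_right_add_hom[of x] x by (simp add: CM_simps del: PT.add_hom_tensor)
  have "{..<m} = {..m - 1}"
    using m by auto
  then have "p = (\<Sum>k<m. Polynomial.monom (Polynomial.coeff p k) k)"
    using poly_as_sum_of_monoms'[of p "m - 1"] m by simp
  then have "poly_pure A M x p = poly_pure A M x (\<Oplus>\<^bsub>poly_bimodule\<^esub>k\<in>{..<m}. Polynomial.monom (Polynomial.coeff p k) k)"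
    by (simp add: finsum_poly_bimodule)
  also have "\<dots> = (\<Oplus>\<^bsub>MP\<^esub>k\<in>{..<m}. poly_pure A M x (Polynomial.monom (Polynomial.coeff p k) k))"
    by (rule add_hom_finsum[OF abelian_group_poly_bimodule PT.abelian_group_tensor hom])
      (simp add: poly_bimodule_simps)
  also have "\<dots> = (\<Oplus>\<^bsub>MP\<^esub>k\<in>{..<m}. poly_pure A M ((Polynomial.coeff p k \<odot>\<^bsub>A\<^esub> \<one>\<^bsub>A\<^esub>) \<odot>\<^bsub>M\<^esub> x) (xi ^ k))"
  proof (rule PT.T.finsum_cong')
    fix k
    \<comment> \<open>The complex coefficient of the monomial crosses the tensor sign and is
      absorbed into \<open>x\<close>.\<close>
    have "poly_pure A M (x \<bullet>\<^bsub>CM\<^esub> Polynomial.coeff p k) (xi ^ k)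
        = poly_pure A M x (Polynomial.coeff p k \<odot>\<^bsub>poly_bimodule\<^esub> xi ^ k)"
      using x by (intro PT.pure_balanced) (simp_all add: CM_simps poly_bimodule_simps ring_of_type_algebra_def)
    then show "poly_pure A M x (Polynomial.monom (Polynomial.coeff p k) k)
        = poly_pure A M ((Polynomial.coeff p k \<odot>\<^bsub>A\<^esub> \<one>\<^bsub>A\<^esub>) \<odot>\<^bsub>M\<^esub> x) (xi ^ k)"
      using x by (simp add: CM_simps poly_bimodule_simps xi_power smult_monom flip: complex_central)
  qed (use x in \<open>auto intro!: poly_pure_closed lact_closed A.scalar_closed\<close>)
  finally show ?thesis .
qed

text \<open>On pure tensors this expands the polynomial factor in monomials. All sufficiently large
  lengths are allowed so that two elements can be expanded to a common length.\<close>

lemma poly_tensor_expand: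
  assumes "U \<in> carrier MP"
  shows "\<exists>N. \<forall>m\<ge>N. U = (\<Oplus>\<^bsub>MP\<^esub>k\<in>{..<m}. poly_pure A M (poly_coeff k U) (xi ^ k)) \<and> poly_coeff m U = \<zero>\<^bsub>M\<^esub>"
  using assms
proof (induction U rule: PT.tensor_induct)
  case zero
  have "poly_coeff k \<zero>\<^bsub>MP\<^esub> = \<zero>\<^bsub>M\<^esub>" for k
    by (rule add_hom_zero[OF PT.abelian_group_tensor M.abelian_group_axioms poly_coeff_add_hom])
  moreover have "poly_pure A M \<zero>\<^bsub>M\<^esub> p = \<zero>\<^bsub>MP\<^esub>" for p
    by (rule add_hom_zero[OF M.abelian_group_axioms PT.abelian_group_tensor poly_pure_left_add_hom])
  ultimately show ?case by simp
next
  case (pure x p)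
  then have x: "x \<in> carrier M"
    by (simp add: CM_simps)
  show ?case
  proof (intro exI allI impI conjI)
    fix m assume m: "Suc (Polynomial.degree p) \<le> m"
    then show "poly_coeff m (poly_pure A M x p) = \<zero>\<^bsub>M\<^esub>"
      using x by (simp add: poly_coeff_pure coeff_eq_0 A.smult_scalar_zero)
    show "poly_pure A M x p = (\<Oplus>\<^bsub>MP\<^esub>k\<in>{..<m}. poly_pure A M (poly_coeff k (poly_pure A M x p)) (xi ^ k))"
      unfolding poly_coeff_pure[OF x] using m by (intro poly_pure_expand x) simp
  qed
next
  case (diff V W)
  then obtain N N' where V: "\<And>m. m \<ge> N \<Longrightarrow> V = (\<Oplus>\<^bsub>MP\<^esub>k\<in>{..<m}. poly_pure A M (poly_coeff k V) (xi ^ k)) \<and> poly_coeff m V = \<zero>\<^bsub>M\<^esub>"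
    and W: "\<And>m. m \<ge> N' \<Longrightarrow> W = (\<Oplus>\<^bsub>MP\<^esub>k\<in>{..<m}. poly_pure A M (poly_coeff k W) (xi ^ k)) \<and> poly_coeff m W = \<zero>\<^bsub>M\<^esub>"
    by blast
  have coeff: "poly_coeff k (V \<ominus>\<^bsub>MP\<^esub> W) = poly_coeff k V \<ominus>\<^bsub>M\<^esub> poly_coeff k W" for k
    using diff.hyps by (rule add_hom_minus[OF PT.abelian_group_tensor M.abelian_group_axioms poly_coeff_add_hom])
  have pure: "poly_pure A M (y \<ominus>\<^bsub>M\<^esub> z) p = poly_pure A M y p \<ominus>\<^bsub>MP\<^esub> poly_pure A M z p"
    if "y \<in> carrier M" "z \<in> carrier M" for y z p
    using that by (rule add_hom_minus[OF M.abelian_group_axioms PT.abelian_group_tensor poly_pure_left_add_hom])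
  show ?case
  proof (intro exI allI impI conjI)
    \<comment> \<open>Past both bounds the two expansions have the same length and are subtracted
      term by term.\<close>
    fix m assume m: "max N N' \<le> m"
    let ?v = "\<lambda>k. poly_pure A M (poly_coeff k V) (xi ^ k)" and ?w = "\<lambda>k. poly_pure A M (poly_coeff k W) (xi ^ k)"
    have closed: "?v k \<in> carrier MP" "?w k \<in> carrier MP" for k
      using diff.hyps by (auto intro: poly_pure_closed poly_coeff_closed)
    show "poly_coeff m (V \<ominus>\<^bsub>MP\<^esub> W) = \<zero>\<^bsub>M\<^esub>"
      using V[of m] W[of m] m by (simp add: coeff M.minus_eq_zero_iff)
    have neg: "(\<lambda>x. \<ominus>\<^bsub>MP\<^esub> x) \<in> add_hom MP MP"
      by (rule add_homI) (simp_all add: PT.T.minus_add del: PT.add_hom_tensor)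
    have "(\<Oplus>\<^bsub>MP\<^esub>k\<in>{..<m}. poly_pure A M (poly_coeff k (V \<ominus>\<^bsub>MP\<^esub> W)) (xi ^ k))
        = (\<Oplus>\<^bsub>MP\<^esub>k\<in>{..<m}. ?v k \<oplus>\<^bsub>MP\<^esub> (\<ominus>\<^bsub>MP\<^esub> ?w k))"
      unfolding coeff using diff.hyps closed
      by (intro PT.T.finsum_cong') (simp_all add: pure poly_coeff_closed a_minus_def[of MP])
    also have "\<dots> = (\<Oplus>\<^bsub>MP\<^esub>k\<in>{..<m}. ?v k) \<oplus>\<^bsub>MP\<^esub> (\<Oplus>\<^bsub>MP\<^esub>k\<in>{..<m}. \<ominus>\<^bsub>MP\<^esub> ?w k)"
      using closed by (intro PT.T.finsum_addf) auto
    also have "(\<Oplus>\<^bsub>MP\<^esub>k\<in>{..<m}. \<ominus>\<^bsub>MP\<^esub> ?w k) = \<ominus>\<^bsub>MP\<^esub> (\<Oplus>\<^bsub>MP\<^esub>k\<in>{..<m}. ?w k)"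
      using closed by (intro add_hom_finsum[OF PT.abelian_group_tensor PT.abelian_group_tensor neg, symmetric]) auto
    also have "(\<Oplus>\<^bsub>MP\<^esub>k\<in>{..<m}. ?v k) = V"
      using V[of m] m by simp
    also have "(\<Oplus>\<^bsub>MP\<^esub>k\<in>{..<m}. ?w k) = W"
      using W[of m] m by simp
    finally show "V \<ominus>\<^bsub>MP\<^esub> W = (\<Oplus>\<^bsub>MP\<^esub>k\<in>{..<m}. poly_pure A M (poly_coeff k (V \<ominus>\<^bsub>MP\<^esub> W)) (xi ^ k))"
      by (simp add: a_minus_def)
  qed
qed

lemma poly_coeff_finite:
  assumes "U \<in> carrier MP"
  shows "finite {k. poly_coeff k U \<noteq> \<zero>\<^bsub>M\<^esub>}"
proof -
  obtain N where "\<forall>m\<ge>N. poly_coeff m U = \<zero>\<^bsub>M\<^esub>"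
    using poly_tensor_expand[OF assms] by blast
  then have "{k. poly_coeff k U \<noteq> \<zero>\<^bsub>M\<^esub>} \<subseteq> {..<N}"
    by (auto simp: not_le[symmetric])
  then show ?thesis
    by (rule finite_subset) simp
qed

lemma poly_coeff_eqI:
  assumes U: "U \<in> carrier MP" and W: "W \<in> carrier MP"
    and eq: "\<And>k. poly_coeff k U = poly_coeff k W"
  shows "U = W"
proof -
  obtain N N' where "\<And>m. m \<ge> N \<Longrightarrow> U = (\<Oplus>\<^bsub>MP\<^esub>k\<in>{..<m}. poly_pure A M (poly_coeff k U) (xi ^ k))"
    and "\<And>m. m \<ge> N' \<Longrightarrow> W = (\<Oplus>\<^bsub>MP\<^esub>k\<in>{..<m}. poly_pure A M (poly_coeff k W) (xi ^ k))"
    using poly_tensor_expand[OF U] poly_tensor_expand[OF W] by blast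
  from this(1)[of "max N N'"] this(2)[of "max N N'"] show ?thesis
    by (simp add: eq)
qed

lemma poly_coeff_pure_power:
  "x \<in> carrier M \<Longrightarrow> poly_coeff j (poly_pure A M x (xi ^ k)) = (if j = k then x else \<zero>\<^bsub>M\<^esub>)"
  by (simp add: poly_coeff_pure xi_power A.smult_one A.smult_scalar_zero lact_one)

lemma poly_coeff_surj:
  assumes g: "\<And>k. g k \<in> carrier M" and fin: "finite {k. g k \<noteq> \<zero>\<^bsub>M\<^esub>}"
  obtains U where "U \<in> carrier MP" "\<And>k. poly_coeff k U = g k"
proof -
  let ?S = "{k. g k \<noteq> \<zero>\<^bsub>M\<^esub>}"
  let ?U = "\<Oplus>\<^bsub>MP\<^esub>k\<in>?S. poly_pure A M (g k) (xi ^ k)"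
  have "poly_coeff j ?U = g j" for j
  proof -
    have "poly_coeff j ?U = (\<Oplus>\<^bsub>M\<^esub>k\<in>?S. poly_coeff j (poly_pure A M (g k) (xi ^ k)))"
      using g by (intro add_hom_finsum[OF PT.abelian_group_tensor M.abelian_group_axioms poly_coeff_add_hom])
        (auto intro: poly_pure_closed)
    also have "\<dots> = (\<Oplus>\<^bsub>M\<^esub>k\<in>?S. if j = k then g k else \<zero>\<^bsub>M\<^esub>)"
      using g by (intro M.finsum_cong') (auto simp: poly_coeff_pure_power)
    also have "\<dots> = g j"
    proof (cases "j \<in> ?S")
      case True
      then show ?thesis
        using fin g by (subst M.add.finprod_singleton) auto
    next
      case False
      then have "(\<Oplus>\<^bsub>M\<^esub>k\<in>?S. if j = k then g k else \<zero>\<^bsub>M\<^esub>) = (\<Oplus>\<^bsub>M\<^esub>k\<in>?S. \<zero>\<^bsub>M\<^esub>)"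
        by (intro M.finsum_cong') auto
      with False show ?thesis by simp
    qed
    finally show ?thesis .
  qed
  moreover have "?U \<in> carrier MP"
    using g by (intro PT.T.finsum_closed) (auto intro: poly_pure_closed)
  ultimately show thesis
    by (intro that[of ?U])
qed

end


section \<open>The algebra generated by \<open>A\<close>, \<open>L\<close> and a central variable\<close>

lemma regular_bimodule_simps:
  "carrier (regular_bimodule A) = carrier A" "add (regular_bimodule A) = add A" "zero (regular_bimodule A) = zero A"
  "module.smult (regular_bimodule A) = monoid.mult A" "rsmult (regular_bimodule A) = monoid.mult A"
  by (simp_all add: regular_bimodule_def)

lemma (in ring) abelian_group_regular_bimodule: "abelian_group (regular_bimodule R)"
proof (rule abelian_groupI)
  show "\<exists>y\<in>carrier (regular_bimodule R). y \<oplus>\<^bsub>regular_bimodule R\<^esub> x = \<zero>\<^bsub>regular_bimodule R\<^esub>"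
    if "x \<in> carrier (regular_bimodule R)" for x
    using that l_neg[of x] by (auto simp: regular_bimodule_simps intro!: bexI[of _ "\<ominus> x"])
qed (simp_all add: regular_bimodule_simps a_ac)

lemma (in complex_algebra) bimodule_regular: "bimodule A (regular_bimodule A)"
  by (intro bimodule.intro bimodule_axioms.intro complex_algebra_axioms abelian_group_regular_bimodule)
    (simp_all add: regular_bimodule_simps l_distr r_distr m_assoc scalar_mult_left scalar_mult_right)

section \<open>The even and odd halves of the algebra with the central variable\<close>

context star_line_module
begin

abbreviation "R \<equiv> regular_bimodule A"

sublocale R: bimodule A R
  by (rule A.bimodule_regular)

abbreviation "AP \<equiv> poly_tensor A R"
abbreviation "LP \<equiv> poly_tensor A L"

definition constant_times :: "'a \<times> 'l \<Rightarrow> complex poly \<Rightarrow> nat \<Rightarrow> 'a \<times> 'l"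
  where "constant_times x p n = Polynomial.coeff p n \<odot>\<^bsub>C\<^esub> x"

lemma constant_times_closed: "x \<in> carrier C \<Longrightarrow> constant_times x p \<in> carrier P"
proof (rule P_I)
  assume x: "x \<in> carrier C"
  then have "{n. constant_times x p n \<noteq> \<zero>\<^bsub>C\<^esub>} \<subseteq> {..Polynomial.degree p}"
    by (auto simp: constant_times_def C.smult_scalar_zero intro: le_degree)
  then show "finite {n. constant_times x p n \<noteq> \<zero>\<^bsub>C\<^esub>}"
    by (rule finite_subset) simp
qed (simp add: constant_times_def C.smult_closed)

lemma C_sum_smult:
  assumes "x \<in> carrier C" "finite I"
  shows "(\<Oplus>\<^bsub>C\<^esub>i\<in>I. f i \<odot>\<^bsub>C\<^esub> x) = (\<Sum>i\<in>I. f i) \<odot>\<^bsub>C\<^esub> x"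
  using assms(2) assms(1)
  by (induction I rule: finite_induct) (simp_all add: C.smult_scalar_zero C.smult_add_scalar C.smult_closed)

text \<open>Complex coefficients commute with everything, so the constant factors and the complex
  polynomials multiply independently. Product formulas on pure tensors thereby reduce to one
  identity in \<open>C\<close> and one between complex polynomials.\<close>

lemma constant_times_mult:
  assumes x: "x \<in> carrier C" and y: "y \<in> carrier C"
  shows "constant_times x p \<otimes>\<^bsub>P\<^esub> constant_times y q = constant_times (x \<otimes>\<^bsub>C\<^esub> y) (p * q)"
proof
  fix n
  have "(constant_times x p \<otimes>\<^bsub>P\<^esub> constant_times y q) n
      = (\<Oplus>\<^bsub>C\<^esub>i\<in>{..n}. (Polynomial.coeff q (n - i) * Polynomial.coeff p i) \<odot>\<^bsub>C\<^esub> (x \<otimes>\<^bsub>C\<^esub> y))"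
    using x y by (simp add: P_mult_apply constant_times_closed)
      (simp add: constant_times_def C.smult_mult_left C.smult_mult_right C.smult_mult C.smult_closed)
  also have "\<dots> = (\<Sum>i\<le>n. Polynomial.coeff q (n - i) * Polynomial.coeff p i) \<odot>\<^bsub>C\<^esub> (x \<otimes>\<^bsub>C\<^esub> y)"
    using x y by (intro C_sum_smult) auto
  finally show "(constant_times x p \<otimes>\<^bsub>P\<^esub> constant_times y q) n = constant_times (x \<otimes>\<^bsub>C\<^esub> y) (p * q) n"
    by (simp add: constant_times_def coeff_mult mult.commute)
qed

text \<open>Halving the degree: \<open>a\<close> times \<open>xi ^ k\<close> sits in degree
  \<open>2 * k\<close>, and for \<open>odd_poly\<close> below \<open>e\<close> times
  \<open>xi ^ k\<close> sits in degree \<open>2 * k + 1\<close>.\<close>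

definition even_poly :: "('a \<times> complex poly \<Rightarrow>\<^sub>0 int) set \<Rightarrow> nat \<Rightarrow> 'a \<times> 'l"
  where "even_poly U n = (if even n then (R.poly_coeff (n div 2) U, \<zero>\<^bsub>L\<^esub>) else \<zero>\<^bsub>C\<^esub>)"

definition odd_poly :: "('l \<times> complex poly \<Rightarrow>\<^sub>0 int) set \<Rightarrow> nat \<Rightarrow> 'a \<times> 'l"
  where "odd_poly W n = (if even n then \<zero>\<^bsub>C\<^esub> else (\<zero>\<^bsub>A\<^esub>, L.poly_coeff (n div 2) W))"

lemma even_poly_coeff_closed: "U \<in> carrier AP \<Longrightarrow> R.poly_coeff k U \<in> carrier A"
  using R.poly_coeff_closed[of U k] by (simp add: regular_bimodule_simps)

lemma even_poly_closed: "U \<in> carrier AP \<Longrightarrow> even_poly U \<in> carrier P"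
proof (rule P_I)
  assume U: "U \<in> carrier AP"
  have "{n. even_poly U n \<noteq> \<zero>\<^bsub>C\<^esub>} \<subseteq> (\<lambda>k. 2 * k) ` {k. R.poly_coeff k U \<noteq> \<zero>\<^bsub>R\<^esub>}"
    by (auto simp: even_poly_def C_simps regular_bimodule_simps elim!: evenE split: if_splits)
  then show "finite {n. even_poly U n \<noteq> \<zero>\<^bsub>C\<^esub>}"
    using R.poly_coeff_finite[OF U] by (meson finite_imageI finite_subset)
qed (simp add: even_poly_def even_poly_coeff_closed)

lemma odd_poly_closed: "W \<in> carrier LP \<Longrightarrow> odd_poly W \<in> carrier P"
proof (rule P_I)
  assume W: "W \<in> carrier LP"
  have "{n. odd_poly W n \<noteq> \<zero>\<^bsub>C\<^esub>} \<subseteq> (\<lambda>k. 2 * k + 1) ` {k. L.poly_coeff k W \<noteq> \<zero>\<^bsub>L\<^esub>}"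
    by (auto simp: odd_poly_def C_simps elim!: oddE split: if_splits)
  then show "finite {n. odd_poly W n \<noteq> \<zero>\<^bsub>C\<^esub>}"
    using L.poly_coeff_finite[OF W] by (meson finite_imageI finite_subset)
qed (simp add: odd_poly_def L.poly_coeff_closed)

lemma even_poly_add_hom: "even_poly \<in> add_hom AP P"
proof (rule add_homI)
  fix U W assume *: "U \<in> carrier AP" "W \<in> carrier AP"
  show "even_poly (U \<oplus>\<^bsub>AP\<^esub> W) = even_poly U \<oplus>\<^bsub>P\<^esub> even_poly W"
    using * add_hom_add[OF R.poly_coeff_add_hom *]
    by (intro ext) (simp add: P_add_apply even_poly_closed, simp add: even_poly_def C_simps regular_bimodule_simps)
qed (rule even_poly_closed)

lemma odd_poly_add_hom: "odd_poly \<in> add_hom LP P"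
proof (rule add_homI)
  fix U W assume *: "U \<in> carrier LP" "W \<in> carrier LP"
  show "odd_poly (U \<oplus>\<^bsub>LP\<^esub> W) = odd_poly U \<oplus>\<^bsub>P\<^esub> odd_poly W"
    using * add_hom_add[OF L.poly_coeff_add_hom *]
    by (intro ext) (simp add: P_add_apply odd_poly_closed, simp add: odd_poly_def C_simps)
qed (rule odd_poly_closed)

lemma even_poly_inj: "inj_on even_poly (carrier AP)"
proof (rule inj_onI)
  fix U W assume *: "U \<in> carrier AP" "W \<in> carrier AP" and eq: "even_poly U = even_poly W"
  have "R.poly_coeff k U = R.poly_coeff k W" for k
    using fun_cong[OF eq, of "2 * k"] by (simp add: even_poly_def)
  with * show "U = W"
    by (rule R.poly_coeff_eqI)
qed

lemma odd_poly_inj: "inj_on odd_poly (carrier LP)"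
proof (rule inj_onI)
  fix U W assume *: "U \<in> carrier LP" "W \<in> carrier LP" and eq: "odd_poly U = odd_poly W"
  have "L.poly_coeff k U = L.poly_coeff k W" for k
    using fun_cong[OF eq, of "2 * k + 1"] by (simp add: odd_poly_def)
  with * show "U = W"
    by (rule L.poly_coeff_eqI)
qed

lemma even_poly_pure: "a \<in> carrier A \<Longrightarrow> even_poly (poly_pure A R a p) = constant_times (a, \<zero>\<^bsub>L\<^esub>) (spread p)"
  using R.poly_coeff_pure[of a _ p]
  by (intro ext) (simp add: even_poly_def constant_times_def coeff_spread regular_bimodule_simps C_simps
      A.scalar_mult_left A.scalar_closed A.smult_scalar_zero)

text \<open>On the right, \<open>xi\<close> is the variable that counts degrees and contributes the
  degree 1 of \<open>e\<close>; the central variable of degree 2 has become its square inside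
  \<open>spread\<close>.\<close>

lemma odd_poly_pure:
  assumes e: "e \<in> carrier L"
  shows "odd_poly (poly_pure A L e p) = constant_times (\<zero>\<^bsub>A\<^esub>, e) (xi * spread p)"
proof
  show "odd_poly (poly_pure A L e p) n = constant_times (\<zero>\<^bsub>A\<^esub>, e) (xi * spread p) n" for n
    using e by (cases n) (simp_all add: odd_poly_def constant_times_def L.poly_coeff_pure coeff_xi_mult coeff_spread
        C_simps A.smult_scalar_zero)
qed

lemma AP_pure_closed: "a \<in> carrier A \<Longrightarrow> poly_pure A R a p \<in> carrier AP"
  using R.poly_pure_closed[of a p] by (simp add: regular_bimodule_simps)

lemma abelian_group_AP: "abelian_group AP"
  by (rule R.PT.abelian_group_tensor)

lemma abelian_group_LP: "abelian_group LP"
  by (rule L.PT.abelian_group_tensor)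

lemma P_mult_right_add_hom: "g \<in> carrier P \<Longrightarrow> (\<lambda>f. f \<otimes>\<^bsub>P\<^esub> g) \<in> add_hom P P"
  by (rule add_homI) (simp_all add: P.l_distr)

lemma P_mult_left_add_hom: "f \<in> carrier P \<Longrightarrow> (\<lambda>g. f \<otimes>\<^bsub>P\<^esub> g) \<in> add_hom P P"
  by (rule add_homI) (simp_all add: P.r_distr)

text \<open>The two factors and the target are left open, so that all four products of even and odd
  halves are instances.\<close>

lemma poly_product:
  fixes M :: "('a, 'm) bimodule" and N :: "('a, 'n) bimodule" and Q :: "('q, 'z) ring_scheme"
  assumes M: "bimodule A M" and N: "bimodule A N" and Q: "abelian_group Q"
    and \<kappa>: "\<kappa> \<in> add_hom Q P" and inj: "inj_on \<kappa> (carrier Q)"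
    and g: "g \<in> add_hom (poly_tensor A M) P" and h: "h \<in> add_hom (poly_tensor A N) P"
    and f: "\<And>x p y q. \<lbrakk>x \<in> carrier M; y \<in> carrier N\<rbrakk> \<Longrightarrow> f (x, p) (y, q) \<in> carrier Q"
    and eq: "\<And>x p y q. \<lbrakk>x \<in> carrier M; y \<in> carrier N\<rbrakk> \<Longrightarrow>
      \<kappa> (f (x, p) (y, q)) = g (poly_pure A M x p) \<otimes>\<^bsub>P\<^esub> h (poly_pure A N y q)"
    and U: "U \<in> carrier (poly_tensor A M)" and W: "W \<in> carrier (poly_tensor A N)"
  shows "extend_biadditively Q f U W \<in> carrier Q"
    and "\<kappa> (extend_biadditively Q f U W) = g U \<otimes>\<^bsub>P\<^esub> h W"
proof -
  have carriers: "carrier (complex_restrict A M) = carrier M" "carrier (complex_restrict A N) = carrier N"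
    by (simp_all add: complex_restrict_def)
  have \<beta>1: "(\<lambda>U. g U \<otimes>\<^bsub>P\<^esub> h W) \<in> add_hom (poly_tensor A M) P" if "W \<in> carrier (poly_tensor A N)" for W
    using g P_mult_right_add_hom[OF add_hom_closed[OF h that]] by (rule add_hom_compose)
  have \<beta>2: "(\<lambda>W. g U \<otimes>\<^bsub>P\<^esub> h W) \<in> add_hom (poly_tensor A N) P" if "U \<in> carrier (poly_tensor A M)" for U
    using h P_mult_left_add_hom[OF add_hom_closed[OF g that]] by (rule add_hom_compose)
  note * = tensor_extend_biadditively_via_embedding[OF bimodule.tensor_pair_poly[OF M] bimodule.tensor_pair_poly[OF N]
      Q P.abelian_group_axioms \<kappa> inj, of "\<lambda>U W. g U \<otimes>\<^bsub>P\<^esub> h W" f U W,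
      folded poly_tensor_def poly_pure_def, unfolded carriers, OF \<beta>1 \<beta>2 f eq U W]
  show "extend_biadditively Q f U W \<in> carrier Q" "\<kappa> (extend_biadditively Q f U W) = g U \<otimes>\<^bsub>P\<^esub> h W"
    by (rule *; assumption)+
qed

abbreviation "LA \<equiv> line_poly_algebra A L st G"

definition line_poly :: "('a \<times> complex poly \<Rightarrow>\<^sub>0 int) set \<times> ('l \<times> complex poly \<Rightarrow>\<^sub>0 int) set \<Rightarrow> nat \<Rightarrow> 'a \<times> 'l"
  where "line_poly x = even_poly (fst x) \<oplus>\<^bsub>P\<^esub> odd_poly (snd x)"

lemma line_poly_apply:
  "\<lbrakk>U \<in> carrier AP; W \<in> carrier LP\<rbrakk> \<Longrightarrow> line_poly (U, W) n =
    (if even n then (R.poly_coeff (n div 2) U, \<zero>\<^bsub>L\<^esub>) else (\<zero>\<^bsub>A\<^esub>, L.poly_coeff (n div 2) W))"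
  by (simp add: line_poly_def P_add_apply even_poly_closed odd_poly_closed)
    (simp add: even_poly_def odd_poly_def even_poly_coeff_closed L.poly_coeff_closed C_simps)

lemma LA_simps:
  "carrier LA = carrier AP \<times> carrier LP"
  "\<zero>\<^bsub>LA\<^esub> = (\<zero>\<^bsub>AP\<^esub>, \<zero>\<^bsub>LP\<^esub>)"
  "\<one>\<^bsub>LA\<^esub> = (poly_pure A R \<one>\<^bsub>A\<^esub> 1, \<zero>\<^bsub>LP\<^esub>)"
  "(U, W) \<oplus>\<^bsub>LA\<^esub> (U', W') = (U \<oplus>\<^bsub>AP\<^esub> U', W \<oplus>\<^bsub>LP\<^esub> W')"
  "c \<odot>\<^bsub>LA\<^esub> (U, W) = (c \<odot>\<^bsub>AP\<^esub> U, c \<odot>\<^bsub>LP\<^esub> W)"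
  by (simp_all add: line_poly_algebra_def Let_def)

lemma even_poly_zero: "even_poly \<zero>\<^bsub>AP\<^esub> = \<zero>\<^bsub>P\<^esub>"
  by (rule add_hom_zero[OF abelian_group_AP P.abelian_group_axioms even_poly_add_hom])

lemma odd_poly_zero: "odd_poly \<zero>\<^bsub>LP\<^esub> = \<zero>\<^bsub>P\<^esub>"
  by (rule add_hom_zero[OF abelian_group_LP P.abelian_group_axioms odd_poly_add_hom])

lemma LA_mult:
  assumes x: "x \<in> carrier LA" and y: "y \<in> carrier LA"
  shows "x \<otimes>\<^bsub>LA\<^esub> y \<in> carrier LA" and "line_poly (x \<otimes>\<^bsub>LA\<^esub> y) = line_poly x \<otimes>\<^bsub>P\<^esub> line_poly y"
proof -
  obtain U W U' W' where xy: "x = (U, W)" "y = (U', W')"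
    by (metis prod.exhaust)
  have UW: "U \<in> carrier AP" "W \<in> carrier LP" "U' \<in> carrier AP" "W' \<in> carrier LP"
    using x y by (simp_all add: xy LA_simps)
  let ?UU = "extend_biadditively AP (\<lambda>(a, p) (b, q). poly_pure A R (a \<otimes>\<^bsub>A\<^esub> b) (p * q)) U U'"
  let ?WW = "extend_biadditively AP (\<lambda>(e, p) (f, q). poly_pure A R (pr e f) (xi * (p * q))) W W'"
  let ?UW = "extend_biadditively LP (\<lambda>(a, p) (f, q). poly_pure A L (a \<odot>\<^bsub>L\<^esub> f) (p * q)) U W'"
  let ?WU = "extend_biadditively LP (\<lambda>(e, p) (b, q). poly_pure A L (e \<bullet>\<^bsub>L\<^esub> b) (p * q)) W U'"
  have UU: "?UU \<in> carrier AP" "even_poly ?UU = even_poly U \<otimes>\<^bsub>P\<^esub> even_poly U'"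
    by (rule poly_product[OF R.bimodule_axioms R.bimodule_axioms abelian_group_AP even_poly_add_hom
          even_poly_inj even_poly_add_hom even_poly_add_hom _ _ UW(1,3)];
        simp add: regular_bimodule_simps AP_pure_closed even_poly_pure constant_times_mult C_simps spread_mult)+
  \<comment> \<open>Each odd factor carries one \<open>xi\<close> in the degree-counting variable;
    their product is \<open>spread xi\<close>, which accounts for the extra \<open>xi\<close> in the
    product of two elements of \<open>L\<close>.\<close>
  have WW: "?WW \<in> carrier AP" "even_poly ?WW = odd_poly W \<otimes>\<^bsub>P\<^esub> odd_poly W'"
    by (rule poly_product[OF L.bimodule_axioms L.bimodule_axioms abelian_group_AP even_poly_add_hom
          even_poly_inj odd_poly_add_hom odd_poly_add_hom _ _ UW(2,4)];
        simp add: regular_bimodule_simps AP_pure_closed even_poly_pure odd_poly_pure constant_times_mult C_simps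
          spread_mult spread_xi mult_ac)+
  have UW': "?UW \<in> carrier LP" "odd_poly ?UW = even_poly U \<otimes>\<^bsub>P\<^esub> odd_poly W'"
    by (rule poly_product[OF R.bimodule_axioms L.bimodule_axioms abelian_group_LP odd_poly_add_hom
          odd_poly_inj even_poly_add_hom odd_poly_add_hom _ _ UW(1,4)];
        simp add: regular_bimodule_simps L.poly_pure_closed L.lact_closed even_poly_pure odd_poly_pure
          constant_times_mult C_simps spread_mult mult_ac)+
  have WU: "?WU \<in> carrier LP" "odd_poly ?WU = odd_poly W \<otimes>\<^bsub>P\<^esub> even_poly U'"
    by (rule poly_product[OF L.bimodule_axioms R.bimodule_axioms abelian_group_LP odd_poly_add_hom
          odd_poly_inj odd_poly_add_hom even_poly_add_hom _ _ UW(2,3)];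
        simp add: regular_bimodule_simps L.poly_pure_closed L.ract_closed even_poly_pure odd_poly_pure
          constant_times_mult C_simps spread_mult mult_ac)+
  have prod: "x \<otimes>\<^bsub>LA\<^esub> y = (?UU \<oplus>\<^bsub>AP\<^esub> ?WW, ?UW \<oplus>\<^bsub>LP\<^esub> ?WU)"
    by (simp add: xy line_poly_algebra_def Let_def)
  show "x \<otimes>\<^bsub>LA\<^esub> y \<in> carrier LA"
    unfolding prod using UU WW UW' WU abelian_groupE(1)[OF abelian_group_AP] abelian_groupE(1)[OF abelian_group_LP]
    by (simp add: LA_simps)
  show "line_poly (x \<otimes>\<^bsub>LA\<^esub> y) = line_poly x \<otimes>\<^bsub>P\<^esub> line_poly y"
    unfolding prod using UU WW UW' WU UW even_poly_closed odd_poly_closed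
    by (simp add: xy line_poly_def add_hom_add[OF even_poly_add_hom] add_hom_add[OF odd_poly_add_hom] P.l_distr P.r_distr P.a_ac)
qed

text \<open>The one-variable counterpart, with \<theta> the action of a complex scalar or the star
  on polynomials.\<close>

lemma poly_extend:
  fixes M :: "('a, 'm) bimodule"
  assumes M: "bimodule A M"
    and \<kappa>: "\<kappa> \<in> add_hom (poly_tensor A M) P" and inj: "inj_on \<kappa> (carrier (poly_tensor A M))"
    and \<theta>: "\<theta> \<in> add_hom P P"
    and f: "\<And>x p. x \<in> carrier M \<Longrightarrow> f (x, p) \<in> carrier (poly_tensor A M)"
    and eq: "\<And>x p. x \<in> carrier M \<Longrightarrow> \<kappa> (f (x, p)) = \<theta> (\<kappa> (poly_pure A M x p))"
    and U: "U \<in> carrier (poly_tensor A M)"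
  shows "extend_additively (poly_tensor A M) f U \<in> carrier (poly_tensor A M)"
    and "\<kappa> (extend_additively (poly_tensor A M) f U) = \<theta> (\<kappa> U)"
proof -
  interpret M: bimodule A M by fact
  have f': "f (x, p) \<in> carrier (poly_tensor A M)" "\<kappa> (f (x, p)) = \<theta> (\<kappa> (poly_pure A M x p))"
    if "x \<in> carrier M.CM" for x p
    using that f eq by (simp_all add: M.CM_simps)
  note * = M.PT.tensor_extend_via_embedding[OF M.PT.abelian_group_tensor P.abelian_group_axioms \<kappa> inj
      add_hom_compose[OF \<kappa> \<theta>], of f]
  have "extend_additively (poly_tensor A M) f \<in> add_hom (poly_tensor A M) (poly_tensor A M)"
    by (rule *(1)) (rule f', assumption)+
  then show "extend_additively (poly_tensor A M) f U \<in> carrier (poly_tensor A M)"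
    using U by (rule add_hom_closed)
  show "\<kappa> (extend_additively (poly_tensor A M) f U) = \<theta> (\<kappa> U)"
    by (rule *(2)) (rule f' U, assumption?)+
qed

lemmas AP_extend = poly_extend[OF R.bimodule_axioms even_poly_add_hom even_poly_inj, unfolded regular_bimodule_simps]
lemmas LP_extend = poly_extend[OF L.bimodule_axioms odd_poly_add_hom odd_poly_inj]

lemma LA_smult:
  assumes U: "U \<in> carrier AP" and W: "W \<in> carrier LP"
  shows "c \<odot>\<^bsub>AP\<^esub> U \<in> carrier AP" "even_poly (c \<odot>\<^bsub>AP\<^esub> U) = P_smult c (even_poly U)"
    and "c \<odot>\<^bsub>LP\<^esub> W \<in> carrier LP" "odd_poly (c \<odot>\<^bsub>LP\<^esub> W) = P_smult c (odd_poly W)"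
proof -
  have smult: "P_smult c (constant_times x p) = constant_times (c \<odot>\<^bsub>C\<^esub> x) p" if "x \<in> carrier C" for x p
    using that by (intro ext) (simp add: P_smult_def constant_times_def mult.commute flip: C.smult_mult)
  show "c \<odot>\<^bsub>AP\<^esub> U \<in> carrier AP" "even_poly (c \<odot>\<^bsub>AP\<^esub> U) = P_smult c (even_poly U)"
    unfolding R.PT.tensor_smult
    by (rule AP_extend[OF P_smult_add_hom[of c] _ _ U]; simp add: R.CM_simps regular_bimodule_simps AP_pure_closed
        even_poly_pure smult A.scalar_closed A.scalar_mult_left A.smult_closed C_simps)+
  show "c \<odot>\<^bsub>LP\<^esub> W \<in> carrier LP" "odd_poly (c \<odot>\<^bsub>LP\<^esub> W) = P_smult c (odd_poly W)"
    unfolding L.PT.tensor_smult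
    by (rule LP_extend[OF P_smult_add_hom[of c] _ _ W]; simp add: L.CM_simps L.poly_pure_closed odd_poly_pure smult
        A.scalar_closed L.lact_closed C_simps)+
qed

lemma LA_star:
  assumes x: "x \<in> carrier LA"
  shows "star LA x \<in> carrier LA" and "line_poly (star LA x) = P_star (line_poly x)"
proof -
  obtain U W where x_eq: "x = (U, W)"
    by (cases x)
  have UW: "U \<in> carrier AP" "W \<in> carrier LP"
    using x by (simp_all add: x_eq LA_simps)
  \<comment> \<open>The variable is self-adjoint: conjugating coefficients commutes with doubling
    degrees and with shifting by one.\<close>
  have cnj: "spread (map_poly cnj p) = map_poly cnj (spread p)" "xi * map_poly cnj p = map_poly cnj (xi * p)" for p
    by (rule poly_eqI, simp add: coeff_spread coeff_map_poly coeff_xi_mult split: nat.split)+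
  have star: "P_star (constant_times y p) = constant_times (cst y) (map_poly cnj p)" if "y \<in> carrier C" for y p
    using that by (intro ext) (simp add: P_star_def constant_times_def cst_smult coeff_map_poly)
  have cst: "cst (a, \<zero>\<^bsub>L\<^esub>) = (star A a, \<zero>\<^bsub>L\<^esub>)" "cst (\<zero>\<^bsub>A\<^esub>, e) = (\<zero>\<^bsub>A\<^esub>, st e)" for a e
    using add_hom_zero[of L L st] add_hom_zero[OF _ _ A.star_add_hom] by (simp_all add: cst_def add_homI st_add)
  let ?U = "extend_additively AP (\<lambda>(a, p). poly_pure A R (star A a) (map_poly cnj p)) U"
  let ?W = "extend_additively LP (\<lambda>(e, p). poly_pure A L (st e) (map_poly cnj p)) W"
  have U: "?U \<in> carrier AP" "even_poly ?U = P_star (even_poly U)"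
    by (rule AP_extend[OF P_star_add_hom _ _ UW(1)]; simp add: AP_pure_closed even_poly_pure star
        A.star_closed cst cnj)+
  have W: "?W \<in> carrier LP" "odd_poly ?W = P_star (odd_poly W)"
    by (rule LP_extend[OF P_star_add_hom _ _ UW(2)]; simp add: L.poly_pure_closed odd_poly_pure star cst cnj)+
  have eq: "star LA x = (?U, ?W)"
    by (simp add: x_eq line_poly_algebra_def Let_def)
  show "star LA x \<in> carrier LA"
    unfolding eq using U W by (simp add: LA_simps)
  show "line_poly (star LA x) = P_star (line_poly x)"
    unfolding eq using U W UW
    by (simp add: x_eq line_poly_def P_star_add even_poly_closed odd_poly_closed)
qed

lemma line_poly_inj: "inj_on line_poly (carrier LA)"
proof (rule inj_onI)
  fix x y assume x: "x \<in> carrier LA" and y: "y \<in> carrier LA" and eq: "line_poly x = line_poly y"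
  obtain U W U' W' where xy: "x = (U, W)" "y = (U', W')"
    by (metis prod.exhaust)
  have UW: "U \<in> carrier AP" "W \<in> carrier LP" "U' \<in> carrier AP" "W' \<in> carrier LP"
    using x y by (simp_all add: xy LA_simps)
  have "R.poly_coeff k U = R.poly_coeff k U'" "L.poly_coeff k W = L.poly_coeff k W'" for k
    using fun_cong[OF eq, of "2 * k"] fun_cong[OF eq, of "2 * k + 1"] UW by (simp_all add: xy line_poly_apply)
  with UW show "x = y"
    by (simp add: xy R.poly_coeff_eqI L.poly_coeff_eqI)
qed

lemma line_poly_image: "line_poly ` carrier LA = graded_polys"
proof
  show "line_poly ` carrier LA \<subseteq> graded_polys"
  proof clarify
    fix U W assume "(U, W) \<in> carrier LA"
    then have UW: "U \<in> carrier AP" "W \<in> carrier LP"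
      by (simp_all add: LA_simps)
    then have "line_poly (U, W) n \<in> even_odd_degree A L (of_nat n)" for n
      by (cases "even n") (auto simp: line_poly_apply even_odd_degree_def even_poly_coeff_closed
          L.poly_coeff_closed elim!: evenE oddE)
    with UW show "line_poly (U, W) \<in> graded_polys"
      by (simp add: graded_polys_def line_poly_def even_poly_closed odd_poly_closed)
  qed
  show "graded_polys \<subseteq> line_poly ` carrier LA"
  proof
    fix f assume f: "f \<in> graded_polys"
    then have deg: "f n \<in> even_odd_degree A L (of_nat n)" for n
      by (simp add: graded_polys_def)
    have fin: "finite {n. f n \<noteq> \<zero>\<^bsub>C\<^esub>}"
      using P_finite[OF graded_polys_carrier[OF f]] .
    have even: "\<exists>a\<in>carrier A. f (2 * k) = (a, \<zero>\<^bsub>L\<^esub>)" for k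
      using deg[of "2 * k"] by (auto simp: even_odd_degree_def)
    have odd: "\<exists>e\<in>carrier L. f (2 * k + 1) = (\<zero>\<^bsub>A\<^esub>, e)" for k
      using deg[of "2 * k + 1"] by (auto simp: even_odd_degree_def)
    \<comment> \<open>The coefficients chosen for the even half have finite support because k to 2 k
      embeds it into the support of \<open>f\<close>.\<close>
    have fin_even: "finite {k. fst (f (2 * k)) \<noteq> \<zero>\<^bsub>R\<^esub>}"
    proof (rule finite_imageD[of "\<lambda>k. 2 * k"])
      show "finite ((\<lambda>k. 2 * k) ` {k. fst (f (2 * k)) \<noteq> \<zero>\<^bsub>R\<^esub>})"
        by (rule finite_subset[OF _ fin]) (auto simp: regular_bimodule_simps C_simps)
    qed (simp add: inj_on_def)
    have mem_even: "fst (f (2 * k)) \<in> carrier R" for k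
      using even[of k] by (auto simp: regular_bimodule_simps)
    obtain U where U: "U \<in> carrier AP" "\<And>k. R.poly_coeff k U = fst (f (2 * k))"
      using R.poly_coeff_surj[of "\<lambda>k. fst (f (2 * k))", OF mem_even fin_even] by blast
    have fin_odd: "finite {k. snd (f (2 * k + 1)) \<noteq> \<zero>\<^bsub>L\<^esub>}"
    proof (rule finite_imageD[of "\<lambda>k. 2 * k + 1"])
      show "finite ((\<lambda>k. 2 * k + 1) ` {k. snd (f (2 * k + 1)) \<noteq> \<zero>\<^bsub>L\<^esub>})"
        by (rule finite_subset[OF _ fin]) (auto simp: C_simps)
    qed (simp add: inj_on_def)
    have mem_odd: "snd (f (2 * k + 1)) \<in> carrier L" for k
      using odd[of k] by auto
    obtain W where W: "W \<in> carrier LP" "\<And>k. L.poly_coeff k W = snd (f (2 * k + 1))"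
      using L.poly_coeff_surj[of "\<lambda>k. snd (f (2 * k + 1))", OF mem_odd fin_odd] by blast
    have "line_poly (U, W) = f"
    proof
      show "line_poly (U, W) n = f n" for n
        using U W even[of "n div 2"] odd[of "n div 2"]
        by (cases "even n") (auto simp: line_poly_apply)
    qed
    with U(1) W(1) show "f \<in> line_poly ` carrier LA"
      by (force simp: LA_simps)
  qed
qed

text \<open>A polynomial concentrated in degree \<open>n\<close> leaves a single coordinate, at
  \<open>xi ^ (n div 2)\<close> in the half of the parity of \<open>n\<close>; as coordinates
  determine elements, what remains is one pure tensor.\<close>

lemma line_poly_degree_eq:
  "line_poly_degree A L n = {x \<in> carrier LA. \<forall>m. m \<noteq> n \<longrightarrow> line_poly x m = \<zero>\<^bsub>C\<^esub>}"
proof -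
  have zero: "R.poly_coeff k \<zero>\<^bsub>AP\<^esub> = \<zero>\<^bsub>A\<^esub>" "L.poly_coeff k \<zero>\<^bsub>LP\<^esub> = \<zero>\<^bsub>L\<^esub>" for k
    using add_hom_zero[OF abelian_group_AP R.M.abelian_group_axioms R.poly_coeff_add_hom]
      add_hom_zero[OF abelian_group_LP L.M.abelian_group_axioms L.poly_coeff_add_hom]
    by (simp_all add: regular_bimodule_simps)
  have closed: "\<zero>\<^bsub>AP\<^esub> \<in> carrier AP" "\<zero>\<^bsub>LP\<^esub> \<in> carrier LP"
    using abelian_groupE(2)[OF abelian_group_AP] abelian_groupE(2)[OF abelian_group_LP] .
  have R_coeff: "R.poly_coeff j (poly_pure A R a (xi ^ k)) = (if j = k then a else \<zero>\<^bsub>A\<^esub>)"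
    if "a \<in> carrier A" for j k a
    using that R.poly_coeff_pure_power[of a j k] by (simp add: regular_bimodule_simps)
  have half: "m = n" if "even m = even n" "m div 2 = n div 2" for m n :: nat
    using that by (metis dvd_mult_div_cancel odd_two_times_div_two_succ)
  show ?thesis
  proof
    show "line_poly_degree A L n \<subseteq> {x \<in> carrier LA. \<forall>m. m \<noteq> n \<longrightarrow> line_poly x m = \<zero>\<^bsub>C\<^esub>}"
      using half by (auto simp: line_poly_degree_def LA_simps closed AP_pure_closed L.poly_pure_closed line_poly_apply
          zero R_coeff L.poly_coeff_pure_power C_simps split: if_splits)
    show "{x \<in> carrier LA. \<forall>m. m \<noteq> n \<longrightarrow> line_poly x m = \<zero>\<^bsub>C\<^esub>} \<subseteq> line_poly_degree A L n"
    proof clarify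
      fix U W assume UW: "(U, W) \<in> carrier LA" and supp: "\<forall>m. m \<noteq> n \<longrightarrow> line_poly (U, W) m = \<zero>\<^bsub>C\<^esub>"
      then have [simp]: "U \<in> carrier AP" "W \<in> carrier LP"
        by (simp_all add: LA_simps)
      have [simp]: "R.poly_coeff k U \<in> carrier A" "L.poly_coeff k W \<in> carrier L" for k
        by (simp_all add: even_poly_coeff_closed L.poly_coeff_closed)
      have U0: "R.poly_coeff k U = \<zero>\<^bsub>A\<^esub>" if "2 * k \<noteq> n" for k
        using supp[rule_format, OF that] by (simp add: line_poly_apply C_simps)
      have W0: "L.poly_coeff k W = \<zero>\<^bsub>L\<^esub>" if "2 * k + 1 \<noteq> n" for k
        using supp[rule_format, OF that] by (simp add: line_poly_apply C_simps)
      show "(U, W) \<in> line_poly_degree A L n"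
      proof (cases "even n")
        case True
        have "U = poly_pure A R (R.poly_coeff (n div 2) U) (xi ^ (n div 2))"
          using U0 True by (intro R.poly_coeff_eqI) (auto simp: AP_pure_closed R_coeff)
        moreover have "W = \<zero>\<^bsub>LP\<^esub>"
        proof (intro L.poly_coeff_eqI)
          have "2 * k + 1 \<noteq> n" for k
            using True by auto
          then show "L.poly_coeff k W = L.poly_coeff k \<zero>\<^bsub>LP\<^esub>" for k
            by (simp add: W0 zero)
        qed (simp_all add: closed)
        ultimately show ?thesis
          using True by (auto simp: line_poly_degree_def)
      next
        case False
        have "W = poly_pure A L (L.poly_coeff (n div 2) W) (xi ^ (n div 2))"
          using W0 False by (intro L.poly_coeff_eqI) (auto simp: L.poly_pure_closed L.poly_coeff_pure_power)
        moreover have "U = \<zero>\<^bsub>AP\<^esub>"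
        proof (intro R.poly_coeff_eqI)
          have "2 * k \<noteq> n" for k
            using False by auto
          then show "R.poly_coeff k U = R.poly_coeff k \<zero>\<^bsub>AP\<^esub>" for k
            by (simp add: U0 zero)
        qed (simp_all add: closed)
        ultimately show ?thesis
          using False by (auto simp: line_poly_degree_def)
      qed
    qed
  qed
qed

lemma graded_model_LA: "graded_model A L st G LA (line_poly_degree A L) line_poly"
proof (intro graded_model.intro graded_model_axioms.intro star_line_module_axioms line_poly_inj line_poly_image
    line_poly_degree_eq)
  have closed: "\<zero>\<^bsub>AP\<^esub> \<in> carrier AP" "\<zero>\<^bsub>LP\<^esub> \<in> carrier LP"
    using abelian_groupE(2)[OF abelian_group_AP] abelian_groupE(2)[OF abelian_group_LP] .
  show "\<zero>\<^bsub>LA\<^esub> \<in> carrier LA" "\<one>\<^bsub>LA\<^esub> \<in> carrier LA"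
    by (simp_all add: LA_simps closed AP_pure_closed)
  show "line_poly \<zero>\<^bsub>LA\<^esub> = \<zero>\<^bsub>P\<^esub>"
    by (simp add: line_poly_def LA_simps even_poly_zero odd_poly_zero)
  have "spread 1 = 1"
    by (simp add: spread_def pcompose_1)
  then have "constant_times (\<one>\<^bsub>A\<^esub>, \<zero>\<^bsub>L\<^esub>) (spread 1) = \<one>\<^bsub>P\<^esub>"
    by (intro ext) (simp add: constant_times_def P_one_apply C.smult_one C.smult_scalar_zero flip: C_simps(3))
  then show "line_poly \<one>\<^bsub>LA\<^esub> = \<one>\<^bsub>P\<^esub>"
    by (simp add: line_poly_def LA_simps odd_poly_zero even_poly_pure)
  fix x assume x: "x \<in> carrier LA"
  then obtain U W where x_eq: "x = (U, W)" and UW: "U \<in> carrier AP" "W \<in> carrier LP"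
    by (auto simp: LA_simps)
  show "c \<odot>\<^bsub>LA\<^esub> x \<in> carrier LA" "line_poly (c \<odot>\<^bsub>LA\<^esub> x) = P_smult c (line_poly x)" for c
    using UW by (simp_all add: x_eq LA_simps LA_smult line_poly_def P_smult_add even_poly_closed odd_poly_closed)
  show "star LA x \<in> carrier LA" "line_poly (star LA x) = P_star (line_poly x)"
    using x by (rule LA_star)+
  fix y assume y: "y \<in> carrier LA"
  then obtain U' W' where y_eq: "y = (U', W')" and UW': "U' \<in> carrier AP" "W' \<in> carrier LP"
    by (auto simp: LA_simps)
  show "x \<oplus>\<^bsub>LA\<^esub> y \<in> carrier LA"
    using UW UW' abelian_groupE(1)[OF abelian_group_AP] abelian_groupE(1)[OF abelian_group_LP]
    by (simp add: x_eq y_eq LA_simps)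
  show "line_poly (x \<oplus>\<^bsub>LA\<^esub> y) = line_poly x \<oplus>\<^bsub>P\<^esub> line_poly y"
    using UW UW' even_poly_closed odd_poly_closed
    by (simp add: x_eq y_eq LA_simps line_poly_def add_hom_add[OF even_poly_add_hom]
        add_hom_add[OF odd_poly_add_hom] P.a_ac)
  show "x \<otimes>\<^bsub>LA\<^esub> y \<in> carrier LA" "line_poly (x \<otimes>\<^bsub>LA\<^esub> y) = line_poly x \<otimes>\<^bsub>P\<^esub> line_poly y"
    using x y by (rule LA_mult)+
qed

end


section \<open>The Hopf-Galois extension\<close>

lemma group_algebra_Z2_simps:
  "carrier group_algebra_Z2 = UNIV" "add group_algebra_Z2 = (+)" "zero group_algebra_Z2 = 0"
  "module.smult group_algebra_Z2 = (\<lambda>c. Poly_Mapping.map ((*) c))"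
  by (simp_all add: group_algebra_Z2_def)

lemma lookup_map_times: "Poly_Mapping.lookup (Poly_Mapping.map ((*) c) g) k = c * Poly_Mapping.lookup g k"
  for c :: complex
  by (simp add: map.rep_eq when_def)

lemma abelian_group_group_algebra_Z2: "abelian_group group_algebra_Z2"
  by (rule abelian_groupI) (auto simp: group_algebra_Z2_simps add_ac intro: exI[of _ "- x" for x])

lemma group_algebra_Z2_expand:
  "Poly_Mapping.map ((*) (Poly_Mapping.lookup g 0)) (Poly_Mapping.single 0 1)
    + Poly_Mapping.map ((*) (Poly_Mapping.lookup g 1)) (Poly_Mapping.single 1 1) = g"
  for g :: "bit \<Rightarrow>\<^sub>0 complex"
proof (rule poly_mapping_eqI)
  show "Poly_Mapping.lookup (Poly_Mapping.map ((*) (Poly_Mapping.lookup g 0)) (Poly_Mapping.single 0 1)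
      + Poly_Mapping.map ((*) (Poly_Mapping.lookup g 1)) (Poly_Mapping.single 1 1)) k = Poly_Mapping.lookup g k" for k
    by (cases k) (simp_all add: lookup_add lookup_map_times lookup_single lookup_one)
qed

section \<open>The grading of the even-odd algebra by parity\<close>

context star_line_module
begin

text \<open>A homogeneous decomposition sums over the support of \<open>f\<close>, which depends on
  \<open>f\<close>; the missing terms are zero and may be added.\<close>

lemma C_finsum_bit:
  fixes f :: "bit \<Rightarrow> 'a \<times> 'l"
  assumes "\<And>i. f i \<in> carrier C"
  shows "(\<Oplus>\<^bsub>C\<^esub>i\<in>{i. f i \<noteq> \<zero>\<^bsub>C\<^esub>}. f i) = f 0 \<oplus>\<^bsub>C\<^esub> f 1"
proof -
  have UNIV: "(UNIV :: bit set) = {0, 1}"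
    by (auto intro: bit.exhaust)
  have "(\<Oplus>\<^bsub>C\<^esub>i\<in>{i. f i \<noteq> \<zero>\<^bsub>C\<^esub>}. f i) = (\<Oplus>\<^bsub>C\<^esub>i\<in>{0, 1}. f i)"
  proof (rule C.add.finprod_mono_neutral_cong_left)
    show "{i. f i \<noteq> \<zero>\<^bsub>C\<^esub>} \<subseteq> {0, 1}"
      by (metis UNIV subset_UNIV)
  qed (use assms in auto)
  also have "\<dots> = f 0 \<oplus>\<^bsub>C\<^esub> f 1"
    using assms by simp
  finally show ?thesis .
qed

lemma C_decomposition_iff:
  assumes "(a, e) \<in> carrier C"
  shows "homogeneous_decomposition C (even_odd_degree A L) (a, e) f \<longleftrightarrow>
    f = (\<lambda>m. if m = 0 then (a, \<zero>\<^bsub>L\<^esub>) else (\<zero>\<^bsub>A\<^esub>, e))" (is "_ \<longleftrightarrow> f = ?f")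
proof
  assume "homogeneous_decomposition C (even_odd_degree A L) (a, e) f"
  then have f: "\<And>i. f i \<in> even_odd_degree A L i"
    and sum: "(a, e) = (\<Oplus>\<^bsub>C\<^esub>i\<in>{i. f i \<noteq> \<zero>\<^bsub>C\<^esub>}. f i)"
    by (auto simp: homogeneous_decomposition_def)
  have "(a, e) = f 0 \<oplus>\<^bsub>C\<^esub> f 1"
    using f even_odd_degree_subset unfolding sum by (intro C_finsum_bit) blast
  then show "f = ?f"
    using f[of 0] f[of 1] by (intro ext) (auto simp: even_odd_degree_def C_simps)
next
  assume f: "f = ?f"
  have closed: "f i \<in> carrier C" for i
    using assms by (simp add: f)
  have "finite {i. f i \<noteq> \<zero>\<^bsub>C\<^esub>}"
    by (rule finite_subset[of _ "{0, 1}"]) (auto intro: bit.exhaust)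
  moreover have "(a, e) = (\<Oplus>\<^bsub>C\<^esub>i\<in>{i. f i \<noteq> \<zero>\<^bsub>C\<^esub>}. f i)"
    using assms by (simp add: C_finsum_bit[OF closed]) (simp add: f C_simps)
  moreover have "f i \<in> even_odd_degree A L i" for i
    using assms by (simp add: f even_odd_degree_def)
  ultimately show "homogeneous_decomposition C (even_odd_degree A L) (a, e) f"
    by (simp add: homogeneous_decomposition_def)
qed

lemma homogeneous_component_C:
  "(a, e) \<in> carrier C \<Longrightarrow> homogeneous_component C (even_odd_degree A L) m (a, e)
    = (if m = 0 then (a, \<zero>\<^bsub>L\<^esub>) else (\<zero>\<^bsub>A\<^esub>, e))"
proof -
  assume "(a, e) \<in> carrier C"
  then have "homogeneous_decomposition C (even_odd_degree A L) (a, e)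
      = (\<lambda>f. f = (\<lambda>m. if m = 0 then (a, \<zero>\<^bsub>L\<^esub>) else (\<zero>\<^bsub>A\<^esub>, e)))"
    by (intro ext C_decomposition_iff)
  then show ?thesis
    by (simp add: homogeneous_component_def)
qed

lemma graded_algebra_C: "graded_algebra C (even_odd_degree A L)"
proof (intro graded_algebra.intro graded_algebra_axioms.intro complex_algebra_C even_odd_degree_submodule
    even_odd_degree_mult)
  show "\<one>\<^bsub>C\<^esub> \<in> even_odd_degree A L 0"
    by (simp add: even_odd_degree_def C_simps)
  show "\<exists>!f. homogeneous_decomposition C (even_odd_degree A L) x f" if "x \<in> carrier C" for x
    using that by (cases x) (simp add: C_decomposition_iff)
qed

section \<open>The canonical map and its inverse\<close>

abbreviation "C0 \<equiv> C\<lparr>carrier := even_odd_degree A L 0\<rparr>"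
abbreviation "RC \<equiv> regular_bimodule C"

sublocale RC: bimodule C RC
  by (rule C.bimodule_regular)

lemma tensor_pair_C0: "tensor_pair C0 RC RC"
  using even_odd_degree_subset[of 0]
  by (intro tensor_pair.intro tensor_pair_axioms.intro C.abelian_group_regular_bimodule)
    (auto simp: regular_bimodule_simps)

lemma tensor_pair_Z2: "tensor_pair complex_ring RC.CM group_algebra_Z2"
  by (intro tensor_pair.intro tensor_pair_axioms.intro RC.abelian_group_CM abelian_group_group_algebra_Z2)
    (auto simp: RC.CM_simps group_algebra_Z2_simps regular_bimodule_simps C.smult_closed)

text \<open>The canonical map after the candidate inverse multiplies the w_i and u_i back together
  to 1, with the odd u_i producing the odd group element. In the other order, the odd part of
  \<open>y\<close> times w_i is even and crosses the tensor sign over \<open>C0\<close>, where the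
  partition of unity restores that part.\<close>

lemma bij_canonical_map:
  "bij_betw (canonical_map C (even_odd_degree A L)) (carrier (tensor C0 RC RC))
    (carrier (tensor complex_ring RC.CM group_algebra_Z2))"
proof -
  interpret X: tensor_pair C0 RC RC
    by (rule tensor_pair_C0)
  interpret Y: tensor_pair complex_ring RC.CM group_algebra_Z2
    by (rule tensor_pair_Z2)
  obtain n w u where w [simp]: "\<And>i. i < n \<Longrightarrow> w i \<in> carrier L" and u [simp]: "\<And>i. i < n \<Longrightarrow> u i \<in> carrier L"
    and unit: "\<And>x. x \<in> carrier C \<Longrightarrow>
      (\<Oplus>\<^bsub>C\<^esub>i\<in>{..<n::nat}. x \<otimes>\<^bsub>C\<^esub> (\<zero>\<^bsub>A\<^esub>, w i) \<otimes>\<^bsub>C\<^esub> (\<zero>\<^bsub>A\<^esub>, u i)) = x"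
    by (rule C_partition_of_unity) blast
  let ?e = "\<lambda>m. Poly_Mapping.single m 1 :: bit \<Rightarrow>\<^sub>0 complex"
  have X_left: "(\<lambda>x. X.pure x y) \<in> add_hom C X.T" if "y \<in> carrier C" for y
    using that X.pure_add_left[of _ _ y] X.pure_closed[of _ y]
    by (intro add_homI) (simp_all add: regular_bimodule_simps)
  have X_right: "X.pure x \<in> add_hom C X.T" if "x \<in> carrier C" for x
    using that X.pure_add_right[of x] X.pure_closed[of x]
    by (intro add_homI) (simp_all add: regular_bimodule_simps)
  have X_balanced: "X.pure (x \<otimes>\<^bsub>C\<^esub> z) y = X.pure x (z \<otimes>\<^bsub>C\<^esub> y)"
    if "x \<in> carrier C" "y \<in> carrier C" "z \<in> even_odd_degree A L 0" for x y z
    using that X.pure_balanced[of x z y] by (simp add: regular_bimodule_simps)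
  have Y_left: "(\<lambda>x. Y.pure x g) \<in> add_hom C Y.T" for g
    using Y.pure_add_left[of _ _ g] Y.pure_closed[of _ g]
    by (intro add_homI) (simp_all add: RC.CM_simps regular_bimodule_simps group_algebra_Z2_simps)
  have Y_right: "Y.pure x \<in> add_hom group_algebra_Z2 Y.T" if "x \<in> carrier C" for x
    using that Y.pure_add_right[of x] Y.pure_closed[of x]
    by (intro add_homI) (simp_all add: RC.CM_simps regular_bimodule_simps group_algebra_Z2_simps)
  have Y_balanced: "Y.pure (c \<odot>\<^bsub>C\<^esub> x) g = Y.pure x (Poly_Mapping.map ((*) c) g)" if "x \<in> carrier C" for x c g
    using that Y.pure_balanced[of x c g]
    by (simp add: RC.CM_simps regular_bimodule_simps group_algebra_Z2_simps ring_of_type_algebra_def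
        C.scalar_mult_right)
  have Y_zero: "Y.pure \<zero>\<^bsub>C\<^esub> g = \<zero>\<^bsub>Y.T\<^esub>" for g
    by (rule add_hom_zero[OF C.abelian_group_axioms Y.abelian_group_tensor Y_left])
  have Y_closed [simp]: "Y.pure x g \<in> carrier Y.T" if "x \<in> carrier C" for x g
    using that Y_left by (rule add_hom_closed[rotated])
  have X_closed [simp]: "X.pure x y \<in> carrier X.T" if "x \<in> carrier C" "y \<in> carrier C" for x y
    using that by (intro X.pure_closed) (simp_all add: regular_bimodule_simps)

  \<comment> \<open>The homogeneous components as explicit projections: unlike
    \<open>homogeneous_component\<close>, which uses \<open>THE\<close>, they are visibly
    additive.\<close>
  define p :: "bit \<Rightarrow> 'a \<times> 'l \<Rightarrow> 'a \<times> 'l"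
    where "p m y = (if m = 0 then (fst y, \<zero>\<^bsub>L\<^esub>) else (\<zero>\<^bsub>A\<^esub>, snd y))" for m y
  have p_hom: "p m \<in> add_hom C C" for m
    by (rule add_homI) (auto simp: p_def C_simps C_carrier)
  have p_closed [simp]: "p m y \<in> carrier C" if "y \<in> carrier C" for m y
    using p_hom that by (rule add_hom_closed)
  have p_sum: "p 0 y \<oplus>\<^bsub>C\<^esub> p 1 y = y" if "y \<in> carrier C" for y
    using that by (auto simp: p_def C_simps C_carrier)
  \<comment> \<open>Even factors on the left respect parity; this yields balance of the canonical
    map over \<open>C0\<close>.\<close>
  have p_left: "p m (z \<otimes>\<^bsub>C\<^esub> y) = z \<otimes>\<^bsub>C\<^esub> p m y" if "z \<in> even_odd_degree A L 0" "y \<in> carrier C" for m y z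
    using that by (auto simp: p_def C_simps C_carrier even_odd_degree_def L.lact_closed)
  let ?can = "canonical_map C (even_odd_degree A L)"
  let ?f = "\<lambda>(x, y). \<Oplus>\<^bsub>Y.T\<^esub>m\<in>UNIV. Y.pure (x \<otimes>\<^bsub>C\<^esub> homogeneous_component C (even_odd_degree A L) m y) (?e m)"
  \<comment> \<open>The sum over the two elements of \<open>bit\<close> written out;
    \<open>?g\<close> replaces \<open>?f\<close> wherever additivity or balance is checked.\<close>
  let ?g = "\<lambda>x y. Y.pure (x \<otimes>\<^bsub>C\<^esub> p 0 y) (?e 0) \<oplus>\<^bsub>Y.T\<^esub> Y.pure (x \<otimes>\<^bsub>C\<^esub> p 1 y) (?e 1)"
  have f_eq: "?f (x, y) = ?g x y" if "x \<in> carrier C" "y \<in> carrier C" for x y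
  proof -
    have UNIV: "(UNIV :: bit set) = {0, 1}"
      by (auto intro: bit.exhaust)
    have "homogeneous_component C (even_odd_degree A L) m y = p m y" for m
      using that by (cases y) (simp add: homogeneous_component_C p_def)
    then show ?thesis
      using that by (simp add: UNIV)
  qed
  have can_eq: "?can = extend_additively Y.T ?f"
    by (simp add: canonical_map_def Let_def)
  have g_left: "(\<lambda>x. ?g x y) \<in> add_hom C Y.T" if "y \<in> carrier C" for y
    using that by (intro add_hom_pointwise_add[OF C.abelian_group_axioms Y.abelian_group_tensor]
        add_hom_compose[OF C_mult_right_add_hom Y_left]) simp_all
  have g_right: "?g x \<in> add_hom C Y.T" if "x \<in> carrier C" for x
    using that by (intro add_hom_pointwise_add[OF C.abelian_group_axioms Y.abelian_group_tensor]
        add_hom_compose[OF p_hom add_hom_compose[OF C_mult_left_add_hom Y_left]]) simp_all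
  have g_balanced: "?g (x \<otimes>\<^bsub>C\<^esub> z) y = ?g x (z \<otimes>\<^bsub>C\<^esub> y)"
    if "x \<in> carrier C" "y \<in> carrier C" "z \<in> even_odd_degree A L 0" for x y z
    using that subsetD[OF even_odd_degree_subset that(3)] by (simp add: p_left C.m_assoc)
  have can_hom: "?can \<in> add_hom X.T Y.T"
    and can_pure: "\<And>x y. \<lbrakk>x \<in> carrier C; y \<in> carrier C\<rbrakk> \<Longrightarrow> ?can (X.pure x y) = ?g x y"
  proof -
    have z: "z \<in> even_odd_degree A L 0 \<Longrightarrow> z \<in> carrier C" for z
      using even_odd_degree_subset by blast
    have f_closed: "?f (x, y) \<in> carrier Y.T" if "x \<in> carrier RC" "y \<in> carrier RC" for x y
      using that f_eq[of x y] by (simp add: regular_bimodule_simps)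
    have f_left: "?f (x \<oplus>\<^bsub>RC\<^esub> x', y) = ?f (x, y) \<oplus>\<^bsub>Y.T\<^esub> ?f (x', y)"
      if "x \<in> carrier RC" "x' \<in> carrier RC" "y \<in> carrier RC" for x x' y
      using that f_eq[of x y] f_eq[of x' y] f_eq[of "x \<oplus>\<^bsub>C\<^esub> x'" y] add_hom_add[OF g_left, of y x x']
      by (simp only: regular_bimodule_simps C.a_closed simp_thms)
    have f_right: "?f (x, y \<oplus>\<^bsub>RC\<^esub> y') = ?f (x, y) \<oplus>\<^bsub>Y.T\<^esub> ?f (x, y')"
      if "x \<in> carrier RC" "y \<in> carrier RC" "y' \<in> carrier RC" for x y y'
      using that f_eq[of x y] f_eq[of x y'] f_eq[of x "y \<oplus>\<^bsub>C\<^esub> y'"] add_hom_add[OF g_right, of x y y']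
      by (simp only: regular_bimodule_simps C.a_closed simp_thms)
    have f_balanced: "?f (x \<bullet>\<^bsub>RC\<^esub> z, y) = ?f (x, z \<odot>\<^bsub>RC\<^esub> y)"
      if "x \<in> carrier RC" "z \<in> carrier C0" "y \<in> carrier RC" for x y z
    proof -
      have "x \<in> carrier C" "y \<in> carrier C" "z \<in> carrier C" "z \<in> even_odd_degree A L 0"
        using that z by (simp_all add: regular_bimodule_simps)
      then show ?thesis
        using f_eq[of "x \<otimes>\<^bsub>C\<^esub> z" y] f_eq[of x "z \<otimes>\<^bsub>C\<^esub> y"] g_balanced[of x y z]
        by (simp only: regular_bimodule_simps C.m_closed simp_thms)
    qed
    show "?can \<in> add_hom X.T Y.T"
      unfolding can_eq
      by (rule X.tensor_extend(1)[OF Y.abelian_group_tensor]) (rule f_closed f_left f_right f_balanced, assumption+)+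
    show "?can (X.pure x y) = ?g x y" if "x \<in> carrier C" "y \<in> carrier C" for x y
    proof -
      have "?can (X.pure x y) = ?f (x, y)"
        unfolding can_eq
        by (rule X.tensor_extend(2)[OF Y.abelian_group_tensor])
          ((rule f_closed f_left f_right f_balanced, assumption+)+, use that in \<open>simp_all add: regular_bimodule_simps\<close>)
      with that show ?thesis
        by (simp only: f_eq)
    qed
  qed

  \<comment> \<open>The inverse on the two basis elements of the group algebra. For the even one,
    \<open>x \<otimes> \<one>\<close> suffices because 1 is even.\<close>
  define T0 where "T0 x = X.pure x \<one>\<^bsub>C\<^esub>" for x
  define T1 where "T1 x = (\<Oplus>\<^bsub>X.T\<^esub>i\<in>{..<n}. X.pure (x \<otimes>\<^bsub>C\<^esub> (\<zero>\<^bsub>A\<^esub>, w i)) (\<zero>\<^bsub>A\<^esub>, u i))" for x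
  have T0: "T0 \<in> add_hom C X.T"
    unfolding T0_def[abs_def] by (rule X_left) simp
  have T1: "T1 \<in> add_hom C X.T"
    unfolding T1_def[abs_def]
    by (intro add_hom_finsum_pointwise[OF C.abelian_group_axioms X.abelian_group_tensor]
        add_hom_compose[OF C_mult_right_add_hom X_left]) simp_all
  \<comment> \<open>A general element of the group algebra enters through its two coordinates, which
    are moved onto \<open>x\<close> as scalars.\<close>
  let ?h = "\<lambda>(x, g). T0 (Poly_Mapping.lookup g 0 \<odot>\<^bsub>C\<^esub> x) \<oplus>\<^bsub>X.T\<^esub> T1 (Poly_Mapping.lookup g 1 \<odot>\<^bsub>C\<^esub> x)"
  let ?inv = "extend_additively X.T ?h"
  note T_closed = add_hom_closed[OF T0] add_hom_closed[OF T1]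
  have h_left: "?h (x \<oplus>\<^bsub>C\<^esub> x', g) = ?h (x, g) \<oplus>\<^bsub>X.T\<^esub> ?h (x', g)" if "x \<in> carrier C" "x' \<in> carrier C" for x x' g
    using that by (simp add: C.smult_add C.smult_closed add_hom_add[OF T0] add_hom_add[OF T1] T_closed X.T.a_ac)
  have h_right: "?h (x, g + g') = ?h (x, g) \<oplus>\<^bsub>X.T\<^esub> ?h (x, g')" if "x \<in> carrier C" for x g g'
    using that by (simp add: lookup_add C.smult_add_scalar C.smult_closed add_hom_add[OF T0] add_hom_add[OF T1]
        T_closed X.T.a_ac)
  have h_balanced: "?h (c \<odot>\<^bsub>C\<^esub> x, g) = ?h (x, Poly_Mapping.map ((*) c) g)" if "x \<in> carrier C" for x c g
    using that by (simp add: lookup_map_times mult.commute[of c] C.smult_mult)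
  have inv_hom: "?inv \<in> add_hom Y.T X.T"
    and inv_pure: "\<And>x g. x \<in> carrier C \<Longrightarrow> ?inv (Y.pure x g) = ?h (x, g)"
  proof -
    have closed: "?h (x, g) \<in> carrier X.T" if "x \<in> carrier RC.CM" for x g
      using that by (simp add: RC.CM_simps regular_bimodule_simps T_closed C.smult_closed)
    have left: "?h (x \<oplus>\<^bsub>RC.CM\<^esub> x', g) = ?h (x, g) \<oplus>\<^bsub>X.T\<^esub> ?h (x', g)"
      if "x \<in> carrier RC.CM" "x' \<in> carrier RC.CM" for x x' g
      using h_left[of x x' g] that by (simp only: RC.CM_simps regular_bimodule_simps)
    have right: "?h (x, g \<oplus>\<^bsub>group_algebra_Z2\<^esub> g') = ?h (x, g) \<oplus>\<^bsub>X.T\<^esub> ?h (x, g')"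
      if "x \<in> carrier RC.CM" for x g g'
      using h_right[of x g g'] that by (simp only: RC.CM_simps regular_bimodule_simps group_algebra_Z2_simps)
    have balanced: "?h (x \<bullet>\<^bsub>RC.CM\<^esub> c, g) = ?h (x, c \<odot>\<^bsub>group_algebra_Z2\<^esub> g)" if "x \<in> carrier RC.CM" for x c g
      using h_balanced[of x c g] that C.scalar_mult_right[of x c]
      by (simp only: RC.CM_simps regular_bimodule_simps group_algebra_Z2_simps)
    show "?inv \<in> add_hom Y.T X.T"
      by (rule Y.tensor_extend(1)[OF X.abelian_group_tensor]) (rule closed left right balanced, assumption+)+
    show "?inv (Y.pure x g) = ?h (x, g)" if "x \<in> carrier C" for x g
      by (rule Y.tensor_extend(2)[OF X.abelian_group_tensor])
        ((rule closed left right balanced, assumption+)+,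
          use that in \<open>simp_all add: RC.CM_simps regular_bimodule_simps group_algebra_Z2_simps\<close>)
  qed

  have can_T0: "?can (T0 x) = Y.pure x (?e 0)" if "x \<in> carrier C" for x
  proof -
    have "p 0 \<one>\<^bsub>C\<^esub> = \<one>\<^bsub>C\<^esub>" "p 1 \<one>\<^bsub>C\<^esub> = \<zero>\<^bsub>C\<^esub>"
      by (simp_all add: p_def C_simps)
    with that show ?thesis
      by (simp add: T0_def can_pure Y_zero)
  qed
  have can_T1: "?can (T1 x) = Y.pure x (?e 1)" if x: "x \<in> carrier C" for x
  proof -
    have p: "p 0 (\<zero>\<^bsub>A\<^esub>, e) = \<zero>\<^bsub>C\<^esub>" "p 1 (\<zero>\<^bsub>A\<^esub>, e) = (\<zero>\<^bsub>A\<^esub>, e)" for e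
      by (simp_all add: p_def C_simps)
    have "?can (T1 x) = (\<Oplus>\<^bsub>Y.T\<^esub>i\<in>{..<n}. ?can (X.pure (x \<otimes>\<^bsub>C\<^esub> (\<zero>\<^bsub>A\<^esub>, w i)) (\<zero>\<^bsub>A\<^esub>, u i)))"
      unfolding T1_def using x
      by (intro add_hom_finsum[OF X.abelian_group_tensor Y.abelian_group_tensor can_hom]) simp
    also have "\<dots> = (\<Oplus>\<^bsub>Y.T\<^esub>i\<in>{..<n}. Y.pure (x \<otimes>\<^bsub>C\<^esub> (\<zero>\<^bsub>A\<^esub>, w i) \<otimes>\<^bsub>C\<^esub> (\<zero>\<^bsub>A\<^esub>, u i)) (?e 1))"
      using x by (intro Y.T.finsum_cong') (simp_all add: can_pure p Y_zero)
    also have "\<dots> = Y.pure (\<Oplus>\<^bsub>C\<^esub>i\<in>{..<n}. x \<otimes>\<^bsub>C\<^esub> (\<zero>\<^bsub>A\<^esub>, w i) \<otimes>\<^bsub>C\<^esub> (\<zero>\<^bsub>A\<^esub>, u i)) (?e 1)"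
      using x by (intro add_hom_finsum[OF C.abelian_group_axioms Y.abelian_group_tensor Y_left, symmetric]) simp
    finally show ?thesis
      using x by (simp add: unit)
  qed
  have can_inv: "?can (?inv V) = V" if V: "V \<in> carrier Y.T" for V
  proof (rule Y.tensor_hom_eqI[OF Y.abelian_group_tensor add_hom_compose[OF inv_hom can_hom] add_hom_id _ V])
    fix x and g :: "bit \<Rightarrow>\<^sub>0 complex"
    assume "x \<in> carrier RC.CM"
    then have x: "x \<in> carrier C"
      by (simp add: RC.CM_simps regular_bimodule_simps)
    let ?c = "\<lambda>m. Poly_Mapping.lookup g m"
    have "?can (?inv (Y.pure x g)) = Y.pure (?c 0 \<odot>\<^bsub>C\<^esub> x) (?e 0) \<oplus>\<^bsub>Y.T\<^esub> Y.pure (?c 1 \<odot>\<^bsub>C\<^esub> x) (?e 1)"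
      using x by (simp add: inv_pure add_hom_add[OF can_hom] T_closed C.smult_closed can_T0 can_T1)
    also have "\<dots> = Y.pure x (Poly_Mapping.map ((*) (?c 0)) (?e 0) + Poly_Mapping.map ((*) (?c 1)) (?e 1))"
      using x add_hom_add[OF Y_right[OF x]] by (simp add: Y_balanced group_algebra_Z2_simps)
    finally show "?can (?inv (Y.pure x g)) = Y.pure x g"
      by (simp only: group_algebra_Z2_expand)
  qed
  have inv_can: "?inv (?can V) = V" if V: "V \<in> carrier X.T" for V
  proof (rule X.tensor_hom_eqI[OF X.abelian_group_tensor add_hom_compose[OF can_hom inv_hom] add_hom_id _ V])
    fix x y assume "x \<in> carrier RC" "y \<in> carrier RC"
    then have x: "x \<in> carrier C" and y: "y \<in> carrier C"
      by (simp_all add: regular_bimodule_simps)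
    have T_zero: "T0 \<zero>\<^bsub>C\<^esub> = \<zero>\<^bsub>X.T\<^esub>" "T1 \<zero>\<^bsub>C\<^esub> = \<zero>\<^bsub>X.T\<^esub>"
      using add_hom_zero[OF C.abelian_group_axioms X.abelian_group_tensor T0]
        add_hom_zero[OF C.abelian_group_axioms X.abelian_group_tensor T1] .
    have inv: "?inv (Y.pure z (?e 0)) = T0 z" "?inv (Y.pure z (?e 1)) = T1 z" if "z \<in> carrier C" for z
      using that by (simp_all add: inv_pure lookup_single lookup_one C.smult_one C.smult_scalar_zero T_zero T_closed)
    have p0: "p 0 y \<in> even_odd_degree A L 0"
      using y by (auto simp: p_def even_odd_degree_def C_carrier)
    \<comment> \<open>Odd times odd is even, so this factor lies in \<open>C0\<close> and can be
      moved to the other side of the tensor sign.\<close>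
    have p1: "p 1 y \<otimes>\<^bsub>C\<^esub> (\<zero>\<^bsub>A\<^esub>, w i) \<in> even_odd_degree A L 0" if "i < n" for i
      using y that by (auto simp: p_def even_odd_degree_def C_carrier C_simps)
    have "T0 (x \<otimes>\<^bsub>C\<^esub> p 0 y) = X.pure x (p 0 y)"
      using x y p0 by (simp add: T0_def X_balanced)
    moreover have "T1 (x \<otimes>\<^bsub>C\<^esub> p 1 y) = X.pure x (p 1 y)"
    proof -
      have "T1 (x \<otimes>\<^bsub>C\<^esub> p 1 y)
          = (\<Oplus>\<^bsub>X.T\<^esub>i\<in>{..<n}. X.pure x (p 1 y \<otimes>\<^bsub>C\<^esub> (\<zero>\<^bsub>A\<^esub>, w i) \<otimes>\<^bsub>C\<^esub> (\<zero>\<^bsub>A\<^esub>, u i)))"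
        unfolding T1_def using x y p1
        by (intro X.T.finsum_cong') (simp_all add: C.m_assoc[of x] X_balanced)
      also have "\<dots> = X.pure x (\<Oplus>\<^bsub>C\<^esub>i\<in>{..<n}. p 1 y \<otimes>\<^bsub>C\<^esub> (\<zero>\<^bsub>A\<^esub>, w i) \<otimes>\<^bsub>C\<^esub> (\<zero>\<^bsub>A\<^esub>, u i))"
        using y by (intro add_hom_finsum[OF C.abelian_group_axioms X.abelian_group_tensor X_right[OF x], symmetric]) simp
      finally show ?thesis
        using y by (simp add: unit)
    qed
    ultimately have "?inv (?can (X.pure x y)) = X.pure x (p 0 y) \<oplus>\<^bsub>X.T\<^esub> X.pure x (p 1 y)"
      using x y by (simp add: can_pure add_hom_add[OF inv_hom] inv del: single_one)
    also have "\<dots> = X.pure x (p 0 y \<oplus>\<^bsub>C\<^esub> p 1 y)"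
      using y by (intro add_hom_add[OF X_right[OF x], symmetric]) simp_all
    finally show "?inv (?can (X.pure x y)) = X.pure x y"
      using y by (simp add: p_sum)
  qed
  show ?thesis
    by (rule bij_betw_byWitness[where f' = ?inv])
      (auto simp: can_inv inv_can intro: add_hom_closed[OF can_hom] add_hom_closed[OF inv_hom])
qed

lemma hopf_galois_C: "hopf_galois_Z2 C (even_odd_degree A L)"
  unfolding hopf_galois_Z2_def using graded_algebra_C bij_canonical_map by blast

text \<open>\<open>hopf_galois_Z2\<close> speaks of an extension of the degree 0 part; this
  identifies that part with \<open>A\<close>.\<close>

lemma even_part_iso: "(\<lambda>a. (a, \<zero>\<^bsub>L\<^esub>)) \<in> ring_iso A C0"
proof -
  have "(\<lambda>a. (a, \<zero>\<^bsub>L\<^esub>)) \<in> ring_hom A C0"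
    by (rule ring_hom_memI) (simp_all add: even_odd_degree_def C_simps)
  moreover have "bij_betw (\<lambda>a. (a, \<zero>\<^bsub>L\<^esub>)) (carrier A) (carrier C0)"
    by (auto simp: bij_betw_def inj_on_def even_odd_degree_def)
  ultimately show ?thesis
    by (simp add: ring_iso_def)
qed

end

theorem theorem12p10:
  fixes A :: "'a star_algebra"
    and L :: "('a, 'l) bimodule"
    and st :: "'l \<Rightarrow> 'l"
    and G :: "'l \<Rightarrow> 'l \<Rightarrow> 'a"
  assumes "star_algebra A"
    and "left_line_module A L"
    and "star_operation A L st"
    and "hermitian_metric A L G"
    and "star_compatible A L st G"
  shows "(star_algebra (tensor_algebra A L st) \<and>
      graded_algebra (tensor_algebra A L st) (tensor_algebra_degree A L st) \<and>
      star_algebra (line_poly_algebra A L st G) \<and>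
      graded_algebra (line_poly_algebra A L st G) (line_poly_degree A L) \<and>
      (\<exists>h. graded_star_algebra_iso
        (tensor_algebra A L st) (tensor_algebra_degree A L st)
        (line_poly_algebra A L st G) (line_poly_degree A L) h)) \<and>
    (hopf_galois_Z2 (even_odd_algebra A L st G) (even_odd_degree A L) \<and>
      (\<lambda>a. (a, \<zero>\<^bsub>L\<^esub>)) \<in> ring_iso A
        ((even_odd_algebra A L st G)\<lparr>carrier := even_odd_degree A L 0\<rparr>))"
proof -
  interpret star_line_module A L st G
    using assms by (intro star_line_module.intro star_line_module_axioms.intro) (simp_all add: left_line_module_def)
  show ?thesis
    using graded_model.star_algebra_T[OF graded_model_TA] graded_model.graded_algebra_T[OF graded_model_TA]
      graded_model.star_algebra_T[OF graded_model_LA] graded_model.graded_algebra_T[OF graded_model_LA]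
      graded_models_iso[OF graded_model_TA graded_model_LA] hopf_galois_C even_part_iso
    by blast
qed

end
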